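(* Fix an integer $e\ge 3$, and let $E\to\mathbb{P}^1$ be the vector bundle $\mathcal{O}_{\mathbb{P}^1}(e)\oplus\mathcal{O}_{\mathbb{P}^1}(e+1)$. Let $V\subset H^0(\mathbb{P}^1,E)$ be a general subspace of dimension four. Then the coherent system $(E,V)$ is generated and linearly stable, but the dual span bundle $M_{V,E}$ is not semistable.
   Context: The base field is $\mathbb{C}$. "General" means for all $V$ in a nonempty Zariski open subset of the Grassmannian $\mathrm{Gr}(4,H^0(\mathbb{P}^1,E))$. A coherent system of type $(r,d,n)$ over a smooth projective curve $C$ is a pair $(E,V)$ with $E$ a vector bundle of rank $r$ and degree $d$ and $V\subseteq H^0(C,E)$ a subspace of dimension $n$; it is generated if the evaluation map $V\otimes\mathcal{O}_C\to E$ is surjective. For a generated coherent system the dual span bundle is $M_{V,E}=\mathrm{Ker}(V\otimes\mathcal{O}_C\to E)$. For $W\subseteq V$, let $E_W$ be the image of the evaluation map $W\otimes\mathcal{O}_C\to E$ (a locally free subsheaf, not necessarily saturated). A generated coherent system $(E,V)$ of type $(r,d,n)$ is linearly stable if for all proper subspaces $W\subset V$ with $E_W\not\cong W\otimes\mathcal{O}_C$ one has $\frac{\deg(E_W)}{\dim(W)-\mathrm{rk}(E_W)} > \frac{d}{n-r}$. Semistability of vector bundles is slope semistability. *)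

theory Defs
  imports
    "HOL-Computational_Algebra.Computational_Algebra"
    "HOL-Computational_Algebra.Field_as_Ring"
    "HOL-Library.Function_Algebras"
    "Jordan_Normal_Form.Determinant"
begin

section \<open>The projective line over the complex numbers\<close>

text \<open>
  The closed points are given in the affine coordinate \<open>t\<close>; the function field
  \<open>K = \<complex>(t)\<close> is the fraction field of \<open>\<complex>[t]\<close>.
\<close>

datatype p1 = Aff complex | Infty

text \<open>The proper Zariski closed subsets of a curve are its finite subsets.\<close>

definition zopen :: "p1 set \<Rightarrow> bool" where
  "zopen U \<longleftrightarrow> U = {} \<or> finite (- U)"

type_synonym ratfun = "complex poly fract"

text \<open>Order of vanishing at a point; only meaningful for nonzero functions.\<close>

fun ord :: "p1 \<Rightarrow> ratfun \<Rightarrow> int" where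
  "ord (Aff x) f =
     int (Polynomial.order x (fst (quot_of_fract f))) - int (Polynomial.order x (snd (quot_of_fract f)))"
| "ord Infty f =
     int (Polynomial.degree (snd (quot_of_fract f))) - int (Polynomial.degree (fst (quot_of_fract f)))"

text \<open>
  The stalk at \<open>p\<close> of \<open>\<O>(k)\<close>, realised as the sheaf of rational functions with poles bounded by
  \<open>k\<cdot>\<infinity>\<close>: a form of degree \<open>k\<close> is divided by the \<open>k\<close>-th power of the linear form vanishing at
  \<open>\<infinity>\<close>. So \<open>H\<^sup>0(\<O>(k))\<close> consists of the polynomials in \<open>t\<close> of degree at most \<open>k\<close>.
\<close>

definition O_twist :: "int \<Rightarrow> p1 \<Rightarrow> ratfun set" where
  "O_twist k p = {f. f = 0 \<or> ord p f \<ge> (if p = Infty then - k else 0)}"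

abbreviation O_stalk :: "p1 \<Rightarrow> ratfun set" where
  "O_stalk \<equiv> O_twist 0"

section \<open>Vectors of rational functions\<close>

text \<open>
  \<open>K\<^sup>n\<close> is the set of vectors vanishing at all indices \<open>i \<ge> n\<close>. They carry a
  \<open>K\<close>-linear and a \<open>\<complex>\<close>-linear structure, whose notions are prefixed by \<open>KV\<close> and \<open>CV\<close>.
\<close>

type_synonym rvec = "nat \<Rightarrow> ratfun"

definition scaleK :: "ratfun \<Rightarrow> rvec \<Rightarrow> rvec" where
  "scaleK f v = (\<lambda>i. f * v i)"

definition scaleC :: "complex \<Rightarrow> rvec \<Rightarrow> rvec" where
  "scaleC c = scaleK (to_fract [:c:])"

global_interpretation KV: vector_space scaleK
  by unfold_locales (auto simp: scaleK_def algebra_simps)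

lemma to_fract_const_add: "to_fract [:a + b:] = to_fract [:a:] + to_fract [:b:]"
proof -
  have "[:a + b:] = [:a:] + [:b:]" by simp
  then show ?thesis by (metis to_fract_add)
qed

lemma to_fract_const_mult: "to_fract [:a * b:] = to_fract [:a:] * to_fract [:b:]"
proof -
  have "[:a * b:] = [:a:] * [:b:]" by simp
  then show ?thesis by (metis to_fract_mult)
qed

lemma to_fract_const_1: "to_fract [:1:] = 1"
  by (metis one_pCons to_fract_1)

global_interpretation CV: vector_space scaleC
  by unfold_locales
    (auto simp: scaleC_def to_fract_const_add to_fract_const_mult to_fract_const_1
      KV.scale_right_distrib KV.scale_left_distrib)

section \<open>Vector bundles\<close>

text \<open>
  A torsion-free sheaf on \<open>\<P>\<^sup>1\<close> is a subsheaf of the constant sheaf given by its generic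
  stalk, and as such it is determined by its stalks. Hence a sheaf \<open>F\<close> is represented by the family
  of its stalks \<open>F p\<close>, all lying in one and the same \<open>K\<close>-vector space; the sections over a
  nonempty open set \<open>U\<close> are the elements of \<open>\<Inter>p\<in>U. F p\<close>. Inclusions, kernels and images of sheaves
  are computed stalkwise.
\<close>

type_synonym sheaf = "p1 \<Rightarrow> rvec set"

definition global_sections :: "sheaf \<Rightarrow> rvec set" where
  "global_sections F = (\<Inter>p. F p)"

definition subsheaf :: "sheaf \<Rightarrow> sheaf \<Rightarrow> bool" where
  "subsheaf G F \<longleftrightarrow> (\<forall>p. G p \<subseteq> F p)"

definition lin_indep_family :: "nat \<Rightarrow> (nat \<Rightarrow> rvec) \<Rightarrow> bool" where
  "lin_indep_family r b \<longleftrightarrow> inj_on b {..<r} \<and> KV.independent (b ` {..<r})"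

definition O_span :: "p1 \<Rightarrow> nat \<Rightarrow> (nat \<Rightarrow> rvec) \<Rightarrow> rvec set" where
  "O_span p r b = {\<Sum>i<r. scaleK (f i) (b i) | f. \<forall>i<r. f i \<in> O_stalk p}"

text \<open>
  As \<open>b\<close> is linearly independent over \<open>K\<close>, it is a basis of its span over the local rings, so \<open>F\<close> restricted
  to \<open>U\<close> is free of rank \<open>r\<close>.
\<close>

definition locally_free :: "nat \<Rightarrow> sheaf \<Rightarrow> bool" where
  "locally_free r F \<longleftrightarrow>
     (\<forall>p. \<exists>U b. zopen U \<and> p \<in> U \<and> lin_indep_family r b \<and> (\<forall>q\<in>U. F q = O_span q r b))"

definition vector_bundle :: "sheaf \<Rightarrow> bool" where
  "vector_bundle F \<longleftrightarrow> (\<exists>r. locally_free r F)"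

definition rk :: "sheaf \<Rightarrow> nat" where
  "rk F = (THE r. locally_free r F)"

text \<open>
  The degree of a vector bundle is that of its determinant line bundle, that is, of the divisor of
  any nonzero rational section \<open>b\<^sub>0 \<and> \<dots> \<and> b\<^sub>r\<^sub>-\<^sub>1\<close> of it. If \<open>c p\<close> is a basis of
  the stalk at \<open>p\<close> and the columns of \<open>A p\<close> are the coordinates of the \<open>b\<^sub>j\<close> in this basis, then
  \<open>b\<^sub>0 \<and> \<dots> \<and> b\<^sub>r\<^sub>-\<^sub>1\<close> is \<open>det (A p)\<close> times the local generator of the determinant.
\<close>

definition deg :: "sheaf \<Rightarrow> int" where
  "deg F = (THE d. \<exists>r b c A.
     lin_indep_family r b \<and>
     (\<forall>p. lin_indep_family r (c p) \<and> F p = O_span p r (c p) \<and>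
          A p \<in> carrier_mat r r \<and> (\<forall>j<r. b j = (\<Sum>i<r. scaleK (A p $$ (i, j)) (c p i)))) \<and>
     d = (\<Sum>p | ord p (det (A p)) \<noteq> 0. ord p (det (A p))))"

text \<open>
  An isomorphism of vector bundles induces a \<open>K\<close>-linear isomorphism of the generic stalks, of which
  the maps on the stalks are restrictions. (Here it is extended to the ambient vector space.)
\<close>

definition sheaf_iso :: "sheaf \<Rightarrow> sheaf \<Rightarrow> bool" where
  "sheaf_iso F G \<longleftrightarrow>
     (\<exists>\<phi>. Vector_Spaces.linear scaleK scaleK \<phi> \<and> (\<forall>p. bij_betw \<phi> (F p) (G p)))"

definition direct_sum_O :: "int list \<Rightarrow> sheaf" where
  "direct_sum_O ks p =
     {v. (\<forall>i<length ks. v i \<in> O_twist (ks ! i) p) \<and> (\<forall>i\<ge>length ks. v i = 0)}"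

definition trivial_bundle :: "nat \<Rightarrow> sheaf" where
  "trivial_bundle n = direct_sum_O (replicate n 0)"

definition slope :: "sheaf \<Rightarrow> real" where
  "slope F = real_of_int (deg F) / real (rk F)"

definition semistable :: "sheaf \<Rightarrow> bool" where
  "semistable F \<longleftrightarrow>
     (\<forall>G. vector_bundle G \<and> subsheaf G F \<and> rk G > 0 \<longrightarrow> slope G \<le> slope F)"

section \<open>Coherent systems\<close>

definition coherent_system :: "sheaf \<Rightarrow> rvec set \<Rightarrow> bool" where
  "coherent_system E V \<longleftrightarrow> vector_bundle E \<and> CV.subspace V \<and> V \<subseteq> global_sections E"

text \<open>
  The image \<open>E\<^sub>W\<close> of the evaluation map, which sends \<open>\<Sum>w. w \<otimes> f w\<close> to \<open>\<Sum>w. f w \<cdot> w\<close>.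
\<close>

definition eval_image :: "rvec set \<Rightarrow> sheaf" where
  "eval_image W p =
     {\<Sum>w\<in>S. scaleK (f w) w | S f. finite S \<and> S \<subseteq> W \<and> (\<forall>w\<in>S. f w \<in> O_stalk p)}"

definition generated :: "sheaf \<Rightarrow> rvec set \<Rightarrow> bool" where
  "generated E V \<longleftrightarrow> coherent_system E V \<and> (\<forall>p. eval_image V p = E p)"

text \<open>\<open>W \<otimes> \<O>\<close> is the trivial bundle of rank \<open>dim W\<close>.\<close>

definition linearly_stable :: "sheaf \<Rightarrow> rvec set \<Rightarrow> bool" where
  "linearly_stable E V \<longleftrightarrow> generated E V \<and>
     (\<forall>W. CV.subspace W \<and> W \<subset> V \<and> \<not> sheaf_iso (eval_image W) (trivial_bundle (CV.dim W)) \<longrightarrow>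
        real_of_int (deg (eval_image W)) / (real (CV.dim W) - real (rk (eval_image W)))
          > real_of_int (deg E) / (real (CV.dim V) - real (rk E)))"

definition basis_of :: "rvec list \<Rightarrow> rvec set \<Rightarrow> bool" where
  "basis_of vs V \<longleftrightarrow> distinct vs \<and> CV.independent (set vs) \<and> CV.span (set vs) = V"

text \<open>
  The kernel of the evaluation map of the span \<open>V\<close> of \<open>vs\<close>, where \<open>V \<otimes> \<O>\<close> is identified with
  a trivial bundle by means of the basis \<open>vs\<close> of \<open>V\<close>.
\<close>

definition dual_span_bundle :: "rvec list \<Rightarrow> sheaf" where
  "dual_span_bundle vs p =
     {f \<in> trivial_bundle (length vs) p. (\<Sum>i<length vs. scaleK (f i) (vs ! i)) = 0}"

section \<open>The Zariski topology of the Grassmannian\<close>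

definition Gr :: "nat \<Rightarrow> rvec set \<Rightarrow> rvec set set" where
  "Gr k H = {V. CV.subspace V \<and> V \<subseteq> H \<and> (\<exists>vs. length vs = k \<and> basis_of vs V)}"

text \<open>Homogeneous polynomial functions of a given degree in variables indexed by a type.\<close>

inductive hom_poly :: "nat \<Rightarrow> (('i \<Rightarrow> complex) \<Rightarrow> complex) \<Rightarrow> bool" where
  const: "hom_poly 0 (\<lambda>x. c)"
| var: "hom_poly 1 (\<lambda>x. x i)"
| add: "hom_poly d P \<Longrightarrow> hom_poly d Q \<Longrightarrow> hom_poly d (\<lambda>x. P x + Q x)"
| mult: "hom_poly d P \<Longrightarrow> hom_poly d' Q \<Longrightarrow> hom_poly (d + d') (\<lambda>x. P x * Q x)"

text \<open>
  Pluecker coordinates of the span of \<open>vs\<close> with respect to the basis \<open>hs\<close> of the ambient space: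
  the maximal minors of the coordinate matrix, indexed by sets of rows.
\<close>

definition pluecker :: "rvec list \<Rightarrow> rvec list \<Rightarrow> nat set \<Rightarrow> complex" where
  "pluecker hs vs I =
     (if I \<subseteq> {..<length hs} \<and> card I = length vs
      then det (mat (length vs) (length vs)
             (\<lambda>(i, j). CV.representation (set hs) (vs ! j) (hs ! (sorted_list_of_set I ! i))))
      else 0)"

text \<open>
  The closed sets are those cut out by homogeneous polynomials in the Pluecker coordinates. Neither
  the choice of \<open>hs\<close> nor that of \<open>vs\<close> matters.
\<close>

definition zclosed_Gr :: "nat \<Rightarrow> rvec set \<Rightarrow> rvec set set \<Rightarrow> bool" where
  "zclosed_Gr k H Z \<longleftrightarrow>
     (\<exists>hs PP. basis_of hs H \<and> (\<forall>P\<in>PP. \<exists>d. hom_poly d P) \<and>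
        Z = {V \<in> Gr k H. \<forall>vs. basis_of vs V \<longrightarrow> (\<forall>P\<in>PP. P (pluecker hs vs) = 0)})"

definition zopen_Gr :: "nat \<Rightarrow> rvec set \<Rightarrow> rvec set set \<Rightarrow> bool" where
  "zopen_Gr k H U \<longleftrightarrow> U \<subseteq> Gr k H \<and> zclosed_Gr k H (Gr k H - U)"

end

theory Submission
  imports "HOL-Library.Groups_Big_Fun" Defs
begin

text \<open>
  Put \<open>n = e\<close>. Four sections \<open>(f i, g i)\<close> of \<open>E\<close> satisfy a nontrivial relation with polynomial
  coefficients of degree at most \<open>n\<close>, since this amounts to \<open>4 n + 3\<close> linear equations in \<open>4 n + 4\<close>
  unknowns. It spans a line subsheaf of degree \<open>- n\<close> of the dual span bundle, which has rank 2 and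
  degree \<open>- (2 n + 1)\<close>, and so destabilises it.

  For general \<open>V\<close> the equations are independent and the four coefficients \<open>a i\<close> of the relation
  are linearly independent over \<open>\<complex>\<close>. Then every fibre is spanned, and every relation between elements of
  a proper subspace \<open>W\<close> has degree at least \<open>n + 1\<close>, as its coefficients in a basis of \<open>V\<close> are
  linearly dependent. If \<open>W\<close> has dimension \<open>k \<le> 3\<close> and \<open>E\<^sub>W\<close> is not trivial, then \<open>E\<^sub>W\<close> has
  rank \<open>k - 1\<close>, and its degree is that of a primitive relation, so it exceeds \<open>n + 1 / 2 = (2 n + 1) / 2\<close>.

  Both conditions are the nonvanishing of determinants in the coordinates of a chart of the
  Grassmannian, and they are verified for the basis \<open>(1, 0)\<close>, \<open>(t, - t\<^sup>3)\<close>,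
  \<open>(t\<^bsup>n-1\<^esup>, 1 - t\<^bsup>n+1\<^esup>)\<close>, \<open>(t\<^sup>n, t)\<close> with the relation \<open>(- t\<^sup>n, t\<^bsup>n-1\<^esup>, - t, 1)\<close>.
\<close>

section \<open>Valuations of the function field; frames, rank and degree of sheaves\<close>

section \<open>Orders of rational functions\<close>

text \<open>Linear stability tests only those subsheaves of the dual span bundle that come from a
  proper subspace \<open>W\<close> of \<open>V\<close>. Independence of the four \<open>a i\<close>
  says that the destabilising line lies in no \<open>W \<otimes> O\<close>, so the test does not see
  it. Four independent polynomials of degree at most \<open>n\<close> exist only if
  \<open>n + 1 \<ge> 4\<close>, which is \<open>e \<ge> 3\<close>. The equations are independent
  exactly if \<open>V \<otimes> H0(O(n)) \<rightarrow> H0(E(n))\<close> is onto. As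
  \<open>E(n)\<close> is globally generated, \<open>V\<close> then spans every fibre of
  \<open>E\<close>. That the rank of \<open>E_W\<close> drops by only one is not automatic: three
  sections with a common generic line must be excluded. This is done by relations of degree at most
  \<open>n\<close> built from the components of the sections themselves, and it rests on the first
  component having degree \<open>n\<close> rather than \<open>n + 1\<close>. For openness the
  relation has to depend polynomially on \<open>V\<close>. Hence the linear system is made square by
  one normalising row, its solution is read off the adjugate without division, and the chart
  coordinates are Pluecker coordinates up to sign.\<close>

fun poly_ord :: "p1 \<Rightarrow> complex poly \<Rightarrow> int" where
  "poly_ord (Aff x) a = int (order x a)"
| "poly_ord Infty a = - int (degree a)"

lemma poly_ord_mult: "a \<noteq> 0 \<Longrightarrow> b \<noteq> 0 \<Longrightarrow> poly_ord p (a * b) = poly_ord p a + poly_ord p b"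
  by (cases p) (auto simp: order_mult degree_mult_eq)

lemma poly_ord_uminus [simp]: "poly_ord p (- a) = poly_ord p a"
  by (cases p) auto

lemma poly_ord_const [simp]: "c \<noteq> 0 \<Longrightarrow> poly_ord p [:c:] = 0"
  by (cases p) (auto intro: order_0I)

lemma poly_ord_one [simp]: "poly_ord p 1 = 0"
  by (cases p) auto

lemma poly_ord_add:
  assumes "a \<noteq> 0" "b \<noteq> 0" "a + b \<noteq> 0" "m \<le> poly_ord p a" "m \<le> poly_ord p b"
  shows "m \<le> poly_ord p (a + b)"
proof (cases p)
  case (Aff x)
  define k where "k = min (order x a) (order x b)"
  have "[:-x, 1:] ^ k dvd a" "[:-x, 1:] ^ k dvd b"
    using assms by (auto simp: k_def order_divides)
  then have "[:-x, 1:] ^ k dvd a + b" by simp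
  then have "k \<le> order x (a + b)" using assms by (simp add: order_divides)
  with assms Aff show ?thesis by (auto simp: k_def)
next
  case Infty
  have "degree (a + b) \<le> max (degree a) (degree b)" by (rule degree_add_le_max)
  with assms Infty show ?thesis by auto
qed

lemma ord_eq_poly_ord: "ord p f = poly_ord p (fst (quot_of_fract f)) - poly_ord p (snd (quot_of_fract f))"
  by (cases p) auto

text \<open>\<open>ord\<close> is defined by the reduced fraction; cross-multiplication shows that
  any representation may be used instead. Coprimality matters again only in
  \<open>regular_everywhere_imp_poly\<close>.\<close>

lemma ord_quot:
  assumes "a \<noteq> 0" "b \<noteq> 0"
  shows "ord p (to_fract a / to_fract b) = poly_ord p a - poly_ord p b"
proof -
  define f where "f = to_fract a / to_fract b"
  obtain c d where cd: "quot_of_fract f = (c, d)" by fastforce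
  have d: "d \<noteq> 0" using cd snd_quot_of_fract_nonzero[of f] by simp
  have "f \<noteq> 0" using assms by (simp add: f_def)
  then have c: "c \<noteq> 0" using cd by (metis fst_conv fst_quot_of_fract_eq_0_iff)
  have "f = to_fract c / to_fract d"
    using cd Fract_quot_of_fract[of f] by (simp add: Fract_conv_to_fract)
  then have "to_fract (a * d) = to_fract (c * b)"
    using assms d by (simp add: f_def field_simps)
  then have "a * d = c * b" by (simp only: to_fract_eq_iff)
  then have "poly_ord p a + poly_ord p d = poly_ord p c + poly_ord p b"
    using poly_ord_mult assms c d by metis
  then show ?thesis unfolding f_def[symmetric] ord_eq_poly_ord cd by simp
qed

lemma ord_to_fract: "a \<noteq> 0 \<Longrightarrow> ord p (to_fract a) = poly_ord p a"
  using ord_quot[of a 1 p] by simp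

lemma ratfun_quot:
  fixes f :: ratfun
  obtains a b where "f = to_fract a / to_fract b" "b \<noteq> 0"
  by (metis Fract_conv_to_fract Fract_quot_of_fract snd_quot_of_fract_nonzero)

lemma ord_mult:
  assumes "f \<noteq> 0" "g \<noteq> 0"
  shows "ord p (f * g) = ord p f + ord p g"
proof -
  obtain a b where f: "f = to_fract a / to_fract b" "b \<noteq> 0" by (rule ratfun_quot)
  obtain c d where g: "g = to_fract c / to_fract d" "d \<noteq> 0" by (rule ratfun_quot)
  have "a \<noteq> 0" "c \<noteq> 0" using assms f g by auto
  moreover have "f * g = to_fract (a * c) / to_fract (b * d)" using f g by simp
  ultimately show ?thesis using f g by (simp add: ord_quot poly_ord_mult del: to_fract_mult)
qed

lemma ord_one [simp]: "ord p 1 = 0"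
  using ord_to_fract[of 1 p] by simp

lemma ord_inverse: "f \<noteq> 0 \<Longrightarrow> ord p (inverse f) = - ord p f"
  using ord_mult[of f "inverse f" p] by simp

lemma ord_divide: "f \<noteq> 0 \<Longrightarrow> g \<noteq> 0 \<Longrightarrow> ord p (f / g) = ord p f - ord p g"
  by (simp add: divide_inverse ord_mult ord_inverse)

lemma ord_uminus [simp]: "ord p (- f) = ord p f"
proof (cases "f = 0")
  case False
  have "ord p (- 1 :: ratfun) = 0"
    using ord_to_fract[of "-1" p] by simp
  then show ?thesis using ord_mult[of "- 1" f p] False by simp
qed auto

lemma ord_add:
  assumes "f \<noteq> 0" "g \<noteq> 0" "f + g \<noteq> 0" "m \<le> ord p f" "m \<le> ord p g"
  shows "m \<le> ord p (f + g)"
proof -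
  obtain a b where f: "f = to_fract a / to_fract b" "b \<noteq> 0" by (rule ratfun_quot)
  obtain c d where g: "g = to_fract c / to_fract d" "d \<noteq> 0" by (rule ratfun_quot)
  have f': "f = to_fract (a * d) / to_fract (b * d)" using f g by simp
  have g': "g = to_fract (c * b) / to_fract (b * d)" using f g by simp
  have fg: "f + g = to_fract (a * d + c * b) / to_fract (b * d)"
    unfolding f' g' by (simp add: add_divide_distrib)
  have "a * d + c * b \<noteq> 0" using assms(3) unfolding fg by fastforce
  then have nz: "a * d \<noteq> 0" "c * b \<noteq> 0" "b * d \<noteq> 0" "a * d + c * b \<noteq> 0"
    using assms(1-3) f g fg by auto
  have "m + poly_ord p (b * d) \<le> poly_ord p (a * d)" "m + poly_ord p (b * d) \<le> poly_ord p (c * b)"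
    using assms(4,5) nz unfolding f' g' by (auto simp: ord_quot simp del: to_fract_mult)
  then have "m + poly_ord p (b * d) \<le> poly_ord p (a * d + c * b)"
    using nz poly_ord_add by blast
  then show ?thesis unfolding fg using nz by (subst ord_quot) auto
qed

lemma finite_poly_ord: "a \<noteq> 0 \<Longrightarrow> finite {p. poly_ord p a \<noteq> 0}"
proof -
  assume a: "a \<noteq> 0"
  have "p \<in> insert Infty (Aff ` {x. poly a x = 0})" if "poly_ord p a \<noteq> 0" for p
    using that a by (cases p) (auto simp: order_eq_0_iff)
  then have "{p. poly_ord p a \<noteq> 0} \<subseteq> insert Infty (Aff ` {x. poly a x = 0})" by blast
  then show ?thesis by (rule finite_subset) (simp add: poly_roots_finite a)
qed

text \<open>The complex roots, counted with multiplicity, add up to the degree, which is the order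
  of the pole at \<open>Infty\<close>. So principal divisors have degree 0, and this makes
  \<open>deg\<close> independent of the rational frame.\<close>

lemma Sum_any_poly_ord:
  assumes "a \<noteq> 0"
  shows "Sum_any (\<lambda>p. poly_ord p a) = 0"
proof -
  define R where "R = {x. poly a x = 0}"
  have R: "finite R" using assms by (simp add: R_def poly_roots_finite)
  have "Sum_any (\<lambda>p. poly_ord p a) = (\<Sum>p\<in>insert Infty (Aff ` R). poly_ord p a)"
  proof (rule Sum_any.expand_superset)
    show "{p. poly_ord p a \<noteq> 0} \<subseteq> insert Infty (Aff ` R)"
    proof
      fix p assume "p \<in> {p. poly_ord p a \<noteq> 0}"
      then show "p \<in> insert Infty (Aff ` R)"
        using assms by (cases p) (auto simp: order_eq_0_iff R_def)
    qed
  qed (use R in auto)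
  also have "\<dots> = - int (degree a) + (\<Sum>p\<in>Aff ` R. poly_ord p a)"
    using R by (subst sum.insert) auto
  also have "(\<Sum>p\<in>Aff ` R. poly_ord p a) = (\<Sum>x\<in>R. int (order x a))"
    by (subst sum.reindex) (auto simp: inj_on_def)
  also have "\<dots> = int (degree a)"
    using size_proots_complex[of a] assms
    by (simp add: size_multiset_overloaded_eq R_def flip: of_nat_sum)
  finally show ?thesis by simp
qed

lemma finite_ord:
  assumes "f \<noteq> 0"
  shows "finite {p. ord p f \<noteq> 0}"
proof -
  obtain a b where f: "f = to_fract a / to_fract b" "b \<noteq> 0" by (rule ratfun_quot)
  have "a \<noteq> 0" using f assms by auto
  then have "{p. ord p f \<noteq> 0} \<subseteq> {p. poly_ord p a \<noteq> 0} \<union> {p. poly_ord p b \<noteq> 0}"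
    using f by (auto simp: ord_quot)
  with \<open>a \<noteq> 0\<close> f show ?thesis using finite_poly_ord finite_subset by blast
qed

lemma Sum_any_ord:
  assumes "f \<noteq> 0"
  shows "Sum_any (\<lambda>p. ord p f) = 0"
proof -
  obtain a b where f: "f = to_fract a / to_fract b" "b \<noteq> 0" by (rule ratfun_quot)
  have a: "a \<noteq> 0" using f assms by auto
  have "Sum_any (\<lambda>p. ord p f + poly_ord p b) = Sum_any (\<lambda>p. ord p f) + Sum_any (\<lambda>p. poly_ord p b)"
    using finite_ord[OF assms] finite_poly_ord f by (intro Sum_any.distrib) auto
  moreover have "(\<lambda>p. ord p f + poly_ord p b) = (\<lambda>p. poly_ord p a)"
    using f a by (simp add: ord_quot)
  ultimately show ?thesis using Sum_any_poly_ord[OF a] Sum_any_poly_ord[OF f(2)] by (metis add.right_neutral)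
qed

section \<open>Local rings\<close>

lemma O_stalk_iff: "f \<in> O_stalk p \<longleftrightarrow> f = 0 \<or> 0 \<le> ord p f"
  by (simp add: O_twist_def)

lemma O_stalk_0 [simp]: "0 \<in> O_stalk p"
  and O_stalk_1 [simp]: "1 \<in> O_stalk p"
  by (auto simp: O_stalk_iff)

lemma O_stalk_mult: "f \<in> O_stalk p \<Longrightarrow> g \<in> O_stalk p \<Longrightarrow> f * g \<in> O_stalk p"
  by (cases "f = 0 \<or> g = 0") (auto simp: O_stalk_iff ord_mult)

lemma O_stalk_uminus: "f \<in> O_stalk p \<Longrightarrow> - f \<in> O_stalk p"
  by (auto simp: O_stalk_iff)

lemma O_twist_add:
  assumes "f \<in> O_twist k p" "g \<in> O_twist k p"
  shows "f + g \<in> O_twist k p"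
proof (cases "f = 0 \<or> g = 0 \<or> f + g = 0")
  case False
  with assms have "(if p = Infty then - k else 0) \<le> ord p (f + g)"
    by (intro ord_add) (auto simp: O_twist_def)
  then show ?thesis by (simp add: O_twist_def)
qed (use assms in \<open>auto simp: O_twist_def\<close>)

lemma O_twist_0 [simp]: "0 \<in> O_twist k p"
  by (simp add: O_twist_def)

lemma O_twist_sum: "(\<And>i. i \<in> S \<Longrightarrow> f i \<in> O_twist k p) \<Longrightarrow> sum f S \<in> O_twist k p"
  by (induction S rule: infinite_finite_induct) (auto intro: O_twist_add)

lemma O_stalk_prod: "(\<And>i. i \<in> S \<Longrightarrow> f i \<in> O_stalk p) \<Longrightarrow> prod f S \<in> O_stalk p"
  by (induction S rule: infinite_finite_induct) (auto intro: O_stalk_mult)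

lemma to_fract_const_in_O_stalk [simp]: "to_fract [:c:] \<in> O_stalk p"
  by (cases "c = 0") (auto simp: O_stalk_iff ord_to_fract)

text \<open>A root of the reduced denominator would be a root of the numerator as well, so the
  denominator has no root and is constant. The condition at \<open>Infty\<close> then bounds the
  degree.\<close>

lemma regular_everywhere_imp_poly:
  assumes "\<And>p. f \<in> O_twist (int k) p"
  obtains a where "f = to_fract a" "degree a \<le> k"
proof (cases "f = 0")
  case True
  then show ?thesis using that[of 0] by simp
next
  case False
  obtain a b where ab: "quot_of_fract f = (a, b)" by fastforce
  have b: "b \<noteq> 0" using ab snd_quot_of_fract_nonzero[of f] by simp
  have a: "a \<noteq> 0" using ab False by (metis fst_conv fst_quot_of_fract_eq_0_iff)
  have f: "f = to_fract a / to_fract b"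
    using ab Fract_quot_of_fract[of f] by (simp add: Fract_conv_to_fract)
  have "coprime a b" using coprime_quot_of_fract[of f] ab by simp
  have "poly b x \<noteq> 0" for x
  proof
    assume bx: "poly b x = 0"
    then have "order x b > 0" using b by (simp add: order_gt_0_iff)
    moreover have "int (order x a) \<ge> int (order x b)"
      using assms[of "Aff x"] False a b by (auto simp: f O_twist_def ord_quot simp del: ord.simps)
    ultimately have "poly a x = 0" using order_root by fastforce
    with bx have "[:-x, 1:] dvd a" "[:-x, 1:] dvd b" by (auto simp: poly_eq_0_iff_dvd)
    with \<open>coprime a b\<close> have "is_unit [:-x, 1:]" by (meson coprime_def)
    then show False by (simp add: is_unit_iff_degree)
  qed
  then have "degree b = 0" using fundamental_theorem_of_algebra[of b] constant_degree[of b] by blast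
  then obtain c where c: "b = [:c:]" by (meson degree_eq_zeroE)
  then have "c \<noteq> 0" using b by simp
  have "Polynomial.smult (inverse c) a * b = a" using c \<open>c \<noteq> 0\<close> by simp
  then have "f = to_fract (Polynomial.smult (inverse c) a)"
    unfolding f using b by (metis nonzero_eq_divide_eq to_fract_eq_0_iff to_fract_mult)
  moreover have "degree a \<le> k"
    using assms[of Infty] False a b c by (auto simp: f O_twist_def ord_quot simp del: ord.simps)
  ultimately show ?thesis using that[of "Polynomial.smult (inverse c) a"] \<open>c \<noteq> 0\<close> by simp
qed

lemma poly_in_O_twist: "degree a \<le> k \<Longrightarrow> to_fract a \<in> O_twist (int k) p"
  by (cases p; cases "a = 0") (auto simp: O_twist_def ord_to_fract)

section \<open>Frames, rank and degree\<close>

context vector_space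
begin

text \<open>Stated for an arbitrary vector space because it is applied both over the function field
  (\<open>KV\<close>) and over the complex numbers (\<open>CV\<close>).\<close>

lemma independent_family_iff:
  fixes b :: "nat \<Rightarrow> 'b"
  shows "inj_on b {..<r} \<and> independent (b ` {..<r}) \<longleftrightarrow>
    (\<forall>f. (\<Sum>i<r. scale (f i) (b i)) = 0 \<longrightarrow> (\<forall>i<r. f i = 0))"
    (is "_ \<longleftrightarrow> (\<forall>f. ?S f = 0 \<longrightarrow> _ f)")
proof (intro iffI allI impI)
  fix f i assume *: "inj_on b {..<r} \<and> independent (b ` {..<r})" and f: "?S f = 0" and i: "i < r"
  define u where "u v = f (the_inv_into {..<r} b v)" for v
  have u: "u (b j) = f j" if "j < r" for j
    using that * by (simp add: u_def the_inv_into_f_f)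
  have "(\<Sum>v\<in>b ` {..<r}. scale (u v) v) = ?S f"
    using * u by (simp add: sum.reindex)
  with f have "\<forall>v\<in>b ` {..<r}. u v = 0"
    using * dependent_finite[of "b ` {..<r}"] by auto
  with u i show "f i = 0" by auto
next
  assume *: "\<forall>f. ?S f = 0 \<longrightarrow> (\<forall>i<r. f i = 0)"
  have inj: "inj_on b {..<r}"
  proof (rule inj_onI)
    fix i j assume ij: "i \<in> {..<r}" "j \<in> {..<r}" "b i = b j"
    have unit: "?S (\<lambda>k. if k = l then 1 else 0) = b l" if "l < r" for l
      using that by (simp add: if_distrib[of "\<lambda>x. scale x _"] cong: if_cong)
    have "?S (\<lambda>k. (if k = i then 1 else 0) - (if k = j then 1 else 0)) = 0"
      using ij by (simp add: scale_left_diff_distrib sum_subtractf unit)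
    from *[rule_format, OF this, of i] ij(1) have "(if i = j then 1 else 0 :: 'a) = 1" by simp
    then show "i = j" by (simp split: if_splits)
  qed
  have "independent (b ` {..<r})"
  proof
    assume "dependent (b ` {..<r})"
    then obtain u v where u: "v \<in> b ` {..<r}" "u v \<noteq> 0" "(\<Sum>v\<in>b ` {..<r}. scale (u v) v) = 0"
      using dependent_finite[of "b ` {..<r}"] by auto
    then have "?S (\<lambda>i. u (b i)) = 0"
      using inj by (simp add: sum.reindex)
    with * u show False by auto
  qed
  with inj show "inj_on b {..<r} \<and> independent (b ` {..<r})" by simp
qed

end

definition lincomb :: "nat \<Rightarrow> (nat \<Rightarrow> rvec) \<Rightarrow> (nat \<Rightarrow> ratfun) \<Rightarrow> rvec" where
  "lincomb r b f = (\<Sum>i<r. scaleK (f i) (b i))"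

lemma lincomb_apply: "lincomb r b f k = (\<Sum>i<r. f i * b i k)"
  by (induction r) (auto simp: lincomb_def scaleK_def)

lemma lincomb_diff: "lincomb r b (\<lambda>i. f i - g i) = lincomb r b f - lincomb r b g"
  by (simp add: fun_eq_iff lincomb_apply algebra_simps sum_subtractf)

lemma lincomb_cong: "(\<And>i. i < r \<Longrightarrow> f i = g i) \<Longrightarrow> lincomb r b f = lincomb r b g"
  by (simp add: lincomb_def)

lemma lincomb_unit: "j < r \<Longrightarrow> lincomb r b (\<lambda>i. if i = j then 1 else 0) = b j"
  by (simp add: fun_eq_iff lincomb_apply if_distrib[of "\<lambda>x. x * _"] cong: if_cong)

lemma lincomb_lincomb:
  "lincomb r (\<lambda>j. lincomb s b (M j)) f = lincomb s b (\<lambda>i. \<Sum>j<r. f j * M j i)"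
proof
  fix k
  have "lincomb r (\<lambda>j. lincomb s b (M j)) f k = (\<Sum>j<r. \<Sum>i<s. f j * M j i * b i k)"
    by (simp add: lincomb_apply sum_distrib_left mult.assoc)
  also have "\<dots> = (\<Sum>i<s. \<Sum>j<r. f j * M j i * b i k)" by (rule sum.swap)
  finally show "lincomb r (\<lambda>j. lincomb s b (M j)) f k = lincomb s b (\<lambda>i. \<Sum>j<r. f j * M j i) k"
    by (simp add: lincomb_apply sum_distrib_right)
qed

lemma lin_indep_family_iff:
  "lin_indep_family r b \<longleftrightarrow> (\<forall>f. lincomb r b f = 0 \<longrightarrow> (\<forall>i<r. f i = 0))"
  unfolding lin_indep_family_def lincomb_def by (rule KV.independent_family_iff)

lemma lincomb_unique:
  assumes "lin_indep_family r b" "lincomb r b f = lincomb r b g" "i < r"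
  shows "f i = g i"
  using assms lincomb_diff[of r b f g] by (auto simp: lin_indep_family_iff dest: spec[of _ "\<lambda>i. f i - g i"])

lemma O_span_eq: "O_span p r b = {lincomb r b f | f. \<forall>i<r. f i \<in> O_stalk p}"
  by (simp add: O_span_def lincomb_def)

lemma O_spanI: "(\<And>i. i < r \<Longrightarrow> f i \<in> O_stalk p) \<Longrightarrow> lincomb r b f \<in> O_span p r b"
  by (auto simp: O_span_eq)

lemma O_span_base: "j < r \<Longrightarrow> b j \<in> O_span p r b"
  using O_spanI[of r "\<lambda>i. if i = j then 1 else 0" p b] by (simp add: lincomb_unit)

lemma span_O_span: "KV.span (O_span p r b) = KV.span (b ` {..<r})"
proof (rule KV.span_eq[THEN iffD2], intro conjI subsetI)
  fix v assume "v \<in> O_span p r b"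
  then show "v \<in> KV.span (b ` {..<r})"
    unfolding O_span_eq lincomb_def by (blast intro: KV.span_sum KV.span_scale KV.span_base)
next
  fix v assume "v \<in> b ` {..<r}"
  then show "v \<in> KV.span (O_span p r b)" by (auto intro!: KV.span_base O_span_base)
qed

text \<open>The size of a frame is the dimension over the function field of the span of the stalk,
  so a single stalk determines the rank.\<close>

lemma O_span_rank_unique:
  assumes "lin_indep_family r b" "lin_indep_family s c" "O_span p r b = O_span p s c"
  shows "r = s"
proof -
  have "KV.dim (O_span p r b) = r" if "lin_indep_family r b" for r b
    using that KV.dim_span[of "O_span p r b"] KV.dim_span_eq_card_independent[of "b ` {..<r}"]
    by (simp add: span_O_span lin_indep_family_def card_image)
  with assms show ?thesis by metis
qed

lemma rk_eq:
  assumes "locally_free r F"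
  shows "rk F = r"
  unfolding rk_def
proof (rule the_equality)
  fix s assume "locally_free s F"
  with assms show "s = r"
    unfolding locally_free_def by (metis O_span_rank_unique)
qed (rule assms)

lemma mat_mult_index:
  assumes "A \<in> carrier_mat r r" "B \<in> carrier_mat r r" "i < r" "j < r"
  shows "(A * B) $$ (i, j) = (\<Sum>k<r. A $$ (i, k) * B $$ (k, j))"
  using assms by (simp add: scalar_prod_def lessThan_atLeast0)

lemma lincomb_mat_mult:
  assumes "A \<in> carrier_mat r r" "B \<in> carrier_mat r r" "j < r"
  shows "lincomb r (\<lambda>k. lincomb r b (\<lambda>i. A $$ (i, k))) (\<lambda>k. B $$ (k, j))
       = lincomb r b (\<lambda>i. (A * B) $$ (i, j))"
  unfolding lincomb_lincomb using assms
  by (intro lincomb_cong) (simp add: mat_mult_index mult.commute del: index_mult_mat)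

lemma det_in_O_stalk:
  assumes "A \<in> carrier_mat r r" "\<And>i j. i < r \<Longrightarrow> j < r \<Longrightarrow> A $$ (i, j) \<in> O_stalk p"
  shows "det A \<in> O_stalk p"
  unfolding det_def'[OF assms(1)]
proof (intro O_twist_sum O_stalk_mult O_stalk_prod)
  fix \<pi> assume "\<pi> \<in> {p. p permutes {0..<r}}"
  then have \<pi>: "\<pi> permutes {0..<r}" by simp
  show "signof \<pi> \<in> O_stalk p" by (cases "evenperm \<pi>") (auto simp: sign_def O_stalk_uminus)
  fix i assume "i \<in> {0..<r}"
  with permutes_in_image[OF \<pi>, of i] show "A $$ (i, \<pi> i) \<in> O_stalk p"
    by (intro assms) auto
qed

text \<open>The data over which the definition of \<open>deg\<close> quantifies, without the sum of
  orders.\<close>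

definition deg_data ::
  "nat \<Rightarrow> sheaf \<Rightarrow> (nat \<Rightarrow> rvec) \<Rightarrow> (p1 \<Rightarrow> nat \<Rightarrow> rvec) \<Rightarrow> (p1 \<Rightarrow> ratfun mat) \<Rightarrow> bool" where
  "deg_data r F b c A \<longleftrightarrow> lin_indep_family r b \<and>
     (\<forall>p. lin_indep_family r (c p) \<and> F p = O_span p r (c p) \<and>
          A p \<in> carrier_mat r r \<and> (\<forall>j<r. b j = lincomb r (c p) (\<lambda>i. A p $$ (i, j))))"

text \<open>A kernel vector of \<open>A p\<close> would be the coefficient vector of a linear
  relation among the \<open>b j\<close>.\<close>

lemma deg_data_det:
  assumes "deg_data r F b c A"
  shows "det (A p) \<noteq> 0"
proof
  assume d: "det (A p) = 0"
  have A: "A p \<in> carrier_mat r r" and b: "\<forall>j<r. b j = lincomb r (c p) (\<lambda>i. A p $$ (i, j))"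
    and ib: "lin_indep_family r b"
    using assms by (auto simp: deg_data_def)
  obtain v where v: "v \<in> carrier_vec r" "v \<noteq> 0\<^sub>v r" "A p *\<^sub>v v = 0\<^sub>v r"
    using det_0_iff_vec_prod_zero[OF A] d by auto
  have "lincomb r b (\<lambda>j. v $ j) = lincomb r (\<lambda>j. lincomb r (c p) (\<lambda>i. A p $$ (i, j))) (\<lambda>j. v $ j)"
    using b by (simp add: lincomb_def)
  also have "\<dots> = lincomb r (c p) (\<lambda>i. 0)"
    unfolding lincomb_lincomb
  proof (rule lincomb_cong)
    fix i assume "i < r"
    then have "(A p *\<^sub>v v) $ i = 0" using v by simp
    with \<open>i < r\<close> A v(1) show "(\<Sum>j<r. v $ j * A p $$ (i, j)) = 0"
      by (simp add: scalar_prod_def lessThan_atLeast0 mult.commute)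
  qed
  also have "\<dots> = 0" by (simp add: fun_eq_iff lincomb_apply)
  finally have "\<forall>j<r. v $ j = 0" using ib by (simp add: lin_indep_family_iff)
  with v(1,2) show False by (auto simp: vec_eq_iff)
qed

text \<open>The transition matrices in both directions are regular at \<open>p\<close> and inverse
  to each other. Their determinants have nonnegative orders with sum 0.\<close>

lemma O_span_transition:
  assumes "lin_indep_family r c" "lin_indep_family r c'" "O_span p r c = O_span p r c'"
  obtains P where "P \<in> carrier_mat r r" "\<And>j. j < r \<Longrightarrow> c' j = lincomb r c (\<lambda>i. P $$ (i, j))"
    "det P \<noteq> 0" "ord p (det P) = 0"
proof -
  have ex: "\<exists>P. P \<in> carrier_mat r r \<and> (\<forall>j<r. d' j = lincomb r d (\<lambda>i. P $$ (i, j))) \<and> det P \<in> O_stalk p"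
    if "O_span p r d = O_span p r d'" for d d'
  proof -
    have "\<forall>j<r. \<exists>f. d' j = lincomb r d f \<and> (\<forall>i<r. f i \<in> O_stalk p)"
      using O_span_base[of _ r d' p] that unfolding O_span_eq by blast
    then obtain f where f: "\<forall>j<r. d' j = lincomb r d (f j) \<and> (\<forall>i<r. f j i \<in> O_stalk p)" by metis
    have "\<forall>j<r. d' j = lincomb r d (\<lambda>i. mat r r (\<lambda>(i,j). f j i) $$ (i, j))"
      using f by (simp cong: lincomb_cong)
    moreover have "det (mat r r (\<lambda>(i,j). f j i)) \<in> O_stalk p"
      using f by (intro det_in_O_stalk) auto
    ultimately show ?thesis by (intro exI[of _ "mat r r (\<lambda>(i,j). f j i)"]) auto
  qed
  obtain P where P: "P \<in> carrier_mat r r" "\<forall>j<r. c' j = lincomb r c (\<lambda>i. P $$ (i, j))" "det P \<in> O_stalk p"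
    using ex[of c c'] assms by blast
  obtain Q where Q: "Q \<in> carrier_mat r r" "\<forall>j<r. c j = lincomb r c' (\<lambda>i. Q $$ (i, j))" "det Q \<in> O_stalk p"
    using ex[of c' c] assms by metis
  have "(P * Q) $$ (i, j) = 1\<^sub>m r $$ (i, j)" if ij: "i < r" "j < r" for i j
  proof -
    have "lincomb r c (\<lambda>i. (P * Q) $$ (i, j)) = lincomb r (\<lambda>k. lincomb r c (\<lambda>i. P $$ (i, k))) (\<lambda>k. Q $$ (k, j))"
      using P Q ij by (simp add: lincomb_mat_mult)
    also have "\<dots> = lincomb r c' (\<lambda>k. Q $$ (k, j))"
      using P by (simp add: lincomb_def)
    also have "\<dots> = lincomb r c (\<lambda>i. if i = j then 1 else 0)"
      using Q ij by (simp add: lincomb_unit)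
    finally have "(P * Q) $$ (i, j) = (if i = j then 1 else 0)"
      by (rule lincomb_unique[OF assms(1) _ ij(1)])
    then show ?thesis using ij by simp
  qed
  then have "P * Q = 1\<^sub>m r" using P Q by (intro eq_matI) auto
  then have 1: "det P * det Q = 1" using det_mult[OF P(1) Q(1)] by simp
  then have nz: "det P \<noteq> 0" "det Q \<noteq> 0" by auto
  then have "ord p (det P) + ord p (det Q) = 0" using 1 ord_mult[of "det P" "det Q" p] by simp
  with P(3) Q(3) nz have "ord p (det P) = 0" by (auto simp: O_stalk_iff)
  with that P nz show ?thesis by blast
qed

text \<open>Changing the local frames multiplies the determinants by local units; changing the
  rational frame multiplies all of them by one and the same function, the determinant of
  \<open>T\<close>.\<close>

lemma deg_data_compare:
  assumes D: "deg_data r F b c A" and D': "deg_data r F b' c' A'"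
  obtains g where "g \<noteq> 0" "\<And>p. ord p (det (A' p)) = ord p (det (A p)) + ord p g"
proof -
  note d = D[unfolded deg_data_def] and d' = D'[unfolded deg_data_def]
  have A: "A p \<in> carrier_mat r r" and A': "A' p \<in> carrier_mat r r" for p using d d' by auto
  have "\<exists>P. P \<in> carrier_mat r r \<and> (\<forall>j<r. c' p j = lincomb r (c p) (\<lambda>i. P $$ (i, j))) \<and>
      det P \<noteq> 0 \<and> ord p (det P) = 0" for p
  proof -
    have "O_span p r (c p) = O_span p r (c' p)" using d d' by metis
    then show ?thesis using O_span_transition[of r "c p" "c' p" p] d d' by metis
  qed
  then obtain P where P: "\<And>p. P p \<in> carrier_mat r r"
    "\<And>p j. j < r \<Longrightarrow> c' p j = lincomb r (c p) (\<lambda>i. P p $$ (i, j))"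
    "\<And>p. det (P p) \<noteq> 0" "\<And>p. ord p (det (P p)) = 0"
    by metis
  have b': "b' j = lincomb r (c p) (\<lambda>i. (P p * A' p) $$ (i, j))" if j: "j < r" for p j
  proof -
    have "b' j = lincomb r (c' p) (\<lambda>k. A' p $$ (k, j))" using d' j by auto
    also have "\<dots> = lincomb r (\<lambda>k. lincomb r (c p) (\<lambda>i. P p $$ (i, k))) (\<lambda>k. A' p $$ (k, j))"
      using P(2) by (simp add: lincomb_def)
    finally show ?thesis using P(1) A' j by (simp add: lincomb_mat_mult)
  qed
  have bT: "lincomb r b (\<lambda>k. T $$ (k, j)) = lincomb r (c p) (\<lambda>i. (A p * T) $$ (i, j))"
    if "T \<in> carrier_mat r r" "j < r" for p T j
  proof -
    have "lincomb r b (\<lambda>k. T $$ (k, j)) = lincomb r (\<lambda>k. lincomb r (c p) (\<lambda>i. A p $$ (i, k))) (\<lambda>k. T $$ (k, j))"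
      using d by (simp add: lincomb_def)
    then show ?thesis using A that by (simp add: lincomb_mat_mult)
  qed
  \<comment> \<open>\<open>T\<close> expresses \<open>b'\<close> in terms of \<open>b\<close> and so
    does not depend on the point. It is computed at \<open>Infty\<close>; comparing coordinates in
    the frame \<open>c p\<close> gives \<open>A p * T = P p * A' p\<close> everywhere.\<close>
  define B where "B = A Infty"
  obtain B' where B': "B' \<in> carrier_mat r r" "B * B' = 1\<^sub>m r"
  proof -
    have "B \<in> Units (ring_mat TYPE(ratfun) r r)"
      using A deg_data_det[OF D] det_non_zero_imp_unit[of B r] by (auto simp: B_def)
    then show ?thesis using that by (auto simp: Units_def ring_mat_def)
  qed
  define T where "T = B' * (P Infty * A' Infty)"
  have T: "T \<in> carrier_mat r r" unfolding T_def by (intro mult_carrier_mat[of _ r r] B'(1) P(1) A')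
  have PA: "P Infty * A' Infty \<in> carrier_mat r r" by (rule mult_carrier_mat[OF P(1) A'])
  have "B \<in> carrier_mat r r" using A by (simp add: B_def)
  then have "B * T = (B * B') * (P Infty * A' Infty)"
    unfolding T_def by (rule assoc_mult_mat[OF _ B'(1) PA, symmetric])
  then have "B * T = P Infty * A' Infty"
    using B'(2) PA left_mult_one_mat by metis
  then have b'T: "b' j = lincomb r b (\<lambda>k. T $$ (k, j))" if "j < r" for j
    using that b'[of j Infty] bT[OF T, of j Infty] by (simp add: B_def)
  have AT: "A p * T = P p * A' p" for p
  proof (rule eq_matI)
    fix i j assume "i < dim_row (P p * A' p)" "j < dim_col (P p * A' p)"
    then have ij: "i < r" "j < r" using P(1)[of p] A'[of p] by auto
    have "lincomb r (c p) (\<lambda>i. (A p * T) $$ (i, j)) = lincomb r (c p) (\<lambda>i. (P p * A' p) $$ (i, j))"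
      using ij b'[of j p] b'T[of j] bT[OF T, of j p] by simp
    then show "(A p * T) $$ (i, j) = (P p * A' p) $$ (i, j)"
      using lincomb_unique[of r "c p"] d ij by fastforce
  qed (use A[of p] A'[of p] T P(1)[of p] in auto)
  then have e: "det (A p) * det T = det (P p) * det (A' p)" for p
    using det_mult[OF A T] det_mult[OF P(1) A'] by metis
  have nz: "det (A p) \<noteq> 0" "det (A' p) \<noteq> 0" for p using D D' by (auto simp: deg_data_det)
  have "det T \<noteq> 0" using e[of Infty] nz P(3) by auto
  moreover have "ord p (det (A' p)) = ord p (det (A p)) + ord p (det T)" for p
    using arg_cong[OF e[of p], of "ord p"] nz P(3,4) \<open>det T \<noteq> 0\<close> by (simp add: ord_mult)
  ultimately show ?thesis using that by blast
qed

text \<open>A principal divisor contributes nothing to the degree. It is therefore enough that the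
  divisor of the determinants is that of some function \<open>f\<close> plus \<open>m\<close> times
  the point \<open>Infty\<close>.\<close>

lemma deg_eqI:
  assumes b: "lin_indep_family r b"
    and loc: "\<And>p. \<exists>c A. lin_indep_family r c \<and> F p = O_span p r c \<and> A \<in> carrier_mat r r \<and>
        (\<forall>j<r. b j = lincomb r c (\<lambda>i. A $$ (i, j))) \<and>
        ord p (det A) = ord p f + (if p = Infty then m else 0)"
    and f: "f \<noteq> 0"
  shows "deg F = m"
proof -
  obtain c A where cA: "\<And>p. lin_indep_family r (c p) \<and> F p = O_span p r (c p) \<and> A p \<in> carrier_mat r r \<and>
        (\<forall>j<r. b j = lincomb r (c p) (\<lambda>i. A p $$ (i, j))) \<and>
        ord p (det (A p)) = ord p f + (if p = Infty then m else 0)"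
    using loc by metis
  then have D: "deg_data r F b c A" using b by (simp add: deg_data_def)
  have *: "Sum_any (\<lambda>p. ord p (det (A' p))) = m" if D': "deg_data r' F b' c' A'" for r' b' c' A'
  proof -
    have "O_span Infty r (c Infty) = O_span Infty r' (c' Infty)"
      using D D' unfolding deg_data_def by metis
    then have "r = r'"
      using D D' unfolding deg_data_def by (metis O_span_rank_unique)
    with D' obtain g where g: "g \<noteq> 0" "\<And>p. ord p (det (A' p)) = ord p (det (A p)) + ord p g"
      using deg_data_compare[OF D] by metis
    have "Sum_any (\<lambda>p. ord p (det (A' p))) = Sum_any (\<lambda>p. ord p (f * g) + (if p = Infty then m else 0))"
      using g f cA by (simp add: ord_mult algebra_simps)
    also have "\<dots> = Sum_any (\<lambda>p. ord p (f * g)) + Sum_any (\<lambda>p. if p = Infty then m else 0)"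
      using f g by (intro Sum_any.distrib finite_ord) auto
    also have "\<dots> = m" using f g by (simp add: Sum_any_ord)
    finally show ?thesis .
  qed
  show ?thesis
    unfolding deg_def
  proof (rule the_equality)
    show "\<exists>r b c A. lin_indep_family r b \<and>
     (\<forall>p. lin_indep_family r (c p) \<and> F p = O_span p r (c p) \<and>
          A p \<in> carrier_mat r r \<and> (\<forall>j<r. b j = (\<Sum>i<r. scaleK (A p $$ (i, j)) (c p i)))) \<and>
     m = (\<Sum>p | ord p (det (A p)) \<noteq> 0. ord p (det (A p)))"
      using D *[OF D] by (intro exI[of _ r] exI[of _ b] exI[of _ c] exI[of _ A])
        (simp add: deg_data_def lincomb_def Sum_any.expand_set)
  next
    fix d
    assume "\<exists>r b c A. lin_indep_family r b \<and>
     (\<forall>p. lin_indep_family r (c p) \<and> F p = O_span p r (c p) \<and>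
          A p \<in> carrier_mat r r \<and> (\<forall>j<r. b j = (\<Sum>i<r. scaleK (A p $$ (i, j)) (c p i)))) \<and>
     d = (\<Sum>p | ord p (det (A p)) \<noteq> 0. ord p (det (A p)))"
    then obtain r' b' c' A' where "deg_data r' F b' c' A'" "d = Sum_any (\<lambda>p. ord p (det (A' p)))"
      by (auto simp: deg_data_def lincomb_def Sum_any.expand_set)
    with * show "d = m" by simp
  qed
qed

section \<open>Sums of two line bundles\<close>

lemma det_2:
  fixes A :: "'a :: comm_ring_1 mat"
  assumes A: "A \<in> carrier_mat 2 2"
  shows "det A = A $$ (0, 0) * A $$ (1, 1) - A $$ (0, 1) * A $$ (1, 0)"
proof -
  have det1: "det (mat 1 1 h) = h (0, 0)" for h :: "nat \<times> nat \<Rightarrow> 'a"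
    by (subst det_single) auto
  show ?thesis
    using A by (subst laplace_expansion_column[OF A, of 0])
      (auto simp: cofactor_def det1[simplified] mat_delete_def numeral_2_eq_2)
qed

lemma less_2: "i < (2::nat) \<longleftrightarrow> i = 0 \<or> i = 1" by auto

lemma sum_lessThan_2: "(\<Sum>i<2. F i) = F 0 + F (1::nat)" for F :: "nat \<Rightarrow> 'a :: comm_monoid_add"
  by (simp add: numeral_2_eq_2)

definition vec2 :: "ratfun \<Rightarrow> ratfun \<Rightarrow> rvec" where
  "vec2 a b = (\<lambda>i. if i = 0 then a else if i = 1 then b else 0)"

lemma vec2_simps [simp]: "vec2 a b 0 = a" "vec2 a b 1 = b" "vec2 a b (Suc 0) = b" "i \<ge> 2 \<Longrightarrow> vec2 a b i = 0"
  by (auto simp: vec2_def)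

lemma vec2_eqI: "v 0 = a \<Longrightarrow> v 1 = b \<Longrightarrow> (\<And>i. i \<ge> 2 \<Longrightarrow> v i = 0) \<Longrightarrow> v = vec2 a b"
  by (auto simp: vec2_def fun_eq_iff)

lemma vec2_eq_iff [simp]: "vec2 a b = vec2 c d \<longleftrightarrow> a = c \<and> b = d"
  by (metis vec2_simps(1,2))

lemma scaleK_vec2: "scaleK c (vec2 a b) = vec2 (c * a) (c * b)"
  by (auto simp: vec2_def scaleK_def fun_eq_iff)

lemma vec2_add: "vec2 a b + vec2 c d = vec2 (a + c) (b + d)"
  by (auto simp: vec2_def fun_eq_iff)

lemma vec2_0 [simp]: "vec2 0 0 = 0"
  by (auto simp: vec2_def fun_eq_iff)

lemma sum_vec2: "(\<Sum>i\<in>S. vec2 (a i) (b i)) = vec2 (sum a S) (sum b S)"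
  by (induction S rule: infinite_finite_induct) (auto simp: vec2_add)

lemma lincomb_2: "lincomb 2 c f = scaleK (f 0) (c 0) + scaleK (f 1) (c 1)"
  by (simp add: lincomb_def sum_lessThan_2)

definition frame2 :: "ratfun \<Rightarrow> ratfun \<Rightarrow> nat \<Rightarrow> rvec" where
  "frame2 a b i = (if i = 0 then vec2 a 0 else vec2 0 b)"

lemma lincomb_frame2: "lincomb 2 (frame2 a b) f = vec2 (f 0 * a) (f 1 * b)"
  by (simp add: lincomb_2 frame2_def scaleK_vec2 vec2_add)

lemma lin_indep_frame2: "a \<noteq> 0 \<Longrightarrow> b \<noteq> 0 \<Longrightarrow> lin_indep_family 2 (frame2 a b)"
  by (auto simp: lin_indep_family_iff lincomb_frame2 less_2 simp flip: vec2_0)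

definition twist_ord :: "int \<Rightarrow> p1 \<Rightarrow> int" where
  "twist_ord k p = (if p = Infty then - k else 0)"

lemma twist_ord_simps [simp]: "twist_ord k Infty = - k" "twist_ord k (Aff x) = 0" "twist_ord 0 p = 0"
  by (auto simp: twist_ord_def)

lemma twist_ord_add: "twist_ord (k + l) p = twist_ord k p + twist_ord l p"
  by (simp add: twist_ord_def)

lemma O_twist_iff: "f \<in> O_twist k p \<longleftrightarrow> f = 0 \<or> twist_ord k p \<le> ord p f"
  by (simp add: O_twist_def twist_ord_def)

lemma O_twist_mult2: "f \<in> O_twist k p \<Longrightarrow> g \<in> O_twist l p \<Longrightarrow> f * g \<in> O_twist (k + l) p"
  by (cases "f = 0 \<or> g = 0") (auto simp: O_twist_iff twist_ord_add ord_mult)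

lemma O_twist_uminus: "f \<in> O_twist k p \<Longrightarrow> - f \<in> O_twist k p"
  by (simp add: O_twist_iff)

lemma O_twist_diff: "f \<in> O_twist k p \<Longrightarrow> g \<in> O_twist k p \<Longrightarrow> f - g \<in> O_twist k p"
  using O_twist_add[of f k p "- g"] by (simp add: O_twist_uminus)

lemma O_twist_generator:
  assumes "u \<noteq> 0" "ord p u = twist_ord k p"
  shows "f \<in> O_twist k p \<longleftrightarrow> f / u \<in> O_stalk p"
  using assms by (cases "f = 0") (auto simp: O_twist_iff ord_divide)

lemma direct_sum_O_2: "v \<in> direct_sum_O [k, l] p \<longleftrightarrow>
    (\<exists>a b. v = vec2 a b \<and> a \<in> O_twist k p \<and> b \<in> O_twist l p)"
proof
  assume v: "v \<in> direct_sum_O [k, l] p"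
  have "v = vec2 (v 0) (v 1)" using v by (intro vec2_eqI) (auto simp: direct_sum_O_def)
  moreover have "v 0 \<in> O_twist k p" "v 1 \<in> O_twist l p"
    using v by (auto simp: direct_sum_O_def less_Suc_eq all_conj_distrib)
  ultimately show "\<exists>a b. v = vec2 a b \<and> a \<in> O_twist k p \<and> b \<in> O_twist l p" by blast
qed (auto simp: direct_sum_O_def less_Suc_eq)

lemma direct_sum_O_2_frame:
  assumes "u \<noteq> 0" "ord p u = twist_ord k p" "w \<noteq> 0" "ord p w = twist_ord l p"
  shows "direct_sum_O [k, l] p = O_span p 2 (frame2 u w)"
proof (intro Set.set_eqI iffI)
  fix v assume "v \<in> direct_sum_O [k, l] p"
  then obtain a b where v: "v = vec2 a b" "a / u \<in> O_stalk p" "b / w \<in> O_stalk p"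
    using assms by (auto simp: direct_sum_O_2 O_twist_generator)
  have "v = lincomb 2 (frame2 u w) (\<lambda>i. if i = 0 then a / u else b / w)"
    using v assms by (simp add: lincomb_frame2)
  also have "\<dots> \<in> O_span p 2 (frame2 u w)" using v by (intro O_spanI) auto
  finally show "v \<in> O_span p 2 (frame2 u w)" .
next
  fix v assume "v \<in> O_span p 2 (frame2 u w)"
  then show "v \<in> direct_sum_O [k, l] p"
    using assms by (auto simp: O_span_eq lincomb_frame2 direct_sum_O_2 O_twist_generator)
qed

text \<open>The generator of \<open>O(k)\<close> away from the origin; together with 1 on the affine
  part it trivialises \<open>O(k)\<close> on two open sets covering the line.\<close>

definition tpow :: "nat \<Rightarrow> ratfun" where "tpow k = to_fract (monom 1 k)"

lemma tpow_nonzero [simp]: "tpow k \<noteq> 0"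
  by (simp add: tpow_def)

lemma ord_tpow_Infty [simp]: "ord Infty (tpow k) = - int k"
  by (simp add: tpow_def ord_to_fract degree_monom_eq del: ord.simps)

lemma ord_tpow_Aff [simp]: "x \<noteq> 0 \<Longrightarrow> ord (Aff x) (tpow k) = 0"
  by (simp add: tpow_def ord_to_fract poly_monom order_0I del: ord.simps)

lemma zopen_Aff [simp]: "zopen (range Aff)"
proof -
  have "- range Aff = {Infty}" by (auto intro: p1.exhaust)
  then show ?thesis by (simp add: zopen_def)
qed

lemma zopen_compl_finite: "finite S \<Longrightarrow> zopen (- S)"
  by (simp add: zopen_def)

lemma locally_free_direct_sum_O_2: "locally_free 2 (direct_sum_O [int k, int l])"
  unfolding locally_free_def
proof
  fix p
  show "\<exists>U b. zopen U \<and> p \<in> U \<and> lin_indep_family 2 b \<and> (\<forall>q\<in>U. direct_sum_O [int k, int l] q = O_span q 2 b)"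
  proof (cases p)
    case (Aff x)
    then show ?thesis
      by (intro exI[of _ "range Aff"] exI[of _ "frame2 1 1"])
        (auto simp: lin_indep_frame2 direct_sum_O_2_frame simp del: ord.simps)
  next
    case Infty
    have "direct_sum_O [int k, int l] q = O_span q 2 (frame2 (tpow k) (tpow l))" if "q \<noteq> Aff 0" for q
      using that by (cases q) (auto simp: direct_sum_O_2_frame simp del: ord.simps)
    then show ?thesis using Infty
      by (intro exI[of _ "- {Aff 0}"] exI[of _ "frame2 (tpow k) (tpow l)"])
        (auto simp: lin_indep_frame2 zopen_compl_finite)
  qed
qed

lemma deg_direct_sum_O_2: "deg (direct_sum_O [int k, int l]) = int k + int l"
proof (rule deg_eqI)
  show "lin_indep_family 2 (frame2 1 1)" by (simp add: lin_indep_frame2)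
  fix p
  define u where "u k = (if p = Infty then tpow k else 1)" for k
  have u: "u k \<noteq> 0" "ord p (u k) = twist_ord (int k) p" for k
    by (auto simp: u_def twist_ord_def simp del: ord.simps)
  define A where "A = mat 2 2 (\<lambda>(i, j). if i \<noteq> j then 0 else if i = 0 then 1 / u k else 1 / u l)"
  show "\<exists>c A. lin_indep_family 2 c \<and> direct_sum_O [int k, int l] p = O_span p 2 c \<and> A \<in> carrier_mat 2 2 \<and>
        (\<forall>j<2. frame2 1 1 j = lincomb 2 c (\<lambda>i. A $$ (i, j))) \<and>
        ord p (det A) = ord p 1 + (if p = Infty then int k + int l else 0)"
  proof (intro exI conjI allI impI)
    show "lin_indep_family 2 (frame2 (u k) (u l))" using u by (simp add: lin_indep_frame2)
    show "direct_sum_O [int k, int l] p = O_span p 2 (frame2 (u k) (u l))"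
      using u by (simp add: direct_sum_O_2_frame)
    show A: "A \<in> carrier_mat 2 2" by (simp add: A_def)
    show "frame2 1 1 j = lincomb 2 (frame2 (u k) (u l)) (\<lambda>i. A $$ (i, j))" if "j < 2" for j
      using that u(1) by (auto simp: less_2 lincomb_frame2 A_def) (auto simp: frame2_def)
    have "det A = 1 / (u k * u l)" by (simp add: det_2[OF A]) (simp add: A_def)
    then show "ord p (det A) = ord p 1 + (if p = Infty then int k + int l else 0)"
      using u by (simp add: ord_divide ord_mult twist_ord_def)
  qed
qed simp

definition pvec :: "complex poly \<Rightarrow> complex poly \<Rightarrow> rvec" where
  "pvec f g = vec2 (to_fract f) (to_fract g)"

lemma pvec_eq_iff [simp]: "pvec a b = pvec c d \<longleftrightarrow> a = c \<and> b = d"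
  by (simp add: pvec_def)

lemma pvec_0 [simp]: "pvec 0 0 = 0"
  by (simp add: pvec_def)

lemma global_sections_direct_sum_O_2:
  "global_sections (direct_sum_O [int k, int l]) = {pvec f g | f g. degree f \<le> k \<and> degree g \<le> l}"
proof (intro Set.set_eqI iffI)
  fix v assume v: "v \<in> global_sections (direct_sum_O [int k, int l])"
  then have "v \<in> direct_sum_O [int k, int l] p" for p by (auto simp: global_sections_def)
  then have *: "\<exists>a b. v = vec2 a b \<and> a \<in> O_twist (int k) p \<and> b \<in> O_twist (int l) p" for p
    by (simp add: direct_sum_O_2)
  obtain a b where ab: "v = vec2 a b" using *[of Infty] by blast
  then have "a \<in> O_twist (int k) p" "b \<in> O_twist (int l) p" for p using *[of p] by auto
  then obtain f g where "a = to_fract f" "degree f \<le> k" "b = to_fract g" "degree g \<le> l"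
    by (metis regular_everywhere_imp_poly)
  with ab show "v \<in> {pvec f g | f g. degree f \<le> k \<and> degree g \<le> l}" by (auto simp: pvec_def)
next
  fix v assume "v \<in> {pvec f g | f g. degree f \<le> k \<and> degree g \<le> l}"
  then show "v \<in> global_sections (direct_sum_O [int k, int l])"
    by (auto simp: global_sections_def direct_sum_O_2 pvec_def poly_in_O_twist)
qed

section \<open>Images of evaluation maps\<close>

lemma lincomb_add: "lincomb r b (\<lambda>i. f i + g i) = lincomb r b f + lincomb r b g"
  by (simp add: fun_eq_iff lincomb_apply algebra_simps sum.distrib)

lemma scaleK_lincomb: "scaleK c (lincomb r b f) = lincomb r b (\<lambda>i. c * f i)"
  by (simp add: fun_eq_iff lincomb_apply scaleK_def sum_distrib_left mult.assoc)

lemma O_span_0 [simp]: "0 \<in> O_span p r b"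
  using O_spanI[of r "\<lambda>i. 0" p b] by (simp add: lincomb_def)

lemma O_span_add:
  assumes "v \<in> O_span p r b" "w \<in> O_span p r b"
  shows "v + w \<in> O_span p r b"
proof -
  obtain f g where fg: "v = lincomb r b f" "w = lincomb r b g"
    "\<forall>i<r. f i \<in> O_stalk p" "\<forall>i<r. g i \<in> O_stalk p"
    using assms by (auto simp: O_span_eq)
  then have "lincomb r b (\<lambda>i. f i + g i) \<in> O_span p r b" by (intro O_spanI O_twist_add) auto
  with fg show ?thesis by (simp add: lincomb_add)
qed

lemma O_span_scale:
  assumes "v \<in> O_span p r b" "c \<in> O_stalk p"
  shows "scaleK c v \<in> O_span p r b"
proof -
  obtain f where f: "v = lincomb r b f" "\<forall>i<r. f i \<in> O_stalk p"
    using assms by (auto simp: O_span_eq)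
  then have "lincomb r b (\<lambda>i. c * f i) \<in> O_span p r b" using assms(2) by (intro O_spanI O_stalk_mult) auto
  with f show ?thesis by (simp add: scaleK_lincomb)
qed

lemma O_span_sum: "(\<And>i. i \<in> S \<Longrightarrow> F i \<in> O_span p r b) \<Longrightarrow> sum F S \<in> O_span p r b"
  by (induction S rule: infinite_finite_induct) (auto intro: O_span_add)

lemma O_span_subset:
  assumes "\<And>i. i < s \<Longrightarrow> c i \<in> O_span p r b"
  shows "O_span p s c \<subseteq> O_span p r b"
  using assms unfolding O_span_def[of p s c] by (auto intro!: O_span_sum O_span_scale)

text \<open>Constants are regular at every point, so \<open>O_span\<close> is a complex subspace and
  contains with the family its whole complex span.\<close>

lemma eval_image_span:
  assumes "inj_on w {..<k}"
  shows "eval_image (CV.span (w ` {..<k})) p = O_span p k w"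
proof
  have "CV.subspace (O_span p k w)"
    unfolding CV.subspace_def scaleC_def by (auto intro: O_span_add O_span_scale)
  moreover have "w ` {..<k} \<subseteq> O_span p k w" by (auto intro: O_span_base)
  ultimately have "CV.span (w ` {..<k}) \<subseteq> O_span p k w" by (rule CV.span_minimal[rotated])
  then show "eval_image (CV.span (w ` {..<k})) p \<subseteq> O_span p k w"
    unfolding eval_image_def by (auto intro!: O_span_sum O_span_scale)
  show "O_span p k w \<subseteq> eval_image (CV.span (w ` {..<k})) p"
  proof
    fix v assume "v \<in> O_span p k w"
    then obtain f where f: "v = (\<Sum>i<k. scaleK (f i) (w i))" "\<forall>i<k. f i \<in> O_stalk p"
      by (auto simp: O_span_def)
    define h where "h = f \<circ> the_inv_into {..<k} w"
    have h: "h (w i) = f i" if "i < k" for i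
      using that assms by (simp add: h_def the_inv_into_f_f)
    have "v = (\<Sum>u\<in>w ` {..<k}. scaleK (h u) u)"
      using assms h f by (simp add: sum.reindex)
    moreover have "\<forall>u\<in>w ` {..<k}. h u \<in> O_stalk p" using h f by auto
    ultimately show "v \<in> eval_image (CV.span (w ` {..<k})) p"
      unfolding eval_image_def
      by (intro CollectI exI[of _ "w ` {..<k}"] exI[of _ h]) (auto intro: CV.span_base)
  qed
qed

section \<open>The relation bundle of four generating sections and its instability\<close>

section \<open>Four sections spanning every fibre\<close>

lemma direct_sum_O_2_eq_O_span: "\<exists>c. direct_sum_O [int k, int l] p = O_span p 2 c"
  using locally_free_direct_sum_O_2[of k l] unfolding locally_free_def by blast

lemma coeff_mult_top:
  fixes p q :: "'a :: comm_semiring_0 poly"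
  assumes "degree p \<le> m" "degree q \<le> n"
  shows "coeff (p * q) (m + n) = coeff p m * coeff q n"
proof -
  have "coeff p i * coeff q (m + n - i) = (if i = m then coeff p m * coeff q n else 0)" for i
    using assms by (cases i m rule: linorder_cases) (auto simp: coeff_eq_0)
  then show ?thesis by (simp add: coeff_mult)
qed

lemma trivial_bundle_iff: "h \<in> trivial_bundle k p \<longleftrightarrow> (\<forall>i<k. h i \<in> O_stalk p) \<and> (\<forall>i\<ge>k. h i = 0)"
  by (auto simp: trivial_bundle_def direct_sum_O_def)

text \<open>The indices \<open>i\<close> and \<open>j\<close> will be the pivots of Cramer's rule,
  while \<open>k\<close> and \<open>l\<close> number the two relations that it produces.\<close>

definition enum4 :: "nat \<Rightarrow> nat \<Rightarrow> nat \<Rightarrow> nat \<Rightarrow> bool" where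
  "enum4 i j k l \<longleftrightarrow> distinct [i, j, k, l] \<and> {..<4} = {i, j, k, l}"

lemma enum4_exists:
  assumes "i < 4" "j < 4" "i \<noteq> j"
  obtains k l where "enum4 i j k l"
proof -
  have "card ({..<4} - {i, j}) = 2" using assms by (subst card_Diff_subset) auto
  then obtain k l where kl: "{..<4} - {i, j} = {k, l}" "k \<noteq> l" by (auto simp: card_2_iff)
  then have "k \<in> {..<4} - {i, j}" "l \<in> {..<4} - {i, j}" by auto
  then have "distinct [i, j, k, l]" using kl(2) assms(3) by auto
  moreover have "{..<4} = {i, j} \<union> ({..<4} - {i, j})" using assms by auto
  then have "{..<4} = {i, j, k, l}" unfolding kl(1) by (simp only: Un_insert_left Un_empty_left)
  ultimately show ?thesis using that[of k l] unfolding enum4_def by blast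
qed

lemma enum4_sum:
  fixes F :: "nat \<Rightarrow> 'a :: comm_monoid_add"
  assumes "enum4 i j k l"
  shows "(\<Sum>m<4. F m) = F i + F j + F k + F l"
proof -
  have S: "{..<4} = {i, j, k, l}" and d: "distinct [i, j, k, l]"
    using assms unfolding enum4_def by blast+
  show ?thesis unfolding S using d by (simp add: add.assoc)
qed

lemma enum4_less: "enum4 i j k l \<Longrightarrow> i < 4 \<and> j < 4 \<and> k < 4 \<and> l < 4"
  unfolding enum4_def by (metis insertI1 insertI2 lessThan_iff)

lemma enum4_cases: "enum4 i j k l \<Longrightarrow> m < 4 \<Longrightarrow> m = i \<or> m = j \<or> m = k \<or> m = l"
  unfolding enum4_def by (metis empty_iff insert_iff lessThan_iff)

text \<open>Spanning of the fibres is put dually: no nonzero functional on the fibre kills all four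
  sections. At infinity the coordinates of a section in the fibre are its coefficients of degrees
  \<open>n\<close> and \<open>n + 1\<close>.\<close>

locale spanning_family =
  fixes n :: nat and f g :: "nat \<Rightarrow> complex poly"
  assumes degree_f: "i < 4 \<Longrightarrow> degree (f i) \<le> n"
    and degree_g: "i < 4 \<Longrightarrow> degree (g i) \<le> Suc n"
    and fibre: "(\<And>i. i < 4 \<Longrightarrow> \<alpha> * poly (f i) x + \<beta> * poly (g i) x = 0) \<Longrightarrow> \<alpha> = 0 \<and> \<beta> = 0"
    and fibre_Infty: "(\<And>i. i < 4 \<Longrightarrow> \<alpha> * coeff (f i) n + \<beta> * coeff (g i) (Suc n) = 0) \<Longrightarrow> \<alpha> = 0 \<and> \<beta> = 0"
begin

abbreviation "N \<equiv> int n + int (Suc n)"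

definition w :: "nat \<Rightarrow> rvec" where "w i = pvec (f i) (g i)"

definition minor :: "nat \<Rightarrow> nat \<Rightarrow> complex poly" where "minor i j = f i * g j - f j * g i"

definition D :: "nat \<Rightarrow> nat \<Rightarrow> ratfun" where "D i j = to_fract (minor i j)"

definition ambient :: sheaf where "ambient = direct_sum_O [int n, int (Suc n)]"

lemma to_fract_f: "i < 4 \<Longrightarrow> to_fract (f i) \<in> O_twist (int n) p"
  and to_fract_g: "i < 4 \<Longrightarrow> to_fract (g i) \<in> O_twist (int (Suc n)) p"
  using degree_f degree_g by (auto intro: poly_in_O_twist simp del: of_nat_Suc)

lemma D_eq: "D i j = to_fract (f i) * to_fract (g j) - to_fract (f j) * to_fract (g i)"
  by (simp add: D_def minor_def)

lemma D_in: "i < 4 \<Longrightarrow> j < 4 \<Longrightarrow> D i j \<in> O_twist N p"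
  unfolding D_eq by (intro O_twist_diff O_twist_mult2 to_fract_f to_fract_g)

text \<open>If all minors vanish, a nonzero column \<open>(a i, b i)\<close> yields the functional
  \<open>(b i, - a i)\<close>, which kills every column.\<close>

lemma minor_nonzero_at:
  assumes fib: "\<And>\<alpha> \<beta>. (\<And>i. i < 4 \<Longrightarrow> \<alpha> * a i + \<beta> * b i = 0) \<Longrightarrow> \<alpha> = 0 \<and> \<beta> = 0"
  shows "\<exists>i<4. \<exists>j<4. a i * b j - a j * b i \<noteq> (0 :: complex)"
proof (rule ccontr)
  assume *: "\<not> ?thesis"
  show False
  proof (cases "\<forall>i<4. a i = 0")
    case True
    then show False using fib[of 1 0] by auto
  next
    case False
    then obtain i where i: "i < 4" "a i \<noteq> 0" by blast
    have "b i * a j + - a i * b j = 0" if "j < 4" for j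
      using * i that by (auto simp: algebra_simps)
    then show False using fib[of "b i" "- a i"] i by auto
  qed
qed

text \<open>The minors are sections of the determinant bundle \<open>O(N)\<close>. Having order
  exactly \<open>twist_ord N p\<close> means not vanishing at \<open>p\<close> as such a section, so
  the pair \<open>i\<close>, \<open>j\<close> is a frame near \<open>p\<close>.\<close>

lemma minor_exists: "\<exists>i<4. \<exists>j<4. i \<noteq> j \<and> D i j \<noteq> 0 \<and> ord p (D i j) = twist_ord N p"
proof (cases p)
  case (Aff x)
  obtain i j where ij: "i < 4" "j < 4" "poly (f i) x * poly (g j) x - poly (f j) x * poly (g i) x \<noteq> 0"
    using minor_nonzero_at[of "\<lambda>i. poly (f i) x" "\<lambda>i. poly (g i) x"] fibre by blast
  then have m: "poly (minor i j) x \<noteq> 0" by (simp add: minor_def)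
  then have "minor i j \<noteq> 0" "order x (minor i j) = 0" by (auto simp: order_0I)
  with ij show ?thesis using Aff by (intro exI[of _ i] exI[of _ j]) (auto simp: D_def ord_to_fract simp del: ord.simps)
next
  case Infty
  obtain i j where ij: "i < 4" "j < 4"
    "coeff (f i) n * coeff (g j) (Suc n) - coeff (f j) n * coeff (g i) (Suc n) \<noteq> 0"
    using minor_nonzero_at[of "\<lambda>i. coeff (f i) n" "\<lambda>i. coeff (g i) (Suc n)"] fibre_Infty by blast
  then have m: "coeff (minor i j) (n + Suc n) \<noteq> 0"
    using degree_f degree_g unfolding minor_def coeff_diff by (simp only: coeff_mult_top) simp
  then have nz: "minor i j \<noteq> 0" by auto
  have "degree (minor i j) \<ge> n + Suc n" using m by (rule le_degree)
  moreover have "degree (minor i j) \<le> n + Suc n"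
    using ij(1,2) degree_f degree_g unfolding minor_def
    by (intro degree_diff_le order.trans[OF degree_mult_le] add_mono) auto
  ultimately have "ord Infty (D i j) = - N"
    using nz by (simp add: D_def ord_to_fract del: ord.simps)
  with ij nz show ?thesis using Infty
    by (intro exI[of _ i] exI[of _ j]) (auto simp: D_def)
qed

lemma cramer:
  assumes "D i j \<noteq> 0"
  shows "vec2 a b = scaleK ((a * to_fract (g j) - b * to_fract (f j)) / D i j) (w i) +
                    scaleK ((b * to_fract (f i) - a * to_fract (g i)) / D i j) (w j)"
proof -
  have quot: "(x / D i j) * y + (z / D i j) * u = (x * y + z * u) / D i j" for x y z u
    by (simp add: add_divide_distrib)
  have "(a * to_fract (g j) - b * to_fract (f j)) * to_fract (f i) +
        (b * to_fract (f i) - a * to_fract (g i)) * to_fract (f j) = a * D i j"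
    "(a * to_fract (g j) - b * to_fract (f j)) * to_fract (g i) +
        (b * to_fract (f i) - a * to_fract (g i)) * to_fract (g j) = b * D i j"
    unfolding D_eq by (simp_all add: algebra_simps)
  then show ?thesis
    unfolding w_def pvec_def scaleK_vec2 vec2_add vec2_eq_iff quot using assms by simp
qed

lemma w_in_ambient: "i < 4 \<Longrightarrow> w i \<in> ambient p"
  unfolding ambient_def direct_sum_O_2 w_def pvec_def using to_fract_f to_fract_g by blast

text \<open>The numerators in Cramer's rule are sections of \<open>O(N)\<close>, and the denominator
  \<open>D i j\<close> can be chosen to generate \<open>O(N)\<close> at \<open>p\<close>, so the
  quotients are regular there.\<close>

lemma O_span_w: "O_span p 4 w = ambient p"
proof
  obtain c where c: "ambient p = O_span p 2 c"
    using direct_sum_O_2_eq_O_span unfolding ambient_def by blast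
  show "O_span p 4 w \<subseteq> ambient p"
    unfolding c by (rule O_span_subset) (use w_in_ambient in \<open>simp flip: c\<close>)
  show "ambient p \<subseteq> O_span p 4 w"
  proof
    fix v assume "v \<in> ambient p"
    then obtain a b where v: "v = vec2 a b" "a \<in> O_twist (int n) p" "b \<in> O_twist (int (Suc n)) p"
      unfolding ambient_def direct_sum_O_2 by blast
    obtain i j where ij: "i < 4" "j < 4" "D i j \<noteq> 0" "ord p (D i j) = twist_ord N p"
      using minor_exists by blast
    have "a * to_fract (g j) \<in> O_twist N p" "a * to_fract (g i) \<in> O_twist N p"
      using v ij by (auto intro: O_twist_mult2 to_fract_g simp del: of_nat_Suc)
    moreover have "to_fract (f j) * b \<in> O_twist N p" "to_fract (f i) * b \<in> O_twist N p"
      using v ij by (auto intro: O_twist_mult2 to_fract_f simp del: of_nat_Suc)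
    ultimately show "v \<in> O_span p 4 w"
      unfolding v(1) cramer[OF ij(3), of a b] using ij
      by (intro O_span_add O_span_scale O_span_base O_twist_generator[THEN iffD1, OF ij(3,4)] O_twist_diff)
        (auto simp: mult.commute)
  qed
qed

section \<open>The bundle of relations\<close>

definition relations :: sheaf where
  "relations p = {h \<in> trivial_bundle 4 p. lincomb 4 w h = 0}"

lemma lincomb_w: "lincomb 4 w h = vec2 (\<Sum>m<4. h m * to_fract (f m)) (\<Sum>m<4. h m * to_fract (g m))"
  by (simp add: lincomb_def w_def pvec_def scaleK_vec2 sum_vec2)

text \<open>The relation expressing \<open>w k\<close> by \<open>w i\<close> and \<open>w j\<close> through Cramer's rule.\<close>

definition cramer_rel :: "nat \<Rightarrow> nat \<Rightarrow> nat \<Rightarrow> rvec" where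
  "cramer_rel i j k m = (if m = k then 1 else if m = i then - D k j / D i j
      else if m = j then - D i k / D i j else 0)"

definition rel_frame :: "nat \<Rightarrow> nat \<Rightarrow> nat \<Rightarrow> nat \<Rightarrow> nat \<Rightarrow> rvec" where
  "rel_frame i j k l a = (if a = 0 then cramer_rel i j k else cramer_rel i j l)"

lemma lincomb_rel_frame:
  "lincomb 2 (rel_frame i j k l) h m = h 0 * cramer_rel i j k m + h 1 * cramer_rel i j l m"
  by (simp add: lincomb_apply sum_lessThan_2 rel_frame_def)

text \<open>The entries of a relation at \<open>k\<close> and \<open>l\<close> are its coordinates
  in \<open>rel_frame\<close>, since the two component equations determine the entries at the
  pivots.\<close>

lemma relation_eq_lincomb:
  assumes e: "enum4 i j k l" and D: "D i j \<noteq> 0" and h: "lincomb 4 w h = 0" "\<And>m. m \<ge> 4 \<Longrightarrow> h m = 0"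
    and a: "a 0 = h k" "a 1 = h l"
  shows "h = lincomb 2 (rel_frame i j k l) a"
proof
  fix m
  have "vec2 (\<Sum>m<4. h m * to_fract (f m)) (\<Sum>m<4. h m * to_fract (g m)) = vec2 0 0"
    using h(1) unfolding lincomb_w by simp
  then have F: "h i * to_fract (f i) + h j * to_fract (f j) + h k * to_fract (f k) + h l * to_fract (f l) = 0"
    and G: "h i * to_fract (g i) + h j * to_fract (g j) + h k * to_fract (g k) + h l * to_fract (g l) = 0"
    unfolding vec2_eq_iff enum4_sum[OF e] by auto
  \<comment> \<open>Eliminating \<open>h j\<close> between the two component equations; the second
    identity below eliminates \<open>h i\<close>.\<close>
  have "h i * D i j + h k * D k j + h l * D l j
     = (h i * to_fract (f i) + h j * to_fract (f j) + h k * to_fract (f k) + h l * to_fract (f l)) * to_fract (g j)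
     - (h i * to_fract (g i) + h j * to_fract (g j) + h k * to_fract (g k) + h l * to_fract (g l)) * to_fract (f j)"
    unfolding D_eq by (simp add: algebra_simps)
  then have hi: "h i * D i j = - (h k * D k j + h l * D l j)"
    unfolding F G by (simp add: algebra_simps eq_neg_iff_add_eq_0)
  have "h j * D i j + h k * D i k + h l * D i l
     = (h i * to_fract (g i) + h j * to_fract (g j) + h k * to_fract (g k) + h l * to_fract (g l)) * to_fract (f i)
     - (h i * to_fract (f i) + h j * to_fract (f j) + h k * to_fract (f k) + h l * to_fract (f l)) * to_fract (g i)"
    unfolding D_eq by (simp add: algebra_simps)
  then have hj: "h j * D i j = - (h k * D i k + h l * D i l)"
    unfolding F G by (simp add: algebra_simps eq_neg_iff_add_eq_0)
  have dist: "i \<noteq> j" "i \<noteq> k" "i \<noteq> l" "j \<noteq> k" "j \<noteq> l" "k \<noteq> l" using e by (auto simp: enum4_def)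
  show "h m = lincomb 2 (rel_frame i j k l) a m"
  proof (cases "m < 4")
    case True
    then consider "m = i" | "m = j" | "m = k" | "m = l" using enum4_cases[OF e] by blast
    then show ?thesis
    proof cases
      case 1
      have "h i = - (h k * D k j + h l * D l j) / D i j" using hi D by (simp add: field_simps)
      then show ?thesis using 1 dist a by (simp add: lincomb_rel_frame cramer_rel_def add_divide_distrib diff_divide_distrib)
    next
      case 2
      have "h j = - (h k * D i k + h l * D i l) / D i j" using hj D by (simp add: field_simps)
      then show ?thesis using 2 dist a by (simp add: lincomb_rel_frame cramer_rel_def add_divide_distrib diff_divide_distrib)
    qed (use dist a in \<open>auto simp: lincomb_rel_frame cramer_rel_def\<close>)
  next
    case False
    then have "m \<noteq> i" "m \<noteq> j" "m \<noteq> k" "m \<noteq> l" using enum4_less[OF e] by auto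
    with False h(2) show ?thesis by (simp add: lincomb_rel_frame cramer_rel_def)
  qed
qed

lemma cramer_rel_relation:
  assumes e: "enum4 i j k l" and D: "D i j \<noteq> 0"
  shows "lincomb 4 w (cramer_rel i j k) = 0"
proof -
  have dist: "i \<noteq> j" "i \<noteq> k" "i \<noteq> l" "j \<noteq> k" "j \<noteq> l" "k \<noteq> l" using e by (auto simp: enum4_def)
  have "D i j * (\<Sum>m<4. cramer_rel i j k m * to_fract (F m)) =
      D i j * to_fract (F k) - D k j * to_fract (F i) - D i k * to_fract (F j)" for F
    unfolding enum4_sum[OF e] cramer_rel_def using dist D by (simp add: field_simps)
  moreover have "D i j * to_fract (f k) - D k j * to_fract (f i) - D i k * to_fract (f j) = 0"
    "D i j * to_fract (g k) - D k j * to_fract (g i) - D i k * to_fract (g j) = 0"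
    unfolding D_eq by (auto simp: algebra_simps)
  ultimately have "D i j * (\<Sum>m<4. cramer_rel i j k m * to_fract (f m)) = 0"
    "D i j * (\<Sum>m<4. cramer_rel i j k m * to_fract (g m)) = 0"
    by metis+
  then show ?thesis using D unfolding lincomb_w by simp
qed

lemma enum4_swap: "enum4 i j k l \<Longrightarrow> enum4 i j l k"
  unfolding enum4_def by (auto simp: insert_commute)

lemma rel_frame_relation:
  assumes "enum4 i j k l" "D i j \<noteq> 0"
  shows "lincomb 4 w (rel_frame i j k l a) = 0"
  using cramer_rel_relation[of i j k l] cramer_rel_relation[of i j l k] assms enum4_swap
  by (auto simp: rel_frame_def)

lemma rel_frame_outside:
  assumes "enum4 i j k l" "m \<ge> 4"
  shows "rel_frame i j k l a m = 0"
  using assms enum4_less[OF assms(1)] by (auto simp: rel_frame_def cramer_rel_def)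

lemma rel_frame_indep:
  assumes "enum4 i j k l"
  shows "lin_indep_family 2 (rel_frame i j k l)"
  unfolding lin_indep_family_iff
proof (intro allI impI)
  fix h a assume h: "lincomb 2 (rel_frame i j k l) h = 0" and a: "a < (2::nat)"
  have dist: "i \<noteq> j" "i \<noteq> k" "i \<noteq> l" "j \<noteq> k" "j \<noteq> l" "k \<noteq> l" using assms by (auto simp: enum4_def)
  have "h 0 = 0" using fun_cong[OF h, of k] dist by (simp add: lincomb_rel_frame cramer_rel_def)
  moreover have "h 1 = 0" using fun_cong[OF h, of l] dist by (simp add: lincomb_rel_frame cramer_rel_def)
  ultimately show "h a = 0" using a by (auto simp: less_2)
qed

lemma relations_frame:
  assumes e: "enum4 i j k l" and D: "D i j \<noteq> 0" "ord p (D i j) = twist_ord N p"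
  shows "relations p = O_span p 2 (rel_frame i j k l)"
proof (intro Set.set_eqI iffI)
  fix h assume h: "h \<in> relations p"
  have "h = lincomb 2 (rel_frame i j k l) (\<lambda>a. if a = 0 then h k else h l)"
    using h by (intro relation_eq_lincomb[OF e D(1)]) (auto simp: relations_def trivial_bundle_iff)
  also have "\<dots> \<in> O_span p 2 (rel_frame i j k l)"
    using h enum4_less[OF e] by (intro O_spanI) (auto simp: relations_def trivial_bundle_iff)
  finally show "h \<in> O_span p 2 (rel_frame i j k l)" .
next
  fix h assume "h \<in> O_span p 2 (rel_frame i j k l)"
  then obtain a where h: "h = lincomb 2 (rel_frame i j k l) a" "\<forall>m<2. a m \<in> O_stalk p"
    by (auto simp: O_span_eq)
  have "lincomb 4 w h = (\<lambda>m. a 0 * lincomb 4 w (rel_frame i j k l 0) m + a 1 * lincomb 4 w (rel_frame i j k l 1) m)"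
    by (simp add: fun_eq_iff h(1) lincomb_apply sum_lessThan_2 sum_distrib_left sum.distrib algebra_simps)
  then have "lincomb 4 w h = 0" using e D(1) by (simp add: rel_frame_relation fun_eq_iff)
  moreover have "cramer_rel i j k' m \<in> O_stalk p" if "k' < 4" for m k'
  proof -
    have "D a b / D i j \<in> O_stalk p" if "a < 4" "b < 4" for a b
      using D_in[OF that, of p] O_twist_generator[OF D] by blast
    then show ?thesis using that enum4_less[OF e] O_stalk_uminus
      unfolding cramer_rel_def minus_divide_left[symmetric] by auto
  qed
  then have "h m \<in> O_stalk p" for m
    using h enum4_less[OF e] unfolding h(1) lincomb_rel_frame
    by (intro O_twist_add O_stalk_mult) auto
  moreover have "h m = 0" if "m \<ge> 4" for m
    using rel_frame_outside[OF e that] by (simp add: h(1) lincomb_apply)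
  ultimately show "h \<in> relations p" by (auto simp: relations_def trivial_bundle_iff)
qed

lemma locally_free_relations: "locally_free 2 relations"
  unfolding locally_free_def
proof
  fix p
  obtain i j where ij: "i < 4" "j < 4" "i \<noteq> j" "D i j \<noteq> 0" "ord p (D i j) = twist_ord N p"
    using minor_exists by blast
  obtain k l where e: "enum4 i j k l" using enum4_exists ij by blast
  \<comment> \<open>Where \<open>D i j\<close> generates \<open>O(N)\<close>, one and the same
    \<open>rel_frame\<close> works. Its complement lies among the finitely many zeros of
    \<open>D i j\<close> and \<open>Infty\<close>.\<close>
  define U where "U = {q. ord q (D i j) = twist_ord N q}"
  have "- U \<subseteq> {q. ord q (D i j) \<noteq> 0} \<union> {Infty}" by (auto simp: U_def twist_ord_def)
  then have "zopen U" using finite_ord[OF ij(4)] finite_subset unfolding zopen_def by blast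
  then show "\<exists>U b. zopen U \<and> p \<in> U \<and> lin_indep_family 2 b \<and> (\<forall>q\<in>U. relations q = O_span q 2 b)"
    using ij e rel_frame_indep[OF e] relations_frame[OF e ij(4)]
    by (intro exI[of _ U] exI[of _ "rel_frame i j k l"]) (auto simp: U_def)
qed

text \<open>Duality of minors: a minor of a basis of the kernel equals, up to sign, the
  complementary minor of the matrix times a common factor, here \<open>1 / D i j\<close>.\<close>

lemma rel_frame_det:
  assumes e: "enum4 i j k l" and e': "enum4 i' j' k' l'" and D: "D i j \<noteq> 0"
  defines "b \<equiv> rel_frame i j k l"
  defines "d \<equiv> b 0 k' * b 1 l' - b 1 k' * b 0 l'"
  shows "d = D i' j' / D i j \<or> d = - (D i' j' / D i j)"
proof -
  have dist: "i \<noteq> j" "i \<noteq> k" "i \<noteq> l" "j \<noteq> k" "j \<noteq> l" "k \<noteq> l" using e by (auto simp: enum4_def)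
  have b: "b 0 i = - D k j / D i j" "b 0 j = - D i k / D i j" "b 0 k = 1" "b 0 l = 0"
    "b 1 i = - D l j / D i j" "b 1 j = - D i l / D i j" "b 1 k = 0" "b 1 l = 1"
    using dist by (auto simp: b_def rel_frame_def cramer_rel_def)
  have Dswap: "D x y = - D y x" for x y by (simp add: D_eq)
  \<comment> \<open>The three-term Pluecker relation for the 2 by 4 matrix of the sections.\<close>
  have Dkl: "(D k j * D i l - D l j * D i k) / (D i j * D i j) = D k l / D i j"
  proof -
    have "D k j * D i l - D l j * D i k = D k l * D i j" unfolding D_eq by (simp add: algebra_simps)
    then show ?thesis using D by simp
  qed
  define Q where "Q x y u v \<longleftrightarrow> b 0 x * b 1 y - b 1 x * b 0 y \<in> {D u v / D i j, - (D u v / D i j)}" for x y u v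
  have Q1: "Q y x u v" if "Q x y u v" for x y u v
    using that by (auto simp: Q_def algebra_simps)
  have Q2: "Q x y v u" if "Q x y u v" for x y u v
    using that Dswap[of u v] by (auto simp: Q_def)
  have Q: "Q k l i j" "Q k i l j" "Q k j i l" "Q l i k j" "Q l j i k" "Q i j k l"
    unfolding Q_def b using Dkl D by (auto simp: diff_divide_distrib)
  \<comment> \<open>Six choices of the pair of rows, each in two orders on either side, give all 24
    arrangements of the indices.\<close>
  note Qs = Q Q[THEN Q1] Q[THEN Q2] Q[THEN Q1, THEN Q2]
  have S: "{i', j', k', l'} = {i, j, k, l}" and dist': "distinct [i', j', k', l']"
    using e e' unfolding enum4_def by blast+
  have "i' \<in> {i, j, k, l}" "j' \<in> {i, j, k, l}" "k' \<in> {i, j, k, l}" "l' \<in> {i, j, k, l}"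
    unfolding S[symmetric] by auto
  then have "Q k' l' i' j'"
    using dist' by (elim insertE emptyE) (simp_all add: Qs)
  then show ?thesis by (simp add: Q_def d_def)
qed

text \<open>A rational frame with fixed pivots is compared at each point with a frame whose pivot
  minor generates \<open>O(N)\<close> there. By \<open>rel_frame_det\<close> the resulting divisor
  is that of \<open>1 / D i j\<close> minus \<open>N\<close> times \<open>Infty\<close>.\<close>

lemma deg_relations: "deg relations = - N"
proof -
  obtain i j where ij: "i < 4" "j < 4" "i \<noteq> j" "D i j \<noteq> 0"
    using minor_exists by blast
  obtain k l where e: "enum4 i j k l" using enum4_exists ij by blast
  define b where "b = rel_frame i j k l"
  show ?thesis
  proof (rule deg_eqI)
    show "lin_indep_family 2 b" unfolding b_def by (rule rel_frame_indep[OF e])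
    show "1 / D i j \<noteq> 0" using ij by simp
    fix p
    obtain i' j' where ij': "i' < 4" "j' < 4" "i' \<noteq> j'" "D i' j' \<noteq> 0" "ord p (D i' j') = twist_ord N p"
      using minor_exists by blast
    obtain k' l' where e': "enum4 i' j' k' l'" using enum4_exists ij' by blast
    define A where "A = mat 2 2 (\<lambda>(x, a). b a (if x = 0 then k' else l'))"
    have A: "A \<in> carrier_mat 2 2" by (simp add: A_def)
    have "b a = lincomb 2 (rel_frame i' j' k' l') (\<lambda>x. A $$ (x, a))" if "a < 2" for a
      using that rel_frame_relation[OF e ij(4)] rel_frame_outside[OF e]
      by (intro relation_eq_lincomb[OF e' ij'(4)]) (auto simp: b_def A_def)
    moreover have "det A = D i' j' / D i j \<or> det A = - (D i' j' / D i j)"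
      using rel_frame_det[OF e e' ij(4)] by (simp add: det_2[OF A]) (simp add: A_def b_def)
    then have "ord p (det A) = ord p (D i' j' / D i j)" by auto
    then have "ord p (det A) = ord p (1 / D i j) + (if p = Infty then - N else 0)"
      using ij ij' by (simp add: ord_divide twist_ord_def)
    ultimately show "\<exists>c A. lin_indep_family 2 c \<and> relations p = O_span p 2 c \<and> A \<in> carrier_mat 2 2 \<and>
        (\<forall>a<2. b a = lincomb 2 c (\<lambda>x. A $$ (x, a))) \<and>
        ord p (det A) = ord p (1 / D i j) + (if p = Infty then - N else 0)"
      using rel_frame_indep[OF e'] relations_frame[OF e' ij'(4,5)] A by blast
  qed
qed

end

section \<open>A destabilising line subsheaf\<close>

text \<open>A copy of \<open>O(k)\<close> whose generic stalk is the line through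
  \<open>v\<close>.\<close>

definition line_sheaf :: "int \<Rightarrow> rvec \<Rightarrow> sheaf" where
  "line_sheaf k v p = {scaleK c v | c. c \<in> O_twist k p}"

lemma lin_indep_single: "v \<noteq> 0 \<Longrightarrow> lin_indep_family 1 (\<lambda>_. v)"
  by (simp add: lin_indep_family_iff lincomb_def)

lemma line_sheaf_frame:
  assumes "u \<noteq> 0" "ord p u = twist_ord k p"
  shows "line_sheaf k v p = O_span p 1 (\<lambda>_. scaleK u v)"
proof -
  have "scaleK c v = scaleK (c / u) (scaleK u v)" for c using assms(1) by simp
  then have "line_sheaf k v p = {scaleK (c / u) (scaleK u v) | c. c \<in> O_twist k p}"
    unfolding line_sheaf_def by metis
  also have "\<dots> = {scaleK c (scaleK u v) | c. c \<in> O_stalk p}"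
  proof (intro Set.set_eqI iffI)
    fix y assume "y \<in> {scaleK c (scaleK u v) | c. c \<in> O_stalk p}"
    then obtain c where c: "y = scaleK c (scaleK u v)" "c \<in> O_stalk p" by blast
    have "(c * u) / u = c" using assms(1) by simp
    then have "c * u \<in> O_twist k p" "y = scaleK ((c * u) / u) (scaleK u v)"
      using c O_twist_generator[OF assms, of "c * u"] by simp_all
    then show "y \<in> {scaleK (c / u) (scaleK u v) | c. c \<in> O_twist k p}" by blast
  qed (use O_twist_generator[OF assms] in blast)
  also have "\<dots> = O_span p 1 (\<lambda>_. scaleK u v)"
    by (auto simp: O_span_def)
  finally show ?thesis .
qed

lemma ord_inverse_tpow:
  "ord Infty (1 / tpow k) = int k" "x \<noteq> 0 \<Longrightarrow> ord (Aff x) (1 / tpow k) = 0"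
  by (simp_all add: ord_divide del: ord.simps)

lemma locally_free_line_sheaf:
  assumes "v \<noteq> 0"
  shows "locally_free 1 (line_sheaf (- int k) v)"
  unfolding locally_free_def
proof
  fix p
  have ind: "u \<noteq> 0 \<Longrightarrow> lin_indep_family 1 (\<lambda>_. scaleK u v)" for u
    using assms by (intro lin_indep_single) simp
  show "\<exists>U b. zopen U \<and> p \<in> U \<and> lin_indep_family 1 b \<and> (\<forall>q\<in>U. line_sheaf (- int k) v q = O_span q 1 b)"
  proof (cases p)
    case (Aff x)
    have "line_sheaf (- int k) v q = O_span q 1 (\<lambda>_. scaleK 1 v)" if "q \<in> range Aff" for q
      using that by (intro line_sheaf_frame) (auto simp del: ord.simps)
    then show ?thesis using Aff ind[of 1]
      by (intro exI[of _ "range Aff"] exI[of _ "\<lambda>_. scaleK 1 v"]) auto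
  next
    case Infty
    have "line_sheaf (- int k) v q = O_span q 1 (\<lambda>_. scaleK (1 / tpow k) v)" if "q \<noteq> Aff 0" for q
      using that by (intro line_sheaf_frame; cases q) (auto simp: ord_inverse_tpow simp del: ord.simps)
    then show ?thesis using Infty ind[of "1 / tpow k"]
      by (intro exI[of _ "- {Aff 0}"] exI[of _ "\<lambda>_. scaleK (1 / tpow k) v"])
        (auto simp: zopen_compl_finite)
  qed
qed

lemma deg_line_sheaf:
  assumes "v \<noteq> 0"
  shows "deg (line_sheaf (- int k) v) = - int k"
proof (rule deg_eqI)
  show "lin_indep_family 1 (\<lambda>_. v)" using assms by (rule lin_indep_single)
  fix p
  define u where "u = (if p = Infty then 1 / tpow k else 1)"
  have u: "u \<noteq> 0" "ord p u = twist_ord (- int k) p"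
    by (auto simp: u_def twist_ord_def ord_inverse_tpow simp del: ord.simps)
  define A where "A = mat 1 1 (\<lambda>_. 1 / u)"
  have A: "A \<in> carrier_mat 1 1" by (simp add: A_def)
  have "det A = 1 / u" by (simp add: det_single[OF A]) (simp add: A_def)
  then have "ord p (det A) = ord p 1 + (if p = Infty then - int k else 0)"
    using u by (simp add: ord_divide twist_ord_def)
  moreover have "v = lincomb 1 (\<lambda>_. scaleK u v) (\<lambda>i. A $$ (i, j))" if "j < 1" for j
    using that u by (simp add: lincomb_def A_def)
  moreover have "lin_indep_family 1 (\<lambda>_. scaleK u v)" using assms u by (intro lin_indep_single) simp
  ultimately show "\<exists>c A. lin_indep_family 1 c \<and> line_sheaf (- int k) v p = O_span p 1 c \<and>
      A \<in> carrier_mat 1 1 \<and> (\<forall>j<1. v = lincomb 1 c (\<lambda>i. A $$ (i, j))) \<and>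
      ord p (det A) = ord p 1 + (if p = Infty then - int k else 0)"
    using line_sheaf_frame[OF u, of v] A
    by (intro exI[of _ "\<lambda>_. scaleK u v"] exI[of _ A] conjI allI impI)
qed simp

context spanning_family
begin

text \<open>The vector of the \<open>y i\<close> has its only poles at \<open>Infty\<close>, of
  order at most \<open>n\<close>, and multiplication by \<open>O(- n)\<close> cancels them. This
  gives a line subsheaf of slope \<open>- n\<close>, above the slope \<open>- n - 1 / 2\<close> of
  the relations.\<close>

lemma relations_not_semistable:
  assumes y: "\<And>i. i < 4 \<Longrightarrow> degree (y i) \<le> n" "(\<Sum>i<4. y i * f i) = 0" "(\<Sum>i<4. y i * g i) = 0"
    and nz: "i < 4" "y i \<noteq> 0"
  shows "\<not> semistable relations"
proof -
  define v :: rvec where "v = (\<lambda>i. if i < 4 then to_fract (y i) else 0)"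
  have v: "v \<noteq> 0" using nz by (auto simp: v_def fun_eq_iff)
  have "lincomb 4 w v = 0"
    unfolding lincomb_w v_def using y(2,3) by (simp flip: to_fract_mult to_fract_sum)
  moreover have "lincomb 4 w (scaleK c v) = scaleK c (lincomb 4 w v)" for c
    unfolding scaleK_lincomb by (simp add: scaleK_def[of c v])
  ultimately have kv: "lincomb 4 w (scaleK c v) = 0" for c by simp
  define G where "G = line_sheaf (- int n) v"
  have "scaleK c v \<in> relations p" if "c \<in> O_twist (- int n) p" for c p
  proof -
    have "c * v i \<in> O_stalk p" if "i < 4" for i
      using O_twist_mult2[OF \<open>c \<in> _\<close> poly_in_O_twist[OF y(1)[OF that]]] that by (simp add: v_def)
    then show ?thesis using kv by (auto simp: relations_def trivial_bundle_iff scaleK_def v_def)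
  qed
  then have "subsheaf G relations" by (auto simp: subsheaf_def G_def line_sheaf_def)
  moreover have "locally_free 1 G" using v by (simp add: G_def locally_free_line_sheaf del: One_nat_def)
  then have "vector_bundle G" "rk G = 1" using rk_eq vector_bundle_def by blast+
  moreover have "slope G = - real n"
    using deg_line_sheaf[OF v, of n] \<open>rk G = 1\<close> by (simp add: slope_def G_def)
  moreover have "slope relations = - real n - 1 / 2"
    using deg_relations rk_eq[OF locally_free_relations] by (simp add: slope_def field_simps)
  ultimately show ?thesis unfolding semistable_def by (intro notI, drule_tac spec[of _ G]) simp
qed

lemma dual_span_bundle_eq:
  assumes "length vs = 4" "\<And>i. i < 4 \<Longrightarrow> vs ! i = w i"
  shows "dual_span_bundle vs = relations"
  using assms by (intro ext) (simp add: dual_span_bundle_def relations_def lincomb_def)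

end

lemma CV_subspace_O_span: "CV.subspace (O_span p k w)"
  unfolding CV.subspace_def scaleC_def by (auto intro: O_span_add O_span_scale)

lemma pvec_sum: "(\<Sum>i\<in>S. pvec (a i) (b i)) = pvec (sum a S) (sum b S)"
  by (simp add: pvec_def sum_vec2)

lemma scaleC_pvec: "scaleC c (pvec a b) = pvec (Polynomial.smult c a) (Polynomial.smult c b)"
proof -
  have "Polynomial.smult c a = [:c:] * a" for a by simp
  then show ?thesis by (simp only: scaleC_def pvec_def scaleK_vec2 to_fract_mult)
qed

lemma scaleK_pvec: "scaleK (to_fract h) (pvec a b) = pvec (h * a) (h * b)"
  by (simp add: pvec_def scaleK_vec2)

context spanning_family
begin

lemma generated_span:
  assumes "inj_on w {..<4}"
  shows "generated ambient (CV.span (w ` {..<4}))"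
proof -
  have "CV.subspace (ambient p)" for p
    unfolding O_span_w[symmetric] by (rule CV_subspace_O_span)
  then have "CV.span (w ` {..<4}) \<subseteq> ambient p" for p
    by (intro CV.span_minimal) (auto intro: w_in_ambient)
  then have "CV.span (w ` {..<4}) \<subseteq> global_sections ambient" by (auto simp: global_sections_def)
  moreover have "vector_bundle ambient"
    unfolding ambient_def vector_bundle_def using locally_free_direct_sum_O_2 by blast
  ultimately show ?thesis
    unfolding generated_def coherent_system_def using eval_image_span[OF assms] O_span_w by auto
qed

end

section \<open>Degrees of sheaves with one relation, and linear stability\<close>

section \<open>Families with a single relation\<close>

lemma ratfun_common_denominator:
  fixes c :: "nat \<Rightarrow> ratfun"
  obtains d y where "d \<noteq> 0" "\<And>i. i < k \<Longrightarrow> c i * to_fract d = to_fract (y i)"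
proof -
  have "\<exists>d y. d \<noteq> 0 \<and> (\<forall>i<k. c i * to_fract d = to_fract (y i))"
  proof (induction k)
    case 0
    show ?case by (intro exI[of _ 1]) auto
  next
    case (Suc k)
    then obtain d y where dy: "d \<noteq> 0" "\<forall>i<k. c i * to_fract d = to_fract (y i)" by blast
    obtain a b where ab: "c k = to_fract a / to_fract b" "b \<noteq> 0" by (rule ratfun_quot)
    have "c i * to_fract (d * b) = to_fract (if i < k then y i * b else a * d)" if "i < Suc k" for i
    proof (cases "i < k")
      case True
      then show ?thesis using dy(2) by (simp flip: mult.assoc)
    next
      case False
      with that have "i = k" by simp
      then show ?thesis using ab by simp
    qed
    moreover have "d * b \<noteq> 0" using dy ab by simp
    ultimately show ?case
      by (intro exI[of _ "d * b"] exI[of _ "\<lambda>i. if i < k then y i * b else a * d"]) simp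
  qed
  then show ?thesis using that by blast
qed

text \<open>After clearing denominators, take a polynomial relation of least total degree: a common
  root of its coefficients could be divided out.\<close>

lemma primitive_relation:
  assumes "\<not> lin_indep_family k u"
  obtains h where "(\<Sum>i<k. scaleK (to_fract (h i)) (u i)) = 0" "\<exists>i<k. h i \<noteq> 0"
    "\<And>x. \<exists>i<k. poly (h i) x \<noteq> 0"
proof -
  define R where "R h \<longleftrightarrow> (\<Sum>i<k. scaleK (to_fract (h i)) (u i)) = 0 \<and> (\<exists>i<k. h i \<noteq> 0)" for h
  obtain c i where c: "lincomb k u c = 0" "i < k" "c i \<noteq> 0"
    using assms by (auto simp: lin_indep_family_iff)
  obtain d y where dy: "d \<noteq> 0" "\<And>i. i < k \<Longrightarrow> c i * to_fract d = to_fract (y i)"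
    using ratfun_common_denominator by blast
  have "(\<Sum>i<k. scaleK (to_fract (y i)) (u i)) = scaleK (to_fract d) (lincomb k u c)"
    unfolding scaleK_lincomb unfolding lincomb_def using dy(2) by (simp add: mult.commute)
  moreover have "y i \<noteq> 0" using c dy(1) dy(2)[of i] by auto
  ultimately have "R y" using c by (auto simp: R_def)
  define \<mu> where "\<mu> h = (\<Sum>i<k. degree (h i :: complex poly))" for h
  obtain h where h: "R h" and min: "\<And>h'. R h' \<Longrightarrow> \<mu> h \<le> \<mu> h'"
    using ex_has_least_nat[of R y \<mu>] \<open>R y\<close> by blast
  have "\<exists>i<k. poly (h i) x \<noteq> 0" for x
  proof (rule ccontr)
    assume "\<not> ?thesis"
    then have "\<forall>i<k. [:-x, 1:] dvd h i" by (auto simp: poly_eq_0_iff_dvd)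
    then have "\<forall>i. \<exists>q. i < k \<longrightarrow> h i = [:-x, 1:] * q" unfolding dvd_def by blast
    then obtain q where q: "\<And>i. i < k \<Longrightarrow> h i = [:-x, 1:] * q i" by metis
    have "scaleK (to_fract [:-x, 1:]) (\<Sum>i<k. scaleK (to_fract (q i)) (u i)) = (\<Sum>i<k. scaleK (to_fract (h i)) (u i))"
      using q unfolding KV.scale_sum_right by (intro sum.cong) (simp_all del: mult_pCons_left)
    then have "(\<Sum>i<k. scaleK (to_fract (q i)) (u i)) = 0" using h by (auto simp: R_def)
    moreover obtain j where j: "j < k" "h j \<noteq> 0" using h by (auto simp: R_def)
    then have "q j \<noteq> 0" using q[of j] by auto
    ultimately have "R q" using j by (auto simp: R_def)
    have deg: "degree (q i) + (if q i = 0 then 0 else 1) = degree (h i)" if "i < k" for i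
      using q[OF that] by (cases "q i = 0") (simp_all add: degree_mult_eq del: mult_pCons_left)
    have "degree (q i) \<le> degree (h i)" if "i < k" for i using deg[OF that] by simp
    moreover have "degree (q j) < degree (h j)" using deg[OF j(1)] \<open>q j \<noteq> 0\<close> by simp
    ultimately have "\<mu> q < \<mu> h" unfolding \<mu>_def using j(1) by (intro sum_strict_mono_ex1) auto
    with min[OF \<open>R q\<close>] show False by simp
  qed
  with h that show ?thesis by (auto simp: R_def)
qed

text \<open>The exact sequence \<open>0 \<rightarrow> O(- m) \<rightarrow> O^(r+1) \<rightarrow>
  sheaf_u \<rightarrow> 0\<close> in terms of coordinates. The absence of a common root and the
  attained degree say that \<open>h\<close>, as a section of \<open>O(m)^(r+1)\<close>, vanishes
  nowhere, including infinity; hence the quotient is locally free of degree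
  \<open>m\<close>.\<close>

locale single_relation =
  fixes r :: nat and u :: "nat \<Rightarrow> rvec" and h :: "nat \<Rightarrow> complex poly" and m :: nat
  assumes indep: "lin_indep_family r u"
    and relation: "(\<Sum>i<Suc r. scaleK (to_fract (h i)) (u i)) = 0"
    and h_last: "h r \<noteq> 0"
    and no_common_root: "\<exists>i<Suc r. poly (h i) x \<noteq> 0"
    and degree_h: "i < Suc r \<Longrightarrow> degree (h i) \<le> m"
    and degree_attained: "\<exists>i<Suc r. h i \<noteq> 0 \<and> degree (h i) = m"
begin

definition sheaf_u :: sheaf where "sheaf_u p = O_span p (Suc r) u"

definition q :: "nat \<Rightarrow> ratfun" where "q j = to_fract (h j) / to_fract (h r)"

lemma u_last: "u r = lincomb r u (\<lambda>j. - q j)"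
proof -
  have "scaleK (1 / to_fract (h r)) (\<Sum>i<Suc r. scaleK (to_fract (h i)) (u i)) = 0"
    unfolding relation by simp
  then have "(\<Sum>i<r. scaleK (q i) (u i)) + u r = 0"
    using h_last by (simp add: KV.scale_sum_right q_def KV.scale_right_distrib)
  then show ?thesis by (simp add: lincomb_def sum_negf eq_neg_iff_add_eq_0 add.commute)
qed

text \<open>Where \<open>h i\<close> generates \<open>O(m)\<close>, the relation can be solved for
  \<open>u i\<close>, and the other generators form a frame; \<open>u r\<close> takes the place of
  \<open>u i\<close>.\<close>

definition exch :: "nat \<Rightarrow> nat \<Rightarrow> rvec" where
  "exch i j = (if j = i then u r else u j)"

text \<open>Its columns are the coordinates of \<open>u 0, ..., u (r - 1)\<close> in the exchanged
  family: the identity except for column \<open>i\<close>, which is the solved relation.\<close>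

definition exch_mat :: "nat \<Rightarrow> ratfun mat" where
  "exch_mat i = replace_col (1\<^sub>m r) (vec r (\<lambda>j. if j = i then - (1 / q i) else - (q j / q i))) i"

lemma lincomb_exch:
  assumes "i < r"
  shows "lincomb r (exch i) a = lincomb r u (\<lambda>j. (if j = i then 0 else a j) - a i * q j)"
proof -
  have "lincomb r (exch i) a = (\<Sum>j<r. (if j = i then scaleK (a i) (u r) else 0) + (if j = i then 0 else scaleK (a j) (u j)))"
    unfolding lincomb_def exch_def by (intro sum.cong) auto
  also have "\<dots> = scaleK (a i) (u r) + lincomb r u (\<lambda>j. if j = i then 0 else a j)"
    using assms unfolding sum.distrib lincomb_def by (simp add: if_distrib[of "\<lambda>x. scaleK x _"] cong: if_cong)
  also have "\<dots> = lincomb r u (\<lambda>j. (if j = i then 0 else a j) - a i * q j)"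
    unfolding u_last scaleK_lincomb lincomb_diff by (simp add: lincomb_def sum_negf)
  finally show ?thesis .
qed

lemma u_eq_lincomb_exch:
  assumes "i < r" "h i \<noteq> 0"
  shows "u i = lincomb r (exch i) (\<lambda>j. if j = i then - (1 / q i) else - (q j / q i))"
proof -
  have "q i \<noteq> 0" using assms h_last by (simp add: q_def)
  then have "lincomb r (exch i) (\<lambda>j. if j = i then - (1 / q i) else - (q j / q i)) =
      lincomb r u (\<lambda>j. if j = i then 1 else 0)"
    unfolding lincomb_exch[OF assms(1)] by (intro lincomb_cong) auto
  then show ?thesis using assms by (simp add: lincomb_unit)
qed

lemma exch_indep:
  assumes "i < r" "h i \<noteq> 0"
  shows "lin_indep_family r (exch i)"
  unfolding lin_indep_family_iff
proof (intro allI impI)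
  fix a j assume a: "lincomb r (exch i) a = 0" and j: "j < r"
  have qi: "q i \<noteq> 0" using assms h_last by (simp add: q_def)
  have *: "\<forall>j<r. (if j = i then 0 else a j) - a i * q j = 0"
    using a indep unfolding lincomb_exch[OF assms(1)] lin_indep_family_iff by blast
  then have "a i * q i = 0" using assms by auto
  then have "a i = 0" using qi by simp
  with * j show "a j = 0" by (cases "j = i") auto
qed

lemma exch_mat:
  assumes "i < r" "h i \<noteq> 0"
  shows "exch_mat i \<in> carrier_mat r r" "det (exch_mat i) = - (to_fract (h r) / to_fract (h i))"
    "\<And>j. j < r \<Longrightarrow> u j = lincomb r (exch i) (\<lambda>l. exch_mat i $$ (l, j))"
proof -
  show "exch_mat i \<in> carrier_mat r r" by (simp add: exch_mat_def replace_col_def)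
  define v where "v = vec r (\<lambda>j. if j = i then - (1 / q i) else - (q j / q i))"
  have "det (replace_col (1\<^sub>m r) (1\<^sub>m r *\<^sub>v v) i) = v $ i * det (1\<^sub>m r)"
    by (rule cramer_lemma_mat) (use assms in \<open>auto simp: v_def\<close>)
  then show "det (exch_mat i) = - (to_fract (h r) / to_fract (h i))"
    using assms by (simp add: exch_mat_def v_def q_def)
  fix j assume j: "j < r"
  show "u j = lincomb r (exch i) (\<lambda>l. exch_mat i $$ (l, j))"
  proof (cases "j = i")
    case True
    have "lincomb r (exch i) (\<lambda>l. exch_mat i $$ (l, i)) =
        lincomb r (exch i) (\<lambda>j. if j = i then - (1 / q i) else - (q j / q i))"
      using assms by (intro lincomb_cong) (auto simp: exch_mat_def replace_col_def)
    then show ?thesis using True u_eq_lincomb_exch[OF assms] by simp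
  next
    case False
    have "lincomb r (exch i) (\<lambda>l. exch_mat i $$ (l, j)) = lincomb r (exch i) (\<lambda>l. if l = j then 1 else 0)"
      using j False assms by (intro lincomb_cong) (auto simp: exch_mat_def replace_col_def)
    then show ?thesis using j False by (simp add: lincomb_unit exch_def)
  qed
qed

text \<open>The frame and the matrix depend on \<open>i\<close> only, not on the point. Solving for
  \<open>u i\<close> introduces the coefficients \<open>h j / h i\<close>, which are regular
  wherever \<open>h i\<close> generates \<open>O(m)\<close>.\<close>

lemma local_frame:
  assumes i: "i < Suc r" "h i \<noteq> 0"
  obtains c A where "lin_indep_family r c"
    "A \<in> carrier_mat r r" "\<And>j. j < r \<Longrightarrow> u j = lincomb r c (\<lambda>l. A $$ (l, j))"
    "\<And>p. ord p (det A) = ord p (to_fract (h r)) - ord p (to_fract (h i))"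
    "\<And>p. ord p (to_fract (h i)) = twist_ord (int m) p \<Longrightarrow> sheaf_u p = O_span p r c"
proof -
  have quot: "to_fract (h j) / to_fract (h i) \<in> O_stalk p"
    if "ord p (to_fract (h i)) = twist_ord (int m) p" "j < Suc r" for p j
    using O_twist_generator[of "to_fract (h i)" p "int m" "to_fract (h j)"] i that
      poly_in_O_twist[OF degree_h[OF that(2)]] by simp
  show ?thesis
  proof (cases "i = r")
    case True
    have "u j = lincomb r u (\<lambda>l. 1\<^sub>m r $$ (l, j))" if "j < r" for j
    proof -
      have "lincomb r u (\<lambda>l. 1\<^sub>m r $$ (l, j)) = lincomb r u (\<lambda>l. if l = j then 1 else 0)"
        using that by (intro lincomb_cong) auto
      then show ?thesis using that by (simp add: lincomb_unit)
    qed
    moreover have "sheaf_u p = O_span p r u" if p: "ord p (to_fract (h i)) = twist_ord (int m) p" for p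
    proof
      have "u r \<in> O_span p r u"
        unfolding u_last by (rule O_spanI) (use quot[OF p] True in \<open>auto simp: q_def intro!: O_stalk_uminus\<close>)
      then show "sheaf_u p \<subseteq> O_span p r u"
        unfolding sheaf_u_def by (intro O_span_subset) (auto simp: less_Suc_eq intro: O_span_base)
      show "O_span p r u \<subseteq> sheaf_u p"
        unfolding sheaf_u_def by (intro O_span_subset O_span_base) auto
    qed
    ultimately show ?thesis using that[of u "1\<^sub>m r"] indep True by simp
  next
    case False
    with i have ir: "i < r" by simp
    have "sheaf_u p = O_span p r (exch i)" if p: "ord p (to_fract (h i)) = twist_ord (int m) p" for p
    proof
      have "u i \<in> O_span p r (exch i)"
        unfolding u_eq_lincomb_exch[OF ir i(2)]
        by (rule O_spanI) (use quot[OF p] h_last in \<open>auto simp: q_def intro!: O_stalk_uminus\<close>)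
      moreover have "u j \<in> O_span p r (exch i)" if "j < Suc r" "j \<noteq> i" for j
        using that O_span_base[of j r "exch i"] O_span_base[of i r "exch i"] ir
        by (cases "j = r") (auto simp: exch_def)
      ultimately show "sheaf_u p \<subseteq> O_span p r (exch i)"
        unfolding sheaf_u_def by (intro O_span_subset) metis
      have "exch i j \<in> O_span p (Suc r) u" if "j < r" for j
        using that O_span_base[of j "Suc r" u] O_span_base[of r "Suc r" u] by (auto simp: exch_def)
      then show "O_span p r (exch i) \<subseteq> sheaf_u p"
        unfolding sheaf_u_def by (intro O_span_subset) auto
    qed
    moreover have "ord p (det (exch_mat i)) = ord p (to_fract (h r)) - ord p (to_fract (h i))" for p
      using exch_mat(2)[OF ir i(2)] h_last i(2) by (simp add: ord_divide)
    ultimately show ?thesis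
      using that[OF exch_indep[OF ir i(2)] exch_mat(1)[OF ir i(2)] exch_mat(3)[OF ir i(2)]] by blast
  qed
qed

lemma generator_exists: "\<exists>i<Suc r. h i \<noteq> 0 \<and> ord p (to_fract (h i)) = twist_ord (int m) p"
proof (cases p)
  case (Aff x)
  obtain i where "i < Suc r" "poly (h i) x \<noteq> 0" using no_common_root by blast
  moreover from this have "h i \<noteq> 0" "order x (h i) = 0" by (auto simp: order_0I)
  ultimately show ?thesis using Aff by (auto simp: ord_to_fract simp del: ord.simps)
next
  case Infty
  then show ?thesis using degree_attained by (auto simp: ord_to_fract simp del: ord.simps)
qed

lemma locally_free_sheaf_u: "locally_free r sheaf_u"
  unfolding locally_free_def
proof
  fix p
  obtain i where i: "i < Suc r" "h i \<noteq> 0" "ord p (to_fract (h i)) = twist_ord (int m) p"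
    using generator_exists by blast
  define U where "U = {p. ord p (to_fract (h i)) = twist_ord (int m) p}"
  have "- U \<subseteq> {p. ord p (to_fract (h i)) \<noteq> 0} \<union> {Infty}" by (auto simp: U_def twist_ord_def)
  then have "zopen U" using finite_ord[of "to_fract (h i)"] i finite_subset unfolding zopen_def by auto
  then show "\<exists>U b. zopen U \<and> p \<in> U \<and> lin_indep_family r b \<and> (\<forall>q\<in>U. sheaf_u q = O_span q r b)"
  proof -
    assume U: "zopen U"
    obtain c where "lin_indep_family r c"
      "\<And>p. ord p (to_fract (h i)) = twist_ord (int m) p \<Longrightarrow> sheaf_u p = O_span p r c"
      using local_frame[OF i(1,2)] by metis
    with U i(3) show ?thesis by (intro exI[of _ U] exI[of _ c]) (auto simp: U_def)
  qed
qed

text \<open>In the frame belonging to \<open>i\<close> the determinant has the divisor of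
  \<open>h r / h i\<close>. With \<open>h i\<close> a generator of \<open>O(m)\<close> at the point,
  this is the divisor of \<open>h r\<close> plus \<open>m\<close> times
  \<open>Infty\<close>.\<close>

lemma deg_sheaf_u: "deg sheaf_u = int m"
proof (rule deg_eqI)
  show "lin_indep_family r u" by (rule indep)
  show "to_fract (h r) \<noteq> 0" using h_last by simp
  fix p
  obtain i where i: "i < Suc r" "h i \<noteq> 0" "ord p (to_fract (h i)) = twist_ord (int m) p"
    using generator_exists by blast
  obtain c A where "lin_indep_family r c" "A \<in> carrier_mat r r"
    "\<And>j. j < r \<Longrightarrow> u j = lincomb r c (\<lambda>l. A $$ (l, j))"
    "\<And>p. ord p (det A) = ord p (to_fract (h r)) - ord p (to_fract (h i))"
    "\<And>p. ord p (to_fract (h i)) = twist_ord (int m) p \<Longrightarrow> sheaf_u p = O_span p r c"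
    by (rule local_frame[OF i(1,2)]) (rule that; blast)
  then show "\<exists>c A. lin_indep_family r c \<and> sheaf_u p = O_span p r c \<and> A \<in> carrier_mat r r \<and>
      (\<forall>j<r. u j = lincomb r c (\<lambda>l. A $$ (l, j))) \<and>
      ord p (det A) = ord p (to_fract (h r)) + (if p = Infty then int m else 0)"
    using i(3) by (intro exI[of _ c] exI[of _ A]) (auto simp: twist_ord_def)
qed

end

section \<open>Linear stability\<close>

definition C_indep :: "nat \<Rightarrow> (nat \<Rightarrow> complex poly) \<Rightarrow> (nat \<Rightarrow> complex poly) \<Rightarrow> bool" where
  "C_indep k f g \<longleftrightarrow> (\<forall>c. (\<Sum>i<k. Polynomial.smult (c i) (f i)) = 0 \<and>
     (\<Sum>i<k. Polynomial.smult (c i) (g i)) = 0 \<longrightarrow> (\<forall>i<k. c i = 0))"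

lemma C_indep_iff:
  "C_indep k f g \<longleftrightarrow> inj_on (\<lambda>i. pvec (f i) (g i)) {..<k} \<and> CV.independent ((\<lambda>i. pvec (f i) (g i)) ` {..<k})"
  unfolding CV.independent_family_iff C_indep_def scaleC_pvec pvec_sum
  using pvec_eq_iff[of _ _ 0 0] by simp

lemma C_indep_mono:
  assumes "C_indep k f g" "l \<le> k"
  shows "C_indep l f g"
proof -
  have "{..<l} \<subseteq> {..<k}" using assms(2) by auto
  then show ?thesis using assms(1) unfolding C_indep_iff
    by (meson CV.independent_mono image_mono inj_on_subset)
qed

text \<open>The genericity behind linear stability: a relation of degree at most \<open>n\<close>
  cannot live on a proper subspace of the four-dimensional \<open>V\<close>, whence
  \<open>k < 4\<close>.\<close>

definition no_short_syzygy :: "nat \<Rightarrow> rvec set \<Rightarrow> bool" where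
  "no_short_syzygy n V \<longleftrightarrow> (\<forall>k f g y. k < 4 \<longrightarrow> (\<forall>i<k. pvec (f i) (g i) \<in> V) \<longrightarrow> C_indep k f g \<longrightarrow>
     (\<forall>i<k. degree (y i) \<le> n) \<longrightarrow> (\<Sum>i<k. y i * f i) = 0 \<longrightarrow> (\<Sum>i<k. y i * g i) = 0 \<longrightarrow> (\<forall>i<k. y i = 0))"

lemma no_short_syzygyD:
  assumes "no_short_syzygy n V" "k < 4" "\<And>i. i < k \<Longrightarrow> pvec (f i) (g i) \<in> V" "C_indep k f g"
    "\<And>i. i < k \<Longrightarrow> degree (y i) \<le> n" "(\<Sum>i<k. y i * f i) = 0" "(\<Sum>i<k. y i * g i) = 0" "i < k"
  shows "y i = 0"
  using assms unfolding no_short_syzygy_def by blast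

text \<open>Two generically proportional sections satisfy the relation \<open>(f 1, - f 0)\<close>,
  which is short because the first components have degree at most \<open>n\<close>.\<close>

lemma proportional_pair:
  assumes V: "no_short_syzygy n V" "\<And>i. i < 2 \<Longrightarrow> pvec (f i) (g i) \<in> V" and ind: "C_indep 2 f g"
    and deg: "\<And>i. i < 2 \<Longrightarrow> degree (f i) \<le> n"
    and det: "f 0 * g 1 = f 1 * g 0" and i: "i < 2"
  shows "f i = 0"
proof -
  define y where "y i = (if i = 0 then f 1 else - f 0)" for i :: nat
  have y: "y i = 0" if "i < 2" for i
  proof (rule no_short_syzygyD[OF V(1) _ V(2) ind _ _ _ that])
    show "degree (y i) \<le> n" if "i < 2" for i using deg by (auto simp: y_def)
    show "(\<Sum>i<2. y i * f i) = 0" "(\<Sum>i<2. y i * g i) = 0"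
      using det by (auto simp: y_def sum_lessThan_2 algebra_simps)
  qed auto
  show ?thesis using y[of 0] y[of 1] i by (auto simp: y_def less_2)
qed

lemma sum_lessThan_3: "(\<Sum>i<3. F i) = F 0 + F 1 + F (2::nat)" for F :: "nat \<Rightarrow> 'a :: comm_monoid_add"
  by (simp add: numeral_3_eq_3 numeral_2_eq_2)

lemma degree_le_if_coeff_0: "degree p \<le> Suc n \<Longrightarrow> coeff p (Suc n) = 0 \<Longrightarrow> degree p \<le> n"
  by (metis degree_le eq_zero_or_degree_less le_SucE leading_coeff_0_iff le_0_eq degree_0 zero_le)

text \<open>
  With \<open>\<gamma>\<close> the vector of leading coefficients, \<open>\<gamma> \<times> g\<close> is a relation in which the terms of
  degree \<open>n + 1\<close> cancel.
\<close>

lemma no_proportional_triple: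
  assumes V: "no_short_syzygy n V" "\<And>i. i < 3 \<Longrightarrow> pvec 0 (g i) \<in> V" and ind: "C_indep 3 (\<lambda>_. 0) g"
    and deg: "\<And>i. i < 3 \<Longrightarrow> degree (g i) \<le> Suc n"
  shows False
proof -
  define \<gamma> where "\<gamma> i = coeff (g i) (Suc n)" for i
  have indD: "c i = 0" if "(\<Sum>i<3. Polynomial.smult (c i) (g i)) = 0" "i < 3" for c i
    using ind that unfolding C_indep_def by simp
  have 3: "(0::nat) < 3" "1 < (3::nat)" "2 < (3::nat)" by auto
  have syz: "y i = 0" if "\<And>i. i < 3 \<Longrightarrow> degree (y i) \<le> n" "(\<Sum>i<3. y i * g i) = 0" "i < 3" for y i
    by (rule no_short_syzygyD[OF V(1) _ V(2) ind that(1) _ that(2,3)]) auto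
  have cross: "Polynomial.smult (\<gamma> a) (g b) = Polynomial.smult (\<gamma> b) (g a)" if "a < 3" "b < 3" for a b
  proof -
    define M where "M a b = Polynomial.smult (\<gamma> a) (g b) - Polynomial.smult (\<gamma> b) (g a)" for a b
    have M: "degree (M a b) \<le> n" if "a < 3" "b < 3" for a b
    proof (rule degree_le_if_coeff_0)
      show "degree (M a b) \<le> Suc n"
        unfolding M_def using deg that by (intro degree_diff_le order.trans[OF degree_smult_le]) auto
      show "coeff (M a b) (Suc n) = 0" by (simp add: M_def \<gamma>_def)
    qed
    define y where "y i = (if i = 0 then M 1 2 else if i = 1 then M 2 0 else M 0 1)" for i :: nat
    have dy: "degree (y i) \<le> n" for i using M 3 by (auto simp: y_def)
    have sy: "(\<Sum>i<3. y i * g i) = 0"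
      by (simp add: sum_lessThan_3 y_def M_def algebra_simps)
    have "M 1 2 = 0" "M 2 0 = 0" "M 0 1 = 0"
      using syz[OF dy sy, of 0] syz[OF dy sy, of 1] syz[OF dy sy, of 2] by (auto simp: y_def)
    then show ?thesis using that
      by (auto simp: M_def less_Suc_eq numeral_3_eq_3 numeral_2_eq_2)
  qed
  \<comment> \<open>\<open>cross\<close> is a linear relation with constant coefficients
    \<open>\<gamma> a\<close> and \<open>- \<gamma> b\<close> between \<open>g b\<close> and
    \<open>g a\<close>, so independence makes the leading coefficients vanish.\<close>
  have \<gamma>0: "\<gamma> a = 0" if a: "a < 3" for a
  proof -
    define b :: nat where "b = (if a = 0 then 1 else 0)"
    have b: "b < 3" "b \<noteq> a" by (auto simp: b_def)
    define c where "c i = (if i = b then \<gamma> a else if i = a then - \<gamma> b else 0)" for i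
    have "(\<Sum>i<3. Polynomial.smult (c i) (g i)) = Polynomial.smult (\<gamma> a) (g b) + Polynomial.smult (- \<gamma> b) (g a)"
    proof -
      have "Polynomial.smult (c i) (g i) = (if i = b then Polynomial.smult (\<gamma> a) (g b) else 0)
          + (if i = a then Polynomial.smult (- \<gamma> b) (g a) else 0)" for i
        using b by (auto simp: c_def)
      then show ?thesis using a b by (simp add: sum.distrib)
    qed
    then have "(\<Sum>i<3. Polynomial.smult (c i) (g i)) = 0" using cross[OF a b(1)] by simp
    from indD[OF this b(1)] show ?thesis by (simp add: c_def)
  qed
  have degn: "degree (g i) \<le> n" if "i < 3" for i
    using deg[OF that] \<gamma>0[OF that] degree_le_if_coeff_0[of "g i" n] by (simp add: \<gamma>_def)
  \<comment> \<open>All \<open>g i\<close> now have degree at most \<open>n\<close>, so the relation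
    \<open>(g 1, - g 0, 0)\<close> is itself short.\<close>
  define y where "y i = (if i = 0 then g 1 else if i = 1 then - g 0 else 0)" for i :: nat
  have dy: "degree (y i) \<le> n" for i using degn 3 by (auto simp: y_def)
  have "(\<Sum>i<3. y i * g i) = 0" by (simp add: sum_lessThan_3 y_def)
  from syz[OF dy this, of 1] have "g 0 = 0" by (simp add: y_def)
  then have "(\<Sum>i<3. Polynomial.smult (if i = 0 then 1 else 0) (g i)) = 0" by (simp add: sum_lessThan_3)
  from indD[OF this, of 0] show False by simp
qed

text \<open>Used contrapositively: if \<open>E_W\<close> is not trivial, then a complex basis of
  \<open>W\<close> is dependent over the function field.\<close>

lemma trivial_iso_if_indep:
  assumes "lin_indep_family k u"
  shows "sheaf_iso (\<lambda>p. O_span p k u) (trivial_bundle k)"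
proof -
  interpret P: vector_space_pair scaleK scaleK ..
  define e :: "nat \<Rightarrow> rvec" where "e i = (\<lambda>j. if j = i then 1 else 0)" for i
  obtain \<phi> where lin: "Vector_Spaces.linear scaleK scaleK \<phi>" and \<phi>: "\<And>i. i < k \<Longrightarrow> \<phi> (u i) = e i"
  proof -
    have inj: "inj_on u {..<k}" and "KV.independent (u ` {..<k})"
      using assms by (auto simp: lin_indep_family_def)
    then obtain \<phi> where "Vector_Spaces.linear scaleK scaleK \<phi>"
      "\<forall>x\<in>u ` {..<k}. \<phi> x = (e \<circ> the_inv_into {..<k} u) x"
      using P.linear_independent_extend[of "u ` {..<k}" "e \<circ> the_inv_into {..<k} u"] by blast
    then show ?thesis using inj by (intro that[of \<phi>]) (auto simp: the_inv_into_f_f)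
  qed
  interpret L: Vector_Spaces.linear scaleK scaleK \<phi> by (rule lin)
  have \<phi>_lincomb: "\<phi> (lincomb k u a) = (\<lambda>j. if j < k then a j else 0)" for a
  proof -
    have "\<phi> (lincomb k u a) = lincomb k e a"
      using \<phi> by (simp add: lincomb_def L.sum L.scale)
    also have "\<dots> = (\<lambda>j. if j < k then a j else 0)"
      by (simp add: fun_eq_iff lincomb_apply e_def if_distrib[of "\<lambda>x. _ * x"] cong: if_cong)
    finally show ?thesis .
  qed
  have "bij_betw \<phi> (O_span p k u) (trivial_bundle k p)" for p
    unfolding bij_betw_def
  proof
    show "inj_on \<phi> (O_span p k u)"
    proof (rule inj_onI)
      fix x y assume "x \<in> O_span p k u" "y \<in> O_span p k u" and e: "\<phi> x = \<phi> y"
      then obtain a b where ab: "x = lincomb k u a" "y = lincomb k u b" by (auto simp: O_span_eq)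
      have "a j = b j" if "j < k" for j
        using fun_cong[OF e, of j] that by (simp add: ab \<phi>_lincomb)
      then show "x = y" unfolding ab by (rule lincomb_cong)
    qed
    show "\<phi> ` O_span p k u = trivial_bundle k p"
    proof (intro Set.set_eqI iffI)
      fix h assume "h \<in> trivial_bundle k p"
      then have "h = \<phi> (lincomb k u h)" "lincomb k u h \<in> O_span p k u"
        by (auto simp: \<phi>_lincomb trivial_bundle_iff fun_eq_iff intro: O_spanI)
      then show "h \<in> \<phi> ` O_span p k u" by blast
    qed (auto simp: O_span_eq \<phi>_lincomb trivial_bundle_iff)
  qed
  with lin show ?thesis unfolding sheaf_iso_def by blast
qed

lemma card_basis_proper_subspace:
  assumes W: "CV.subspace W" "W \<subset> V" and V: "V = CV.span S" "finite S" "card S = k"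
  obtains B where "finite B" "card B < k" "CV.independent B" "CV.span B = W" "card B = CV.dim W"
proof -
  obtain B where B: "B \<subseteq> W" "CV.independent B" "W \<subseteq> CV.span B" "card B = CV.dim W"
    by (rule CV.basis_exists)
  have span: "CV.span B = W" using B W(1) by (meson CV.span_minimal subset_antisym)
  obtain v where v: "v \<in> V" "v \<notin> W" using W(2) by blast
  have ins: "CV.independent (insert v B)"
    using v span B(2) by (simp add: CV.independent_insertI)
  have "insert v B \<subseteq> CV.span S" using v B(1) W(2) V(1) by auto
  then have "finite (insert v B)" "card (insert v B) \<le> card S"
    using CV.independent_span_bound[OF V(2) ins] by auto
  moreover have "v \<notin> B" using v B(1) by blast
  ultimately have "finite B" "card B < k" using V(3) by auto
  with that B span show ?thesis by blast
qed

text \<open>A primitive relation among the \<open>u i\<close> has degree \<open>m > n\<close> by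
  \<open>no_short_syzygy\<close>. Once it is known to be the only one up to factors,
  \<open>single_relation\<close> identifies \<open>m\<close> with the degree and
  \<open>k - 1\<close> with the rank.\<close>

lemma degree_slope_gt:
  assumes V: "no_short_syzygy n V" "V \<subseteq> global_sections (direct_sum_O [int n, int (Suc n)])"
    and u: "inj_on u {..<k}" "CV.independent (u ` {..<k})" "\<And>i. i < k \<Longrightarrow> u i \<in> V" "k < 4"
    and dep: "\<not> lin_indep_family k u"
  obtains r m where "k = Suc r" "rk (\<lambda>p. O_span p k u) = r" "deg (\<lambda>p. O_span p k u) = int m" "n < m"
proof -
  obtain h0 i0 where h0: "(\<Sum>i<k. scaleK (to_fract (h0 i)) (u i)) = 0" "i0 < k" "h0 i0 \<noteq> 0"
    and root0: "\<And>x. \<exists>i<k. poly (h0 i) x \<noteq> 0"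
    using primitive_relation[OF dep] by metis
  define r where "r = k - 1"
  have k: "k = Suc r" using h0(2) by (simp add: r_def)
  \<comment> \<open>\<open>single_relation\<close> solves for the last generator, so a nonzero
    coefficient is moved to the last place.\<close>
  define \<pi> where "\<pi> = transpose i0 r"
  have \<pi>: "\<pi> permutes {..<k}" unfolding \<pi>_def using h0(2) k by (intro permutes_swap_id) auto
  have \<pi>less: "\<pi> i < k \<longleftrightarrow> i < k" for i using permutes_in_image[OF \<pi>, of i] by simp
  have \<pi>r: "\<pi> r = i0" by (simp add: \<pi>_def)
  have "\<forall>i. \<exists>f g. i < k \<longrightarrow> u (\<pi> i) = pvec f g \<and> degree f \<le> n \<and> degree g \<le> Suc n"
    using u(3) V(2) \<pi>less unfolding global_sections_direct_sum_O_2 by blast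
  then obtain f g where fg: "\<And>i. i < k \<Longrightarrow> u (\<pi> i) = pvec (f i) (g i)"
    "\<And>i. i < k \<Longrightarrow> degree (f i) \<le> n" "\<And>i. i < k \<Longrightarrow> degree (g i) \<le> Suc n"
    by metis
  have inV: "pvec (f i) (g i) \<in> V" if "i < k" for i using fg(1) u(3) \<pi>less that by metis
  have img: "(\<lambda>i. pvec (f i) (g i)) ` {..<k} = u ` {..<k}"
  proof -
    have "(\<lambda>i. pvec (f i) (g i)) ` {..<k} = u ` (\<pi> ` {..<k})" using fg(1) by (simp add: image_image)
    then show ?thesis using permutes_image[OF \<pi>] by simp
  qed
  have ind: "C_indep k f g"
    unfolding C_indep_iff img
  proof
    have "inj_on (u \<circ> \<pi>) {..<k}"
      using u(1) permutes_inj_on[OF \<pi>] permutes_image[OF \<pi>] by (intro comp_inj_on) auto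
    then show "inj_on (\<lambda>i. pvec (f i) (g i)) {..<k}" using fg(1) by (simp add: inj_on_def)
  qed (rule u(2))
  define h where "h i = h0 (\<pi> i)" for i
  have "(\<Sum>i<k. scaleK (to_fract (h i)) (u (\<pi> i))) = 0"
    using sum.permute[OF \<pi>, of "\<lambda>i. scaleK (to_fract (h0 i)) (u i)"] h0(1) by (simp add: h_def)
  then have rel: "(\<Sum>i<k. scaleK (to_fract (h i)) (pvec (f i) (g i))) = 0"
    using fg(1) by simp
  then have rel': "(\<Sum>i<k. h i * f i) = 0" "(\<Sum>i<k. h i * g i) = 0"
    unfolding scaleK_pvec pvec_sum using pvec_eq_iff[of _ _ 0 0] by simp_all
  have hr: "h r \<noteq> 0" using h0(3) by (simp add: h_def \<pi>r)
  have root: "\<exists>i<k. poly (h i) x \<noteq> 0" for x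
  proof -
    obtain i where "i < k" "poly (h0 i) x \<noteq> 0" using root0 by blast
    then show ?thesis using permutes_inverses(1)[OF \<pi>] \<pi>less by (metis h_def)
  qed
  define S where "S = {i. i < k \<and> h i \<noteq> 0}"
  define m where "m = Max ((\<lambda>i. degree (h i)) ` S)"
  have S: "finite S" "r \<in> S" using hr k by (auto simp: S_def)
  then have "m \<in> (\<lambda>i. degree (h i)) ` S" unfolding m_def by (intro Max_in) auto
  then have att: "\<exists>i<k. h i \<noteq> 0 \<and> degree (h i) = m" by (auto simp: S_def)
  have le: "degree (h i) \<le> m" if "i < k" for i
    using S(1) that unfolding m_def by (cases "h i = 0") (auto intro!: Max_ge simp: S_def)
  have "n < m"
  proof (rule ccontr)
    assume "\<not> n < m"
    then have "degree (h i) \<le> n" if "i < k" for i using le[OF that] by simp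
    from no_short_syzygyD[OF V(1) u(4) inV ind this rel', of r] hr k show False by simp
  qed
  \<comment> \<open>This rules out a second relation. Only \<open>r = 2\<close> needs work: a
    dependent pair has vanishing first components, the relation with \<open>h 2 \<noteq> 0\<close>
    passes this on to the third section, and three independent sections of \<open>O(n + 1)\<close>
    are excluded by \<open>no_proportional_triple\<close>.\<close>
  have "lin_indep_family r (\<lambda>i. pvec (f i) (g i))"
  proof (rule ccontr)
    assume dep': "\<not> ?thesis"
    have nz: "pvec (f 0) (g 0) \<noteq> 0" if "k > 0"
    proof
      assume 0: "pvec (f 0) (g 0) = 0"
      have "0 \<in> (\<lambda>i. pvec (f i) (g i)) ` {..<k}"
        using that 0 by (intro image_eqI[of _ _ 0]) auto
      then have "CV.dependent ((\<lambda>i. pvec (f i) (g i)) ` {..<k})" by (rule CV.dependent_zero)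
      with ind show False by (simp add: C_indep_iff)
    qed
    have "r < 3" using u(4) k by simp
    then consider "r = 0" | "r = 1" | "r = 2" by linarith
    then show False
    proof cases
      case 1
      then show False using dep' by (simp add: lin_indep_family_iff)
    next
      case 2
      then show False using dep' lin_indep_single[OF nz] k by (auto simp: lin_indep_family_iff lincomb_def)
    next
      case 3
      then have k3: "k = 3" using k by simp
      obtain a i where a: "lincomb 2 (\<lambda>i. pvec (f i) (g i)) a = 0" "i < 2" "a i \<noteq> 0"
        using dep' 3 by (auto simp: lin_indep_family_iff)
      then have a2: "a 0 * to_fract (f 0) + a 1 * to_fract (f 1) = 0" "a 0 * to_fract (g 0) + a 1 * to_fract (g 1) = 0"
        unfolding lincomb_2 pvec_def scaleK_vec2 vec2_add vec2_0[symmetric] vec2_eq_iff by auto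
      have "a 0 * (to_fract (f 0) * to_fract (g 1) - to_fract (f 1) * to_fract (g 0)) =
          (a 0 * to_fract (f 0) + a 1 * to_fract (f 1)) * to_fract (g 1) -
          (a 0 * to_fract (g 0) + a 1 * to_fract (g 1)) * to_fract (f 1)"
        "a 1 * (to_fract (f 0) * to_fract (g 1) - to_fract (f 1) * to_fract (g 0)) =
          (a 0 * to_fract (g 0) + a 1 * to_fract (g 1)) * to_fract (f 0) -
          (a 0 * to_fract (f 0) + a 1 * to_fract (f 1)) * to_fract (g 0)"
        by (simp_all add: algebra_simps)
      then have "to_fract (f 0) * to_fract (g 1) - to_fract (f 1) * to_fract (g 0) = 0"
        unfolding a2 using a(2,3) by (auto simp: less_2)
      then have det: "f 0 * g 1 = f 1 * g 0"
        by (simp flip: to_fract_mult)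
      have f01: "f i = 0" if "i < 2" for i
        by (rule proportional_pair[OF V(1) _ C_indep_mono[OF ind] _ det that]) (use inV fg(2) k3 in auto)
      have "h 2 * f 2 = 0" using rel'(1) f01[of 0] f01[of 1] k3 by (simp add: sum_lessThan_3)
      then have "f 2 = 0" using hr 3 by simp
      with f01 have f0: "f i = 0" if "i < 3" for i
        using that by (cases "i = 2") auto
      have "C_indep 3 (\<lambda>_. 0) g" using ind f0 unfolding k3 C_indep_def by simp
      then show False
        using no_proportional_triple[OF V(1), of g] inV f0 fg(3) k3 by metis
    qed
  qed
  have "single_relation r (\<lambda>i. pvec (f i) (g i)) h m"
  proof (rule single_relation.intro)
    show "lin_indep_family r (\<lambda>i. pvec (f i) (g i))" by fact
    show "(\<Sum>i<Suc r. scaleK (to_fract (h i)) (pvec (f i) (g i))) = 0" using rel unfolding k .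
    show "\<exists>i<Suc r. poly (h i) x \<noteq> 0" for x using root[of x] unfolding k .
    show "degree (h i) \<le> m" if "i < Suc r" for i using le that unfolding k .
    show "\<exists>i<Suc r. h i \<noteq> 0 \<and> degree (h i) = m" using att unfolding k .
  qed (rule hr)
  then interpret R: single_relation r "\<lambda>i. pvec (f i) (g i)" h m .
  have "O_span p k u = R.sheaf_u p" for p
  proof -
    have "u i \<in> R.sheaf_u p" if "i < k" for i
    proof -
      have "u i \<in> (\<lambda>i. pvec (f i) (g i)) ` {..<k}" unfolding img using that by simp
      then obtain j where "j < k" "u i = pvec (f j) (g j)" by auto
      then show ?thesis unfolding R.sheaf_u_def k[symmetric] using O_span_base[of j k "\<lambda>i. pvec (f i) (g i)" p] by simp
    qed
    moreover have "pvec (f i) (g i) \<in> O_span p k u" if "i < k" for i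
      unfolding fg(1)[OF that, symmetric] by (rule O_span_base) (simp add: \<pi>less that)
    ultimately show ?thesis
      unfolding R.sheaf_u_def k[symmetric] by (intro equalityI O_span_subset) auto
  qed
  then have E: "(\<lambda>p. O_span p k u) = R.sheaf_u" by (rule ext)
  show ?thesis
    using that[OF k _ _ \<open>n < m\<close>] rk_eq[OF R.locally_free_sheaf_u] R.deg_sheaf_u unfolding E by blast
qed

context spanning_family
begin

lemma linearly_stable_span:
  assumes w: "inj_on w {..<4}" "CV.independent (w ` {..<4})"
    and syz: "no_short_syzygy n (CV.span (w ` {..<4}))"
  shows "linearly_stable ambient (CV.span (w ` {..<4}))"
  unfolding linearly_stable_def
proof (intro conjI allI impI)
  show gen: "generated ambient (CV.span (w ` {..<4}))" by (rule generated_span[OF w(1)])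
  fix W
  define V where "V = CV.span (w ` {..<4})"
  assume "CV.subspace W \<and> W \<subset> CV.span (w ` {..<4}) \<and>
    \<not> sheaf_iso (eval_image W) (trivial_bundle (CV.dim W))"
  then have W: "CV.subspace W" "W \<subset> V" and niso: "\<not> sheaf_iso (eval_image W) (trivial_bundle (CV.dim W))"
    by (auto simp: V_def)
  have card: "card (w ` {..<4}) = 4" using w(1) by (simp add: card_image)
  obtain B where B: "finite B" "card B < 4" "CV.independent B" "CV.span B = W" "card B = CV.dim W"
    using card_basis_proper_subspace[OF W V_def _ card] by blast
  define k where "k = card B"
  obtain u where "bij_betw u {0..<k} B"
    using ex_bij_betw_nat_finite[OF B(1)] k_def by blast
  then have u: "inj_on u {..<k}" "u ` {..<k} = B"
    by (auto simp: bij_betw_def lessThan_atLeast0)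
  have EW: "eval_image W = (\<lambda>p. O_span p k u)"
    using eval_image_span[OF u(1)] u(2) B(4) by auto
  have "\<not> lin_indep_family k u"
    using niso trivial_iso_if_indep[of k u] B(5) EW k_def by auto
  moreover have "u i \<in> V" if "i < k" for i
    using that u(2) B(4) W(2) CV.span_superset[of B] by blast
  moreover have "V \<subseteq> global_sections (direct_sum_O [int n, int (Suc n)])"
    using gen unfolding generated_def coherent_system_def V_def ambient_def by blast
  ultimately obtain r m where rm: "k = Suc r" "rk (eval_image W) = r" "deg (eval_image W) = int m" "n < m"
    using degree_slope_gt[of n V u k] syz u B k_def unfolding EW V_def by metis
  have "deg ambient = N" unfolding ambient_def by (rule deg_direct_sum_O_2)
  moreover have "rk ambient = 2" unfolding ambient_def by (rule rk_eq[OF locally_free_direct_sum_O_2])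
  moreover have "CV.dim V = 4" unfolding V_def using CV.dim_span_eq_card_independent[OF w(2)] card by simp
  \<comment> \<open>By \<open>k = Suc r\<close> the denominator for \<open>W\<close> is 1, and
    \<open>m \<ge> n + 1\<close> exceeds \<open>(2 n + 1) / (4 - 2)\<close>.\<close>
  ultimately show "real_of_int (deg ambient) / (real (CV.dim (CV.span (w ` {..<4}))) - real (rk ambient))
      < real_of_int (deg (eval_image W)) / (real (CV.dim W) - real (rk (eval_image W)))"
    using rm B(5) k_def by (simp add: V_def)
qed

end

section \<open>From one nondegenerate relation to generation, stability and instability\<close>

section \<open>Systems with an independent relation of minimal degree\<close>

lemma smult_sum_right: "Polynomial.smult c (\<Sum>i\<in>S. p i) = (\<Sum>i\<in>S. Polynomial.smult c (p i))"
  by (induction S rule: infinite_finite_induct) (auto simp: smult_add_right)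

text \<open>\<open>surj\<close> and \<open>unique\<close> say that
  \<open>V \<otimes> H0(O(n)) \<rightarrow> H0(E(n))\<close> is onto with kernel the line through
  \<open>a\<close>, where \<open>E(n)\<close> is the sum of \<open>O(2 n)\<close> and
  \<open>O(2 n + 1)\<close>.\<close>

locale good_family =
  fixes n :: nat and f g a :: "nat \<Rightarrow> complex poly"
  assumes degree_f: "i < 4 \<Longrightarrow> degree (f i) \<le> n"
    and degree_g: "i < 4 \<Longrightarrow> degree (g i) \<le> Suc n"
    and degree_a: "i < 4 \<Longrightarrow> degree (a i) \<le> n"
    and rel_f: "(\<Sum>i<4. a i * f i) = 0"
    and rel_g: "(\<Sum>i<4. a i * g i) = 0"
    and a_indep: "(\<Sum>i<4. Polynomial.smult (c i) (a i)) = 0 \<Longrightarrow> i < 4 \<Longrightarrow> c i = 0"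
    and unique: "(\<And>i. i < 4 \<Longrightarrow> degree (y i) \<le> n) \<Longrightarrow> (\<Sum>i<4. y i * f i) = 0 \<Longrightarrow> (\<Sum>i<4. y i * g i) = 0 \<Longrightarrow>
      \<exists>d. \<forall>i<4. y i = Polynomial.smult d (a i)"
    and surj: "degree F \<le> n + n \<Longrightarrow> degree G \<le> n + Suc n \<Longrightarrow>
      \<exists>y. (\<forall>i<4. degree (y i) \<le> n) \<and> (\<Sum>i<4. y i * f i) = F \<and> (\<Sum>i<4. y i * g i) = G"
begin

text \<open>A functional killing the four sections at \<open>x\<close> kills every section of
  \<open>E(n)\<close> there, in particular \<open>(1, 0)\<close> and \<open>(0, 1)\<close>.\<close>

lemma fibre:
  assumes z: "\<And>i. i < 4 \<Longrightarrow> \<alpha> * poly (f i) x + \<beta> * poly (g i) x = 0"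
  shows "\<alpha> = 0 \<and> \<beta> = 0"
proof -
  have *: "\<alpha> * poly F x + \<beta> * poly G x = 0" if FG: "degree F \<le> n + n" "degree G \<le> n + Suc n" for F G
  proof -
    obtain y where y: "(\<Sum>i<4. y i * f i) = F" "(\<Sum>i<4. y i * g i) = G" using surj[OF FG] by blast
    have "\<alpha> * poly F x + \<beta> * poly G x = (\<Sum>i<4. poly (y i) x * (\<alpha> * poly (f i) x + \<beta> * poly (g i) x))"
      unfolding y[symmetric] by (simp add: poly_sum sum_distrib_left sum.distrib algebra_simps)
    then show ?thesis using z by simp
  qed
  from *[of 1 0] *[of 0 1] show ?thesis by simp
qed

text \<open>As for finite points, with top coefficients as values at infinity and top monomials as
  test sections.\<close>

lemma fibre_Infty:
  assumes z: "\<And>i. i < 4 \<Longrightarrow> \<alpha> * coeff (f i) n + \<beta> * coeff (g i) (Suc n) = 0"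
  shows "\<alpha> = 0 \<and> \<beta> = 0"
proof -
  have *: "\<alpha> * coeff F (n + n) + \<beta> * coeff G (n + Suc n) = 0" if FG: "degree F \<le> n + n" "degree G \<le> n + Suc n" for F G
  proof -
    obtain y where dy: "\<forall>i<4. degree (y i) \<le> n" and y: "(\<Sum>i<4. y i * f i) = F" "(\<Sum>i<4. y i * g i) = G"
      using surj[OF FG] by blast
    have "coeff F (n + n) = (\<Sum>i<4. coeff (y i) n * coeff (f i) n)"
      unfolding y(1)[symmetric] coeff_sum using dy degree_f by (intro sum.cong coeff_mult_top) auto
    moreover have "coeff G (n + Suc n) = (\<Sum>i<4. coeff (y i) n * coeff (g i) (Suc n))"
      unfolding y(2)[symmetric] coeff_sum using dy degree_g by (intro sum.cong coeff_mult_top) auto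
    ultimately have "\<alpha> * coeff F (n + n) + \<beta> * coeff G (n + Suc n) =
        (\<Sum>i<4. coeff (y i) n * (\<alpha> * coeff (f i) n + \<beta> * coeff (g i) (Suc n)))"
      by (simp only: sum_distrib_left sum.distrib[symmetric]) (simp add: algebra_simps)
    then show ?thesis using z by simp
  qed
  from *[of "monom 1 (n + n)" 0] *[of 0 "monom 1 (n + Suc n)"] show ?thesis
    by (simp add: degree_monom_eq)
qed

definition u :: "nat \<Rightarrow> rvec" where "u i = pvec (f i) (g i)"

definition V :: "rvec set" where "V = CV.span (u ` {..<4})"

text \<open>A constant relation is a multiple of \<open>a\<close>. A nonzero multiple would make all
  \<open>a i\<close> constant, contrary to their independence.\<close>

lemma C_indep_fg: "C_indep 4 f g"
  unfolding C_indep_def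
proof (intro allI impI)
  fix c i assume c: "(\<Sum>i<4. Polynomial.smult (c i) (f i)) = 0 \<and> (\<Sum>i<4. Polynomial.smult (c i) (g i)) = 0" and i: "i < (4::nat)"
  obtain d where d: "\<And>i. i < 4 \<Longrightarrow> [:c i:] = Polynomial.smult d (a i)"
    using unique[of "\<lambda>i. [:c i:]"] c by auto
  have "d = 0"
  proof (rule ccontr)
    assume d0: "d \<noteq> 0"
    have a: "a i = [:c i / d:]" if "i < 4" for i
    proof -
      have "a i = Polynomial.smult (1 / d) (Polynomial.smult d (a i))" using d0 by simp
      also have "Polynomial.smult d (a i) = [:c i:]" by (rule d[OF that, symmetric])
      finally show ?thesis by simp
    qed
    have s4: "(\<Sum>i<4. F i) = F 0 + F 1 + F 2 + F (3::nat)" for F :: "nat \<Rightarrow> complex poly"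
      by (simp add: eval_nat_numeral)
    \<comment> \<open>Two constants \<open>a 0\<close> and \<open>a 1\<close> are always dependent;
      this combination forces \<open>a 0 = 0\<close>.\<close>
    define e where "e i = (if i = 0 then c 1 / d else if i = 1 then - (c 0 / d) else 0)" for i :: nat
    have "(\<Sum>i<4. Polynomial.smult (e i) (a i)) = 0" unfolding s4 using a by (simp add: e_def)
    from a_indep[OF this, of 1] have "c 0 / d = 0" by (simp add: e_def)
    then have "a 0 = 0" using a[of 0] by simp
    then have "(\<Sum>i<4. Polynomial.smult (if i = 0 then 1 else 0) (a i)) = 0" unfolding s4 by simp
    from a_indep[OF this, of 0] show False by simp
  qed
  then show "c i = 0" using d[OF i] by simp
qed

lemma u_indep: "inj_on u {..<4}" "CV.independent (u ` {..<4})"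
  using C_indep_fg unfolding C_indep_iff u_def[abs_def] by auto

lemma in_V: "v \<in> V \<Longrightarrow> \<exists>c. v = (\<Sum>j<4. scaleC (c j) (u j))"
proof -
  assume "v \<in> V"
  then obtain h where "v = (\<Sum>x\<in>u ` {..<4}. scaleC (h x) x)"
    unfolding V_def using CV.span_finite[of "u ` {..<4}"] by auto
  then show ?thesis using u_indep(1) by (intro exI[of _ "\<lambda>j. h (u j)"]) (simp add: sum.reindex)
qed

lemma sum_scaleC_u: "(\<Sum>j<4. scaleC (c j) (u j)) =
    pvec (\<Sum>j<4. Polynomial.smult (c j) (f j)) (\<Sum>j<4. Polynomial.smult (c j) (g j))"
  by (simp add: u_def scaleC_pvec pvec_sum)

lemma V_sections: "V \<subseteq> global_sections (direct_sum_O [int n, int (Suc n)])"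
proof
  fix v assume "v \<in> V"
  then obtain c where v: "v = (\<Sum>j<4. scaleC (c j) (u j))" using in_V by blast
  have "degree (\<Sum>j<4. Polynomial.smult (c j) (f j)) \<le> n" "degree (\<Sum>j<4. Polynomial.smult (c j) (g j)) \<le> Suc n"
    using degree_f degree_g by (auto intro!: degree_sum_le order.trans[OF degree_smult_le])
  then show "v \<in> global_sections (direct_sum_O [int n, int (Suc n)])"
    unfolding global_sections_direct_sum_O_2 v sum_scaleC_u by blast
qed

text \<open>Padding fewer than four equations in four unknowns with zero rows gives a singular
  square matrix.\<close>

lemma short_row_kernel:
  fixes H :: "nat \<Rightarrow> nat \<Rightarrow> complex"
  assumes "k < 4"
  obtains l j where "\<And>i. i < k \<Longrightarrow> (\<Sum>j<4. l j * H j i) = 0" "j < 4" "l j \<noteq> 0"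
proof -
  define A where "A = mat 4 4 (\<lambda>(i, j). if i < k then H j i else 0)"
  have A: "A \<in> carrier_mat 4 4" by (simp add: A_def)
  have "A $$ (3, j) = 0" if "j < 4" for j using assms that by (simp add: A_def)
  then have "det A = 0" using laplace_expansion_row[OF A, of 3] by simp
  then obtain v where v: "v \<in> carrier_vec 4" "v \<noteq> 0\<^sub>v 4" "A *\<^sub>v v = 0\<^sub>v 4"
    using det_0_iff_vec_prod_zero[OF A] by auto
  have "(\<Sum>j<4. v $ j * H j i) = 0" if "i < k" for i
  proof -
    have "(A *\<^sub>v v) $ i = (\<Sum>j<4. v $ j * H j i)"
      using that assms v(1) by (simp add: A_def scalar_prod_def lessThan_atLeast0 mult.commute)
    then show ?thesis using v(3) that assms by simp
  qed
  moreover obtain j where "j < 4" "v $ j \<noteq> 0" using v(1,2) by (auto simp: vec_eq_iff)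
  ultimately show ?thesis using that by blast
qed

text \<open>Rewritten in the basis \<open>u\<close>, the relation becomes \<open>z = d a\<close>. As
  \<open>k < 4\<close>, some nonzero constant vector \<open>l\<close> annihilates all rows of
  \<open>H\<close>, hence also \<open>z\<close>; independence of \<open>a\<close> then gives
  \<open>d = 0\<close>.\<close>

lemma no_short_syzygy_V: "no_short_syzygy n V"
  unfolding no_short_syzygy_def
proof (intro allI impI)
  fix k F G y i
  assume k: "k < (4::nat)" and inV: "\<forall>i<k. pvec (F i) (G i) \<in> V" and ind: "C_indep k F G"
    and dy: "\<forall>i<k. degree (y i) \<le> n" and sF: "(\<Sum>i<k. y i * F i) = 0" and sG: "(\<Sum>i<k. y i * G i) = 0"
    and i: "i < k"
  have "\<forall>i. \<exists>c. i < k \<longrightarrow> pvec (F i) (G i) = (\<Sum>j<4. scaleC (c j) (u j))" using inV in_V by blast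
  then obtain H where "\<And>i. i < k \<Longrightarrow> pvec (F i) (G i) = (\<Sum>j<4. scaleC (H i j) (u j))" by metis
  then have H: "F i = (\<Sum>j<4. Polynomial.smult (H i j) (f j))" "G i = (\<Sum>j<4. Polynomial.smult (H i j) (g j))"
    if "i < k" for i using that unfolding sum_scaleC_u by simp_all
  define z where "z j = (\<Sum>i<k. Polynomial.smult (H i j) (y i))" for j
  have swap: "(\<Sum>j<4. z j * w j) = (\<Sum>i<k. y i * (\<Sum>j<4. Polynomial.smult (H i j) (w j)))" for w
  proof -
    have "(\<Sum>j<4. z j * w j) = (\<Sum>j<4. \<Sum>i<k. Polynomial.smult (H i j) (y i * w j))"
      by (simp add: z_def sum_distrib_right)
    also have "\<dots> = (\<Sum>i<k. \<Sum>j<4. Polynomial.smult (H i j) (y i * w j))" by (rule sum.swap)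
    finally show ?thesis by (simp add: sum_distrib_left)
  qed
  have "degree (z j) \<le> n" for j
    unfolding z_def using dy by (auto intro!: degree_sum_le order.trans[OF degree_smult_le])
  moreover have "(\<Sum>j<4. z j * f j) = 0" "(\<Sum>j<4. z j * g j) = 0"
    using sF sG unfolding swap by (simp_all add: H)
  ultimately obtain d where d: "\<And>j. j < 4 \<Longrightarrow> z j = Polynomial.smult d (a j)" using unique by metis
  obtain l j0 where l: "\<And>i. i < k \<Longrightarrow> (\<Sum>j<4. l j * H i j) = 0" and j0: "j0 < 4" "l j0 \<noteq> 0"
    using short_row_kernel[OF k, of "\<lambda>j i. H i j"] by blast
  have "(\<Sum>j<4. Polynomial.smult (l j * d) (a j)) = (\<Sum>j<4. Polynomial.smult (l j) (z j))"
    using d by (intro sum.cong) auto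
  also have "\<dots> = (\<Sum>j<4. \<Sum>i<k. Polynomial.smult (l j * H i j) (y i))"
    by (simp add: z_def smult_sum_right)
  also have "\<dots> = (\<Sum>i<k. Polynomial.smult (\<Sum>j<4. l j * H i j) (y i))"
    by (subst sum.swap) (simp add: smult_sum)
  also have "\<dots> = 0" using l by simp
  finally have "l j0 * d = 0" by (rule a_indep[OF _ j0(1)])
  then have z0: "z j = 0" if "j < 4" for j using d[OF that] j0(2) by simp
  \<comment> \<open>With \<open>z = 0\<close>, the coefficients of degree \<open>m\<close> of the
    \<open>y i\<close> form a constant relation among the independent sections.\<close>
  have "coeff (y i) m = 0" if "i < k" for i m
  proof -
    have comb: "(\<Sum>i<k. Polynomial.smult (coeff (y i) m) (\<Sum>j<4. Polynomial.smult (H i j) (w j))) = 0" for w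
    proof -
      have "(\<Sum>i<k. Polynomial.smult (coeff (y i) m) (\<Sum>j<4. Polynomial.smult (H i j) (w j)))
          = (\<Sum>i<k. \<Sum>j<4. Polynomial.smult (coeff (y i) m * H i j) (w j))"
        by (simp add: smult_sum_right)
      also have "\<dots> = (\<Sum>j<4. Polynomial.smult (\<Sum>i<k. coeff (y i) m * H i j) (w j))"
        by (subst sum.swap) (simp add: smult_sum)
      also have "\<dots> = (\<Sum>j<4. Polynomial.smult (coeff (z j) m) (w j))"
        by (simp add: z_def coeff_sum mult.commute)
      finally show ?thesis using z0 by simp
    qed
    have "(\<Sum>i<k. Polynomial.smult (coeff (y i) m) (F i)) = 0" "(\<Sum>i<k. Polynomial.smult (coeff (y i) m) (G i)) = 0"
      using comb[of f] comb[of g] by (simp_all add: H)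
    with ind[unfolded C_indep_def, rule_format, of "\<lambda>i. coeff (y i) m" i] that show ?thesis by simp
  qed
  then show "y i = 0" using i by (simp add: poly_eq_iff)
qed

lemma spanning_u: "spanning_family n f g"
  by (rule spanning_family.intro) (rule degree_f degree_g fibre fibre_Infty; assumption)+

lemma V_stable:
  "generated (direct_sum_O [int n, int (Suc n)]) V" "linearly_stable (direct_sum_O [int n, int (Suc n)]) V"
proof -
  interpret S: spanning_family n f g by (rule spanning_u)
  have w: "S.w = u" by (simp add: fun_eq_iff S.w_def u_def)
  show "generated (direct_sum_O [int n, int (Suc n)]) V"
    using S.generated_span u_indep(1) unfolding w V_def S.ambient_def by blast
  show "linearly_stable (direct_sum_O [int n, int (Suc n)]) V"
    using S.linearly_stable_span u_indep no_short_syzygy_V unfolding w V_def S.ambient_def by blast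
qed

text \<open>The kernel sheaf is written in an arbitrary basis \<open>vs\<close>. The matrix
  \<open>K\<close> expressing \<open>u\<close> by \<open>vs\<close> carries both the spanning
  conditions and the relation \<open>a\<close> over to \<open>vs\<close>.\<close>

lemma dual_span_bundle_V:
  assumes "basis_of vs V"
  shows "vector_bundle (dual_span_bundle vs) \<and> \<not> semistable (dual_span_bundle vs)"
proof -
  have vs: "distinct vs" "CV.independent (set vs)" "CV.span (set vs) = V" using assms by (auto simp: basis_of_def)
  have "length vs = CV.dim V"
    using vs CV.dim_span_eq_card_independent[OF vs(2)] distinct_card[OF vs(1)] by simp
  also have "\<dots> = 4"
    unfolding V_def using CV.dim_span_eq_card_independent[OF u_indep(2)] u_indep(1) by (simp add: card_image)
  finally have len: "length vs = 4" .
  have "vs ! i \<in> V" if "i < 4" for i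
    using vs(3) CV.span_superset[of "set vs"] that len by auto
  then have "\<forall>i. \<exists>F G. i < 4 \<longrightarrow> vs ! i = pvec F G \<and> degree F \<le> n \<and> degree G \<le> Suc n"
    using V_sections unfolding global_sections_direct_sum_O_2 by blast
  then obtain F G where FG: "\<And>i. i < 4 \<Longrightarrow> vs ! i = pvec (F i) (G i)"
    "\<And>i. i < 4 \<Longrightarrow> degree (F i) \<le> n" "\<And>i. i < 4 \<Longrightarrow> degree (G i) \<le> Suc n"
    by metis
  have "\<exists>c. u j = (\<Sum>i<4. scaleC (c i) (vs ! i))" if "j < 4" for j
  proof -
    have "u j \<in> CV.span (set vs)"
      unfolding vs(3) V_def using that by (intro CV.span_base) auto
    then obtain h where "u j = (\<Sum>x\<in>set vs. scaleC (h x) x)"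
      using CV.span_finite[of "set vs"] by auto
    also have "set vs = (\<lambda>i. vs ! i) ` {..<4}"
      using len by (auto simp: set_conv_nth)
    finally have "u j = (\<Sum>i<4. scaleC (h (vs ! i)) (vs ! i))"
      using vs(1) len by (subst (asm) sum.reindex) (auto simp: inj_on_def nth_eq_iff_index_eq)
    then show ?thesis by (rule exI[of _ "\<lambda>i. h (vs ! i)"])
  qed
  then have "\<forall>j. \<exists>c. j < 4 \<longrightarrow> u j = (\<Sum>i<4. scaleC (c i) (vs ! i))" by blast
  then obtain K where "\<And>j. j < 4 \<Longrightarrow> u j = (\<Sum>i<4. scaleC (K j i) (vs ! i))" by metis
  then have K: "f j = (\<Sum>i<4. Polynomial.smult (K j i) (F i))" "g j = (\<Sum>i<4. Polynomial.smult (K j i) (G i))"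
    if "j < 4" for j
    using that by (simp_all add: u_def FG(1) scaleC_pvec pvec_sum)
  interpret S: spanning_family n F G
  proof
    fix \<alpha> x \<beta>
    assume z: "\<And>i. i < 4 \<Longrightarrow> \<alpha> * poly (F i) x + \<beta> * poly (G i) x = 0"
    have "\<alpha> * poly (f j) x + \<beta> * poly (g j) x = (\<Sum>i<4. K j i * (\<alpha> * poly (F i) x + \<beta> * poly (G i) x))" if "j < 4" for j
      by (simp add: K that poly_sum sum_distrib_left sum.distrib algebra_simps)
    then show "\<alpha> = 0 \<and> \<beta> = 0" using z by (intro fibre) auto
  next
    fix \<alpha> \<beta>
    assume z: "\<And>i. i < 4 \<Longrightarrow> \<alpha> * coeff (F i) n + \<beta> * coeff (G i) (Suc n) = 0"
    have "\<alpha> * coeff (f j) n + \<beta> * coeff (g j) (Suc n) = (\<Sum>i<4. K j i * (\<alpha> * coeff (F i) n + \<beta> * coeff (G i) (Suc n)))" if "j < 4" for j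
      by (simp add: K that coeff_sum sum_distrib_left sum.distrib algebra_simps)
    then show "\<alpha> = 0 \<and> \<beta> = 0" using z by (intro fibre_Infty) auto
  qed (rule FG; assumption)+
  define y where "y i = (\<Sum>j<4. Polynomial.smult (K j i) (a j))" for i
  have dy: "degree (y i) \<le> n" for i
    unfolding y_def using degree_a by (auto intro!: degree_sum_le order.trans[OF degree_smult_le])
  have swap: "(\<Sum>i<4. y i * w i) = (\<Sum>j<4. a j * (\<Sum>i<4. Polynomial.smult (K j i) (w i)))" for w
  proof -
    have "(\<Sum>i<4. y i * w i) = (\<Sum>i<4. \<Sum>j<4. Polynomial.smult (K j i) (a j * w i))"
      by (simp add: y_def sum_distrib_right)
    also have "\<dots> = (\<Sum>j<4. \<Sum>i<4. Polynomial.smult (K j i) (a j * w i))" by (rule sum.swap)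
    finally show ?thesis by (simp add: sum_distrib_left)
  qed
  have sy: "(\<Sum>i<4. y i * F i) = 0" "(\<Sum>i<4. y i * G i) = 0"
    unfolding swap using rel_f rel_g by (simp_all add: K)
  \<comment> \<open>If all \<open>y i\<close> vanished, independence of \<open>a\<close> would make
    the rows of \<open>K\<close> zero, hence \<open>u 0 = 0\<close>.\<close>
  have "\<exists>i<4. y i \<noteq> 0"
  proof (rule ccontr)
    assume "\<not> ?thesis"
    then have "K 0 i = 0" if "i < 4" for i
      using a_indep[of "\<lambda>j. K j i" 0] that by (simp add: y_def)
    then have "f 0 = 0" "g 0 = 0" using K[of 0] by simp_all
    then have "u 0 = 0" by (simp add: u_def)
    then have "0 \<in> u ` {..<4}" by (intro image_eqI[of _ _ 0]) auto
    from CV.dependent_zero[OF this] u_indep(2) show False by simp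
  qed
  then obtain i where "i < 4" "y i \<noteq> 0" by blast
  from S.relations_not_semistable[OF dy sy this] have "\<not> semistable S.relations" .
  moreover have "dual_span_bundle vs = S.relations"
    by (rule S.dual_span_bundle_eq[OF len]) (simp add: FG(1) S.w_def)
  ultimately show ?thesis
    using S.locally_free_relations unfolding vector_bundle_def by metis
qed

end

section \<open>The relation as the solution of a square linear system\<close>

section \<open>The matrix of the relation problem\<close>

text \<open>
  The unknowns are the coefficients of four polynomials \<open>y j\<close> of degree at most \<open>n\<close>; the rows are the
  coefficients of \<open>\<Sum>j. y j * f j\<close> and of \<open>\<Sum>j. y j * g j\<close>. There is one unknown more than there are
  equations; the last row, which picks the constant term of \<open>y 3\<close>, makes the matrix square.
\<close>

definition rel_mat :: "nat \<Rightarrow> (nat \<Rightarrow> complex poly) \<Rightarrow> (nat \<Rightarrow> complex poly) \<Rightarrow> complex mat" where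
  "rel_mat n f g = mat (4 * Suc n) (4 * Suc n) (\<lambda>(r, c).
     if r \<le> 2 * n then coeff (monom 1 (c mod Suc n) * f (c div Suc n)) r
     else if r < 4 * n + 3 then coeff (monom 1 (c mod Suc n) * g (c div Suc n)) (r - (2 * n + 1))
     else if c = 3 * Suc n then 1 else 0)"

definition rel_vec :: "nat \<Rightarrow> (nat \<Rightarrow> complex poly) \<Rightarrow> complex vec" where
  "rel_vec n y = vec (4 * Suc n) (\<lambda>c. coeff (y (c div Suc n)) (c mod Suc n))"

definition rel_polys :: "nat \<Rightarrow> complex vec \<Rightarrow> nat \<Rightarrow> complex poly" where
  "rel_polys n v j = (\<Sum>s<Suc n. monom (v $ (j * Suc n + s)) s)"

lemma rel_mat_carrier [simp]: "rel_mat n f g \<in> carrier_mat (4 * Suc n) (4 * Suc n)"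
  by (simp add: rel_mat_def)

lemma rel_vec_carrier [simp]: "rel_vec n y \<in> carrier_vec (4 * Suc n)"
  by (simp add: rel_vec_def)

lemma block_div_mod:
  assumes "s < Suc n"
  shows "(j * Suc n + s) div Suc n = j" "(j * Suc n + s) mod Suc n = s"
  using assms by (simp_all only: div_mult_self3 mod_mult_self3) auto

lemma block_less: "j < k \<Longrightarrow> s < Suc n \<Longrightarrow> j * Suc n + s < k * Suc n"
proof -
  assume a: "j < k" "s < Suc n"
  have "j * Suc n + s < Suc j * Suc n" using a(2) by simp
  also have "\<dots> \<le> k * Suc n" using a(1) by (intro mult_le_mono1) simp
  finally show ?thesis .
qed

lemma sum_blocks:
  fixes F :: "nat \<Rightarrow> nat \<Rightarrow> 'a :: comm_monoid_add"
  shows "(\<Sum>c<k * Suc n. F (c div Suc n) (c mod Suc n)) = (\<Sum>j<k. \<Sum>s<Suc n. F j s)"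
  unfolding sum.cartesian_product
proof (rule sum.reindex_bij_witness[of _ "\<lambda>(j, s). j * Suc n + s" "\<lambda>c. (c div Suc n, c mod Suc n)"])
  fix c assume "c \<in> {..<k * Suc n}"
  then have "c < k * Suc n" by simp
  then show "(c div Suc n, c mod Suc n) \<in> {..<k} \<times> {..<Suc n}"
    by (simp add: less_mult_imp_div_less)
  show "(case (c div Suc n, c mod Suc n) of (j, s) \<Rightarrow> j * Suc n + s) = c"
    by (simp only: prod.case div_mult_mod_eq)
next
  fix b assume b: "b \<in> {..<k} \<times> {..<Suc n}"
  obtain j s where js: "b = (j, s)" "j < k" "s < Suc n" using b by auto
  show "(case b of (j, s) \<Rightarrow> j * Suc n + s) \<in> {..<k * Suc n}"
    using block_less[OF js(2,3)] js(1) by simp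
  show "((case b of (j, s) \<Rightarrow> j * Suc n + s) div Suc n, (case b of (j, s) \<Rightarrow> j * Suc n + s) mod Suc n) = b"
    unfolding js(1) prod.case block_div_mod[OF js(3)] ..
qed simp

lemma coeff_mult_monoms:
  fixes y p :: "complex poly"
  assumes "degree y \<le> n"
  shows "coeff (y * p) m = (\<Sum>s<Suc n. coeff y s * coeff (monom 1 s * p) m)"
proof -
  have "y = (\<Sum>s\<le>n. monom (coeff y s) s)" using poly_as_sum_of_monoms'[OF assms] by simp
  also have "\<dots> = (\<Sum>s<Suc n. Polynomial.smult (coeff y s) (monom 1 s))"
    by (simp add: lessThan_Suc_atMost smult_monom)
  finally have "y * p = (\<Sum>s<Suc n. Polynomial.smult (coeff y s) (monom 1 s)) * p" by simp
  also have "\<dots> = (\<Sum>s<Suc n. Polynomial.smult (coeff y s) (monom 1 s * p))"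
    by (simp only: sum_distrib_right mult_smult_left)
  finally show ?thesis by (simp only: coeff_sum coeff_smult)
qed

lemma rel_mat_mult_rel_vec:
  assumes y: "\<And>j. j < 4 \<Longrightarrow> degree (y j) \<le> n" and r: "r < 4 * Suc n"
  shows "(rel_mat n f g *\<^sub>v rel_vec n y) $ r =
    (if r \<le> 2 * n then coeff (\<Sum>j<4. y j * f j) r
     else if r < 4 * n + 3 then coeff (\<Sum>j<4. y j * g j) (r - (2 * n + 1))
     else coeff (y 3) 0)"
proof -
  let ?N = "4 * Suc n"
  have sp: "(rel_mat n f g *\<^sub>v rel_vec n y) $ r = (\<Sum>c<?N. rel_mat n f g $$ (r, c) * rel_vec n y $ c)"
    using r by (simp add: scalar_prod_def lessThan_atLeast0 rel_mat_def rel_vec_def)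
  have main: "(\<Sum>c<?N. coeff (y (c div Suc n)) (c mod Suc n) * coeff (monom 1 (c mod Suc n) * w (c div Suc n)) m)
      = coeff (\<Sum>j<4. y j * w j) m" for w m
  proof -
    have "(\<Sum>c<?N. coeff (y (c div Suc n)) (c mod Suc n) * coeff (monom 1 (c mod Suc n) * w (c div Suc n)) m)
        = (\<Sum>j<4. \<Sum>s<Suc n. coeff (y j) s * coeff (monom 1 s * w j) m)"
      by (rule sum_blocks)
    also have "\<dots> = (\<Sum>j<4. coeff (y j * w j) m)"
      using y by (intro sum.cong refl coeff_mult_monoms[symmetric]) simp
    finally show ?thesis by (simp only: coeff_sum)
  qed
  consider "r \<le> 2 * n" | "\<not> r \<le> 2 * n" "r < 4 * n + 3" | "\<not> r \<le> 2 * n" "\<not> r < 4 * n + 3" by blast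
  then show ?thesis
  proof cases
    case 1
    have "(\<Sum>c<?N. rel_mat n f g $$ (r, c) * rel_vec n y $ c) =
        (\<Sum>c<?N. coeff (y (c div Suc n)) (c mod Suc n) * coeff (monom 1 (c mod Suc n) * f (c div Suc n)) r)"
      using 1 r by (intro sum.cong refl) (simp add: rel_mat_def rel_vec_def mult.commute del: mult_Suc_right mult_Suc)
    then show ?thesis using 1 unfolding sp main by simp
  next
    case 2
    have "(\<Sum>c<?N. rel_mat n f g $$ (r, c) * rel_vec n y $ c) =
        (\<Sum>c<?N. coeff (y (c div Suc n)) (c mod Suc n) * coeff (monom 1 (c mod Suc n) * g (c div Suc n)) (r - (2 * n + 1)))"
      using 2 r by (intro sum.cong refl) (simp add: rel_mat_def rel_vec_def mult.commute del: mult_Suc_right mult_Suc)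
    then show ?thesis using 2 unfolding sp main by simp
  next
    case 3
    have "(\<Sum>c<?N. rel_mat n f g $$ (r, c) * rel_vec n y $ c) =
        (\<Sum>c<?N. if c = 3 * Suc n then rel_vec n y $ (3 * Suc n) else 0)"
      using 3 r by (intro sum.cong refl) (simp add: rel_mat_def del: mult_Suc_right mult_Suc)
    also have "\<dots> = rel_vec n y $ (3 * Suc n)" by simp
    also have "\<dots> = coeff (y 3) 0"
      using block_div_mod[of 0 n 3] block_less[of 3 4 0 n] by (simp add: rel_vec_def del: mult_Suc_right mult_Suc)
    finally show ?thesis using 3 unfolding sp by simp
  qed
qed

lemma coeff_rel_polys: "coeff (rel_polys n v j) s = (if s < Suc n then v $ (j * Suc n + s) else 0)"
  unfolding rel_polys_def coeff_sum by (simp del: sum.lessThan_Suc)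

lemma degree_rel_polys: "degree (rel_polys n v j) \<le> n"
  by (rule degree_le) (simp add: coeff_rel_polys)

lemma rel_vec_rel_polys:
  assumes "v \<in> carrier_vec (4 * Suc n)"
  shows "rel_vec n (rel_polys n v) = v"
proof (rule eq_vecI)
  fix c assume "c < dim_vec v"
  then have "c < 4 * Suc n" using assms by simp
  then show "rel_vec n (rel_polys n v) $ c = v $ c"
    by (simp add: rel_vec_def coeff_rel_polys del: mult_Suc_right mult_Suc)
qed (use assms in \<open>simp add: rel_vec_def\<close>)

lemma rel_vec_inject:
  assumes "rel_vec n y = rel_vec n z" "\<And>j. j < 4 \<Longrightarrow> degree (y j) \<le> n" "\<And>j. j < 4 \<Longrightarrow> degree (z j) \<le> n" "j < 4"
  shows "y j = z j"
proof (rule poly_eqI)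
  fix s
  show "coeff (y j) s = coeff (z j) s"
  proof (cases "s < Suc n")
    case True
    have "rel_vec n y $ (j * Suc n + s) = rel_vec n z $ (j * Suc n + s)" by (simp only: assms(1))
    then show ?thesis
      using block_div_mod[OF True, of j] block_less[OF assms(4) True]
      by (simp add: rel_vec_def del: mult_Suc_right mult_Suc)
  next
    case False
    then show ?thesis using assms(2,3)[OF assms(4)] by (simp add: coeff_eq_0)
  qed
qed

text \<open>The solution of the relation problem given by Cramer's rule.\<close>

definition rel_sol :: "nat \<Rightarrow> (nat \<Rightarrow> complex poly) \<Rightarrow> (nat \<Rightarrow> complex poly) \<Rightarrow> nat \<Rightarrow> complex poly" where
  "rel_sol n f g = rel_polys n (col (adj_mat (rel_mat n f g)) (4 * n + 3))"

text \<open>A nonzero determinant makes the four solution polynomials independent. The exponents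
  \<open>0, 1, n - 1, n\<close> are those that occur in the example \<open>ex_a\<close>.\<close>

definition sol_mat :: "nat \<Rightarrow> (nat \<Rightarrow> complex poly) \<Rightarrow> (nat \<Rightarrow> complex poly) \<Rightarrow> complex mat" where
  "sol_mat n f g = mat 4 4 (\<lambda>(i, j). coeff (rel_sol n f g j) ([0, 1, n - 1, n] ! i))"

text \<open>The last column of \<open>B * adj B = det B * 1\<close>: all equations hold, and the
  normalising row takes the value \<open>det B\<close>. Avoiding the division keeps the solution
  polynomial in the entries.\<close>

lemma rel_mat_mult_rel_sol:
  "rel_mat n f g *\<^sub>v rel_vec n (rel_sol n f g) = det (rel_mat n f g) \<cdot>\<^sub>v unit_vec (4 * Suc n) (4 * n + 3)"
proof -
  let ?B = "rel_mat n f g" and ?N = "4 * Suc n"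
  have A: "adj_mat ?B \<in> carrier_mat ?N ?N" "?B * adj_mat ?B = det ?B \<cdot>\<^sub>m 1\<^sub>m ?N"
    using adj_mat[OF rel_mat_carrier] by blast+
  have l: "4 * n + 3 < ?N" by simp
  have "rel_vec n (rel_sol n f g) = col (adj_mat ?B) (4 * n + 3)"
    unfolding rel_sol_def by (rule rel_vec_rel_polys[OF col_carrier_vec[OF l A(1)]])
  then have "?B *\<^sub>v rel_vec n (rel_sol n f g) = col (?B * adj_mat ?B) (4 * n + 3)"
    using A(1) l by (simp add: col_mult2[OF rel_mat_carrier A(1) l])
  also have "\<dots> = det ?B \<cdot>\<^sub>v unit_vec ?N (4 * n + 3)"
    unfolding A(2) using l by (intro eq_vecI) auto
  finally show ?thesis .
qed

lemma invertible_inj: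
  fixes A :: "complex mat"
  assumes A: "A \<in> carrier_mat N N" "det A \<noteq> 0" and v: "v \<in> carrier_vec N" "w \<in> carrier_vec N"
    and e: "A *\<^sub>v v = A *\<^sub>v w"
  shows "v = w"
proof -
  have "A *\<^sub>v (v - w) = 0\<^sub>v N"
    using A v e by (simp add: mult_minus_distrib_mat_vec)
  moreover have "v - w \<in> carrier_vec N" using v by simp
  ultimately have "v - w = 0\<^sub>v N"
    using det_0_iff_vec_prod_zero[OF A(1)] A(2) by metis
  then have z: "(v - w) $ i = 0\<^sub>v N $ i" for i by simp
  show ?thesis
  proof (rule eq_vecI)
    fix i assume "i < dim_vec w"
    then show "v $ i = w $ i" using z[of i] v by simp
  qed (use v in simp)
qed

text \<open>Invertibility of the square matrix gives both \<open>surj\<close> and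
  \<open>unique\<close>: the equations can be solved for any right-hand side, and a relation is
  determined by the constant term of \<open>y 3\<close>.\<close>

theorem good_family_rel_sol:
  assumes df: "\<And>i. i < 4 \<Longrightarrow> degree (f i) \<le> n" and dg: "\<And>i. i < 4 \<Longrightarrow> degree (g i) \<le> Suc n"
    and det: "det (rel_mat n f g) \<noteq> 0" and sol: "det (sol_mat n f g) \<noteq> 0"
  shows "good_family n f g (rel_sol n f g)"
proof
  let ?B = "rel_mat n f g" and ?N = "4 * Suc n" and ?a = "rel_sol n f g"
  show da: "degree (?a i) \<le> n" for i unfolding rel_sol_def by (rule degree_rel_polys)
  have degF: "degree (\<Sum>j<4. y j * f j) \<le> 2 * n" and degG: "degree (\<Sum>j<4. y j * g j) \<le> 2 * n + 1"
    if "\<And>i. i < 4 \<Longrightarrow> degree (y i) \<le> n" for y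
    using that df dg
    by (auto intro!: degree_sum_le order.trans[OF degree_mult_le] add_mono[of _ n _ n, folded mult_2]
      add_mono[of _ n _ "Suc n", simplified, folded mult_2])
  have zero_if: "(\<Sum>j<4. y j * f j) = F \<and> (\<Sum>j<4. y j * g j) = G"
    if y: "\<And>i. i < 4 \<Longrightarrow> degree (y i) \<le> n" and dFG: "degree F \<le> 2 * n" "degree G \<le> 2 * n + 1"
      and v: "\<And>r. r \<le> 2 * n \<Longrightarrow> (?B *\<^sub>v rel_vec n y) $ r = coeff F r"
        "\<And>r. r \<le> 2 * n + 1 \<Longrightarrow> (?B *\<^sub>v rel_vec n y) $ (r + (2 * n + 1)) = coeff G r" for y F G
  proof
    have dF: "degree (\<Sum>j<4. y j * f j) \<le> 2 * n" by (rule degF) (rule y)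
    have dG: "degree (\<Sum>j<4. y j * g j) \<le> 2 * n + 1" by (rule degG) (rule y)
    have rv: "(?B *\<^sub>v rel_vec n y) $ r = (if r \<le> 2 * n then coeff (\<Sum>j<4. y j * f j) r
        else if r < 4 * n + 3 then coeff (\<Sum>j<4. y j * g j) (r - (2 * n + 1)) else coeff (y 3) 0)"
      if "r < ?N" for r
      using that by (intro rel_mat_mult_rel_vec y)
    show "(\<Sum>j<4. y j * f j) = F"
    proof (rule poly_eqI)
      fix r show "coeff (\<Sum>j<4. y j * f j) r = coeff F r"
      proof (cases "r \<le> 2 * n")
        case True
        then show ?thesis using v(1)[OF True] rv[of r] by simp
      next
        case False
        then show ?thesis using dF dFG(1) by (simp add: coeff_eq_0)
      qed
    qed
    show "(\<Sum>j<4. y j * g j) = G"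
    proof (rule poly_eqI)
      fix r show "coeff (\<Sum>j<4. y j * g j) r = coeff G r"
      proof (cases "r \<le> 2 * n + 1")
        case True
        then show ?thesis using v(2)[OF True] rv[of "r + (2 * n + 1)"] by simp
      next
        case False
        then show ?thesis using dG dFG(2) by (simp add: coeff_eq_0)
      qed
    qed
  qed
  have rel: "(\<Sum>j<4. ?a j * f j) = 0 \<and> (\<Sum>j<4. ?a j * g j) = 0"
    using da by (intro zero_if) (auto simp: rel_mat_mult_rel_sol)
  then show "(\<Sum>j<4. ?a j * f j) = 0" "(\<Sum>j<4. ?a j * g j) = 0" by auto
  show "c i = 0" if c: "(\<Sum>i<4. Polynomial.smult (c i) (?a i)) = 0" and i: "i < 4" for c i
  proof -
    have C: "sol_mat n f g \<in> carrier_mat 4 4" by (simp add: sol_mat_def)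
    have "sol_mat n f g *\<^sub>v vec 4 c = 0\<^sub>v 4"
    proof (rule eq_vecI)
      fix k assume "k < dim_vec (0\<^sub>v 4 :: complex vec)"
      then have k: "k < 4" by simp
      have "(sol_mat n f g *\<^sub>v vec 4 c) $ k = (\<Sum>j<4. coeff (?a j) ([0, 1, n - 1, n] ! k) * c j)"
        using k by (simp add: sol_mat_def scalar_prod_def lessThan_atLeast0)
      also have "\<dots> = coeff (\<Sum>i<4. Polynomial.smult (c i) (?a i)) ([0, 1, n - 1, n] ! k)"
        by (simp add: coeff_sum mult.commute)
      finally show "(sol_mat n f g *\<^sub>v vec 4 c) $ k = 0\<^sub>v 4 $ k" using c k by simp
    qed (simp add: sol_mat_def)
    moreover have "vec 4 c \<in> carrier_vec 4" by simp
    ultimately have "vec 4 c = 0\<^sub>v 4" using det_0_iff_vec_prod_zero[OF C] sol by blast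
    then have "vec 4 c $ i = 0\<^sub>v 4 $ i" by simp
    then show ?thesis using i by simp
  qed
  show "\<exists>d. \<forall>i<4. y i = Polynomial.smult d (?a i)"
    if y: "\<And>i. i < 4 \<Longrightarrow> degree (y i) \<le> n" and sy: "(\<Sum>i<4. y i * f i) = 0" "(\<Sum>i<4. y i * g i) = 0" for y
  proof -
    \<comment> \<open>Dividing the values of the normalising row on \<open>y\<close> and on
      \<open>?a\<close>, the latter being \<open>det ?B\<close>.\<close>
    define d where "d = coeff (y 3) 0 / det ?B"
    have sm: "rel_vec n (\<lambda>i. Polynomial.smult d (?a i)) = d \<cdot>\<^sub>v rel_vec n ?a"
      by (intro eq_vecI) (simp_all add: rel_vec_def)
    have "?B *\<^sub>v rel_vec n y = ?B *\<^sub>v rel_vec n (\<lambda>i. Polynomial.smult d (?a i))"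
    proof (rule eq_vecI)
      fix r assume "r < dim_vec (?B *\<^sub>v rel_vec n (\<lambda>i. Polynomial.smult d (?a i)))"
      then have r: "r < ?N" by (simp add: rel_mat_def)
      have "(?B *\<^sub>v rel_vec n (\<lambda>i. Polynomial.smult d (?a i))) $ r = d * (det ?B * (unit_vec ?N (4 * n + 3) $ r))"
        unfolding sm mult_mat_vec[OF rel_mat_carrier rel_vec_carrier] rel_mat_mult_rel_sol using r by simp
      also have "\<dots> = (if r = 4 * n + 3 then coeff (y 3) 0 else 0)"
        using r det by (simp add: d_def)
      also have "\<dots> = (?B *\<^sub>v rel_vec n y) $ r"
        using rel_mat_mult_rel_vec[of y n r f g] y sy r by auto
      finally show "(?B *\<^sub>v rel_vec n y) $ r = (?B *\<^sub>v rel_vec n (\<lambda>i. Polynomial.smult d (?a i))) $ r" by simp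
    qed (simp add: rel_mat_def)
    then have "rel_vec n y = rel_vec n (\<lambda>i. Polynomial.smult d (?a i))"
      by (rule invertible_inj[OF rel_mat_carrier det rel_vec_carrier rel_vec_carrier])
    then have "y i = Polynomial.smult d (?a i)" if "i < 4" for i
      by (rule rel_vec_inject) (use y that da in \<open>auto intro: order.trans[OF degree_smult_le]\<close>)
    then show ?thesis by blast
  qed
  show "\<exists>y. (\<forall>i<4. degree (y i) \<le> n) \<and> (\<Sum>i<4. y i * f i) = F \<and> (\<Sum>i<4. y i * g i) = G"
    if dFG: "degree F \<le> n + n" "degree G \<le> n + Suc n" for F G
  proof -
    \<comment> \<open>The entry in the normalising row only selects one of the solutions;
      \<open>zero_if\<close> compares the other rows.\<close>
    define b where "b = vec ?N (\<lambda>r. if r \<le> 2 * n then coeff F r else coeff G (r - (2 * n + 1)))"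
    define v where "v = (1 / det ?B) \<cdot>\<^sub>v (adj_mat ?B *\<^sub>v b)"
    have A: "adj_mat ?B \<in> carrier_mat ?N ?N" "?B * adj_mat ?B = det ?B \<cdot>\<^sub>m 1\<^sub>m ?N"
      using adj_mat[OF rel_mat_carrier] by blast+
    have b: "b \<in> carrier_vec ?N" by (simp add: b_def)
    have v: "v \<in> carrier_vec ?N" unfolding v_def smult_carrier_vec by (rule mult_mat_vec_carrier[OF A(1) b])
    have "?B *\<^sub>v v = (1 / det ?B) \<cdot>\<^sub>v ((?B * adj_mat ?B) *\<^sub>v b)"
      unfolding v_def assoc_mult_mat_vec[OF rel_mat_carrier A(1) b]
      by (rule mult_mat_vec[OF rel_mat_carrier mult_mat_vec_carrier[OF A(1) b]])
    also have "\<dots> = b"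
    proof -
      have "(det ?B \<cdot>\<^sub>m 1\<^sub>m ?N) *\<^sub>v b = det ?B \<cdot>\<^sub>v b"
        using b by (intro eq_vecI) (auto simp: row_smult)
      then show ?thesis unfolding A(2) using b det by (simp add: smult_smult_assoc)
    qed
    finally have Bv: "?B *\<^sub>v rel_vec n (rel_polys n v) = b" unfolding rel_vec_rel_polys[OF v] .
    have "(\<Sum>j<4. rel_polys n v j * f j) = F \<and> (\<Sum>j<4. rel_polys n v j * g j) = G"
      using dFG by (intro zero_if) (auto simp: degree_rel_polys Bv b_def)
    then show ?thesis using degree_rel_polys by blast
  qed
qed (rule df dg; assumption)+

section \<open>Openness: homogeneous polynomials in Pluecker coordinates\<close>

section \<open>Homogeneous polynomials\<close>

text \<open>Constants are introduced in degree 0 only, so in higher degrees zero arises as a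
  variable times zero. Sparse matrices need it in degree 1.\<close>

lemma hom_poly_zero: "hom_poly d (\<lambda>x :: 'i \<Rightarrow> complex. 0)"
proof (induction d)
  case 0
  show ?case by (rule hom_poly.const)
next
  case (Suc d)
  have "hom_poly (1 + d) (\<lambda>x :: 'i \<Rightarrow> complex. x undefined * 0)"
    by (rule hom_poly.mult[OF hom_poly.var Suc])
  then show ?case by simp
qed

lemma hom_poly_cmult: "hom_poly d F \<Longrightarrow> hom_poly d (\<lambda>x. c * F x)"
  using hom_poly.mult[OF hom_poly.const, of d F c] by simp

lemma hom_poly_sum:
  "(\<And>i. i \<in> S \<Longrightarrow> hom_poly d (F i)) \<Longrightarrow> hom_poly d (\<lambda>x. \<Sum>i\<in>S. F i x)"
  by (induction S rule: infinite_finite_induct) (auto intro: hom_poly_zero hom_poly.add)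

lemma hom_poly_prod:
  "finite S \<Longrightarrow> (\<And>i. i \<in> S \<Longrightarrow> hom_poly (d i) (F i)) \<Longrightarrow> hom_poly (\<Sum>i\<in>S. d i) (\<lambda>x. \<Prod>i\<in>S. F i x)"
  by (induction S rule: finite_induct) (auto intro: hom_poly.const hom_poly.mult)

text \<open>The degree may vary from row to row, since the normalising row of \<open>rel_mat\<close>
  is constant while the others are linear.\<close>

lemma hom_poly_det:
  assumes M: "\<And>x. M x \<in> carrier_mat k k"
    and h: "\<And>i j. i < k \<Longrightarrow> j < k \<Longrightarrow> hom_poly (d i) (\<lambda>x. M x $$ (i, j))"
  shows "hom_poly (\<Sum>i\<in>{0..<k}. d i) (\<lambda>x. det (M x))"
  unfolding det_def'[OF M]
proof (intro hom_poly_sum hom_poly_cmult hom_poly_prod)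
  fix \<pi> i assume "\<pi> \<in> {p. p permutes {0..<k}}" "i \<in> {0..<k}"
  then have "i < k" "\<pi> i < k" using permutes_in_image[of \<pi> "{0..<k}" i] by auto
  then show "hom_poly (d i) (\<lambda>x. M x $$ (i, \<pi> i))" by (rule h)
qed simp

text \<open>The deleted row is the last one; for \<open>rel_mat\<close> it is the constant row, and
  all remaining rows have the same degree.\<close>

lemma hom_poly_cofactor:
  assumes M: "\<And>x. M x \<in> carrier_mat (Suc k) (Suc k)" and c: "c < Suc k"
    and h: "\<And>i j. i < k \<Longrightarrow> j < Suc k \<Longrightarrow> hom_poly d (\<lambda>x. M x $$ (i, j))"
  shows "hom_poly (k * d) (\<lambda>x. cofactor (M x) k c)"
proof -
  have "hom_poly d (\<lambda>x. mat_delete (M x) k c $$ (i, j))" if "i < k" "j < k" for i j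
  proof -
    have "mat_delete (M x) k c $$ (i, j) = M x $$ (i, if j < c then j else Suc j)" for x
      using M[of x] that by (auto simp: mat_delete_def)
    then show ?thesis using h that by simp
  qed
  then have "hom_poly (\<Sum>i\<in>{0..<k}. d) (\<lambda>x. det (mat_delete (M x) k c))"
  proof (intro hom_poly_det)
    show "mat_delete (M x) k c \<in> carrier_mat k k" for x
      using mat_delete_carrier[OF M[of x], of k c] by simp
  qed
  then show ?thesis unfolding cofactor_def by (intro hom_poly_cmult) simp
qed

section \<open>The standard basis of the space of sections\<close>

definition f_poly :: "nat \<Rightarrow> (nat \<Rightarrow> nat \<Rightarrow> complex) \<Rightarrow> nat \<Rightarrow> complex poly" where
  "f_poly n L j = (\<Sum>r<Suc n. monom (L r j) r)"

definition g_poly :: "nat \<Rightarrow> (nat \<Rightarrow> nat \<Rightarrow> complex) \<Rightarrow> nat \<Rightarrow> complex poly" where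
  "g_poly n L j = (\<Sum>r<Suc (Suc n). monom (L (Suc n + r) j) r)"

lemma coeff_f_poly: "coeff (f_poly n L j) r = (if r < Suc n then L r j else 0)"
  unfolding f_poly_def coeff_sum by (simp del: sum.lessThan_Suc)

lemma coeff_g_poly: "coeff (g_poly n L j) r = (if r < Suc (Suc n) then L (Suc n + r) j else 0)"
  unfolding g_poly_def coeff_sum by (simp del: sum.lessThan_Suc)

lemma degree_f_poly: "degree (f_poly n L j) \<le> n"
  by (rule degree_le) (simp add: coeff_f_poly)

lemma degree_g_poly: "degree (g_poly n L j) \<le> Suc n"
  by (rule degree_le) (simp add: coeff_g_poly)

definition std_vec :: "nat \<Rightarrow> nat \<Rightarrow> rvec" where
  "std_vec n r = (if r < Suc n then pvec (monom 1 r) 0 else pvec 0 (monom 1 (r - Suc n)))"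

definition std_basis :: "nat \<Rightarrow> rvec list" where
  "std_basis n = map (std_vec n) [0..<Suc n + Suc (Suc n)]"

abbreviation sections :: "nat \<Rightarrow> rvec set" where
  "sections n \<equiv> global_sections (direct_sum_O [int n, int (Suc n)])"

lemma sum_lessThan_add:
  fixes F :: "nat \<Rightarrow> 'a :: comm_monoid_add"
  shows "(\<Sum>r<m + k. F r) = (\<Sum>r<m. F r) + (\<Sum>r<k. F (m + r))"
  by (induction k) (auto simp: add.assoc)

lemma sum_std_vec:
  "(\<Sum>r<Suc n + Suc (Suc n). scaleC (L r j) (std_vec n r)) = pvec (f_poly n L j) (g_poly n L j)"
proof -
  have "(\<Sum>r<Suc n. scaleC (L r j) (std_vec n r)) = pvec (f_poly n L j) 0"
    unfolding f_poly_def
    by (simp add: std_vec_def scaleC_pvec smult_monom pvec_sum del: sum.lessThan_Suc)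
  moreover have "(\<Sum>r<Suc (Suc n). scaleC (L (Suc n + r) j) (std_vec n (Suc n + r))) = pvec 0 (g_poly n L j)"
    unfolding g_poly_def
    by (simp add: std_vec_def scaleC_pvec smult_monom pvec_sum del: sum.lessThan_Suc)
  moreover have "pvec a 0 + pvec 0 b = pvec a b" for a b
    by (simp add: pvec_def vec2_add)
  ultimately show ?thesis unfolding sum_lessThan_add by metis
qed

lemma std_vec_indep:
  "inj_on (std_vec n) {..<Suc n + Suc (Suc n)}" "CV.independent (std_vec n ` {..<Suc n + Suc (Suc n)})"
proof -
  have "inj_on (std_vec n) {..<Suc n + Suc (Suc n)} \<and> CV.independent (std_vec n ` {..<Suc n + Suc (Suc n)})"
    unfolding CV.independent_family_iff
  proof (intro allI impI)
    fix c r assume c: "(\<Sum>r<Suc n + Suc (Suc n). scaleC (c r) (std_vec n r)) = 0" and r: "r < Suc n + Suc (Suc n)"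
    have "pvec (f_poly n (\<lambda>r j. c r) 0) (g_poly n (\<lambda>r j. c r) 0) = pvec 0 0"
      using sum_std_vec[of "\<lambda>r j. c r" 0 n] c by simp
    then have z: "coeff (f_poly n (\<lambda>r j. c r) 0) r = 0" "coeff (g_poly n (\<lambda>r j. c r) 0) (r - Suc n) = 0"
      unfolding pvec_eq_iff by simp_all
    show "c r = 0"
    proof (cases "r < Suc n")
      case True
      then show ?thesis using z(1) by (simp add: coeff_f_poly)
    next
      case False
      then have "Suc n + (r - Suc n) = r" "r - Suc n < Suc (Suc n)" using r by auto
      then show ?thesis using z(2) by (simp add: coeff_g_poly)
    qed
  qed
  then show "inj_on (std_vec n) {..<Suc n + Suc (Suc n)}" "CV.independent (std_vec n ` {..<Suc n + Suc (Suc n)})"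
    by auto
qed

lemma set_std_basis: "set (std_basis n) = std_vec n ` {..<Suc n + Suc (Suc n)}"
  by (simp add: std_basis_def lessThan_atLeast0 del: upt_Suc)

lemma length_std_basis [simp]: "length (std_basis n) = Suc n + Suc (Suc n)"
  by (simp add: std_basis_def del: upt_Suc)

lemma nth_std_basis: "r < Suc n + Suc (Suc n) \<Longrightarrow> std_basis n ! r = std_vec n r"
  by (simp add: std_basis_def del: upt_Suc)

lemma sections_eq_std_sum:
  assumes "v \<in> sections n"
  obtains c where "v = (\<Sum>r<Suc n + Suc (Suc n). scaleC (c r) (std_vec n r))"
proof -
  obtain f g where v: "v = pvec f g" "degree f \<le> n" "degree g \<le> Suc n"
    using assms unfolding global_sections_direct_sum_O_2 by blast
  define L :: "nat \<Rightarrow> nat \<Rightarrow> complex" where "L r j = (if r < Suc n then coeff f r else coeff g (r - Suc n))" for r j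
  have "f = f_poly n L 0" "g = g_poly n L 0"
    using v(2,3) by (auto simp: poly_eq_iff coeff_f_poly coeff_g_poly L_def coeff_eq_0)
  then have "v = (\<Sum>r<Suc n + Suc (Suc n). scaleC (L r 0) (std_vec n r))"
    unfolding sum_std_vec v(1) by simp
  then show ?thesis by (rule that)
qed

lemma basis_std_basis: "basis_of (std_basis n) (sections n)"
  unfolding basis_of_def
proof (intro conjI)
  show "distinct (std_basis n)"
    using std_vec_indep(1)[of n] unfolding std_basis_def
    by (simp add: distinct_map lessThan_atLeast0 del: upt_Suc)
  show "CV.independent (set (std_basis n))" unfolding set_std_basis by (rule std_vec_indep)
  show "CV.span (set (std_basis n)) = sections n"
  proof
    have "CV.subspace (sections n)"
    proof -
      have "CV.subspace (direct_sum_O [int n, int (Suc n)] p)" for p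
        using direct_sum_O_2_eq_O_span[of n "Suc n" p] CV_subspace_O_span by metis
      then show ?thesis unfolding global_sections_def by (auto intro!: CV.subspace_Inter)
    qed
    moreover have "set (std_basis n) \<subseteq> sections n"
      unfolding set_std_basis global_sections_direct_sum_O_2 std_vec_def
      by (auto simp: degree_monom_eq intro!: exI)
    ultimately show "CV.span (set (std_basis n)) \<subseteq> sections n" by (intro CV.span_minimal)
    show "sections n \<subseteq> CV.span (set (std_basis n))"
    proof
      fix v assume "v \<in> sections n"
      then obtain c where "v = (\<Sum>r<Suc n + Suc (Suc n). scaleC (c r) (std_vec n r))" by (rule sections_eq_std_sum)
      moreover have "(\<Sum>r<Suc n + Suc (Suc n). scaleC (c r) (std_vec n r)) \<in> CV.span (set (std_basis n))"
        unfolding set_std_basis by (intro CV.span_sum CV.span_scale CV.span_base imageI)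
      ultimately show "v \<in> CV.span (set (std_basis n))" by (simp only:)
    qed
  qed
qed

definition coords :: "nat \<Rightarrow> rvec list \<Rightarrow> nat \<Rightarrow> nat \<Rightarrow> complex" where
  "coords n vs r j = CV.representation (set (std_basis n)) (vs ! j) (std_basis n ! r)"

lemma representation_std_sum:
  assumes "r < Suc n + Suc (Suc n)"
  shows "CV.representation (set (std_basis n)) (\<Sum>r<Suc n + Suc (Suc n). scaleC (c r) (std_vec n r))
    (std_basis n ! r) = c r"
proof -
  have ind: "CV.independent (set (std_basis n))" unfolding set_std_basis by (rule std_vec_indep)
  have base: "std_vec n s \<in> set (std_basis n)" if "s < Suc n + Suc (Suc n)" for s
    unfolding set_std_basis using that by simp
  have "CV.representation (set (std_basis n)) (\<Sum>r<Suc n + Suc (Suc n). scaleC (c r) (std_vec n r)) (std_vec n r)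
      = (\<Sum>s<Suc n + Suc (Suc n). c s * CV.representation (set (std_basis n)) (std_vec n s) (std_vec n r))"
    using ind base
    by (subst CV.representation_sum) (auto simp: CV.representation_scale CV.span_base CV.span_scale)
  also have "\<dots> = (\<Sum>s<Suc n + Suc (Suc n). if s = r then c r else 0)"
    using ind base assms std_vec_indep(1)[of n]
    by (intro sum.cong) (auto simp: CV.representation_basis inj_on_def)
  also have "\<dots> = c r" using assms by simp
  finally show ?thesis unfolding nth_std_basis[OF assms] .
qed

lemma coords_eq:
  assumes "vs ! j \<in> sections n"
  shows "vs ! j = pvec (f_poly n (coords n vs) j) (g_poly n (coords n vs) j)"
proof -
  obtain c where c: "vs ! j = (\<Sum>r<Suc n + Suc (Suc n). scaleC (c r) (std_vec n r))"
    using assms by (rule sections_eq_std_sum)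
  then have "coords n vs r j = c r" if "r < Suc n + Suc (Suc n)" for r
    using representation_std_sum[OF that, of c] by (simp only: coords_def)
  then have "vs ! j = (\<Sum>r<Suc n + Suc (Suc n). scaleC (coords n vs r j) (std_vec n r))"
    unfolding c by (intro sum.cong) auto
  then show ?thesis unfolding sum_std_vec .
qed

lemma coords_pvec:
  assumes "vs ! j = pvec f g" "degree f \<le> n" "degree g \<le> Suc n"
  shows "f_poly n (coords n vs) j = f" "g_poly n (coords n vs) j = g"
proof -
  have "vs ! j \<in> sections n" using assms unfolding global_sections_direct_sum_O_2 by blast
  from coords_eq[OF this] show "f_poly n (coords n vs) j = f" "g_poly n (coords n vs) j = g"
    unfolding assms(1) pvec_eq_iff by simp_all
qed

section \<open>Minors with a list of rows\<close>

abbreviation rows_det :: "(nat \<Rightarrow> nat \<Rightarrow> complex) \<Rightarrow> nat list \<Rightarrow> complex" where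
  "rows_det M xs \<equiv> det (mat 4 4 (\<lambda>(i, j). M (xs ! i) j))"

lemma rows_det_not_distinct:
  assumes "length xs = 4" "\<not> distinct xs"
  shows "rows_det M xs = 0"
proof -
  obtain i k where ik: "i < 4" "k < 4" "i \<noteq> k" "xs ! i = xs ! k"
    using assms by (auto simp: distinct_conv_nth)
  show ?thesis
    by (rule det_identical_rows[of _ 4 i k]) (use ik in \<open>auto intro!: eq_vecI\<close>)
qed

text \<open>The factor is the sign of the sorting permutation. It does not depend on the matrix, so
  it may stand as a coefficient in a polynomial.\<close>

lemma rows_det_sorted:
  assumes "length xs = 4" "distinct xs"
  shows "\<exists>\<sigma>. \<forall>M. rows_det M xs = \<sigma> * rows_det M (sorted_list_of_set (set xs))"
proof -
  define ys where "ys = sorted_list_of_set (set xs)"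
  have "mset ys = mset xs"
    using assms(2) unfolding ys_def by (metis distinct_sorted_list_of_set finite_set set_eq_iff_mset_eq_distinct
        set_sorted_list_of_set)
  then obtain \<pi> where \<pi>: "\<pi> permutes {..<length xs}" "permute_list \<pi> xs = ys"
    using mset_eq_permutation by metis
  have p: "\<pi> permutes {0..<4}" using \<pi>(1) assms(1) by (simp add: lessThan_atLeast0)
  have ys: "ys ! i = xs ! \<pi> i" if "i < 4" for i
    using \<pi> that assms(1) permute_list_nth[OF \<pi>(1)] by auto
  have "rows_det M xs = signof \<pi> * rows_det M ys" for M
  proof -
    let ?A = "mat 4 4 (\<lambda>(i, j). M (xs ! i) j)"
    have "mat 4 4 (\<lambda>(i, j). ?A $$ (\<pi> i, j)) = mat 4 4 (\<lambda>(i, j). M (ys ! i) j)"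
      using permutes_in_image[OF p] by (intro eq_matI) (auto simp: ys)
    then have "rows_det M ys = signof \<pi> * det ?A"
      using det_permute_rows[of ?A 4, OF _ p] by simp
    then show ?thesis by (simp add: sign_def)
  qed
  then show ?thesis unfolding ys_def by blast
qed

definition row_sign :: "nat list \<Rightarrow> complex" where
  "row_sign xs = (SOME \<sigma>. \<forall>M. rows_det M xs = \<sigma> * rows_det M (sorted_list_of_set (set xs)))"

text \<open>A Pluecker coordinate as a function of a list of rows. \<open>pluecker\<close> knows
  only sets in increasing order, whereas replacing a row of the chart may disturb the order or
  repeat a row.\<close>

definition row_coord :: "nat list \<Rightarrow> (nat set \<Rightarrow> complex) \<Rightarrow> complex" where
  "row_coord xs x = row_sign xs * x (set xs)"

lemma hom_poly_row_coord: "hom_poly 1 (row_coord xs)"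
  unfolding row_coord_def[abs_def] by (rule hom_poly_cmult[OF hom_poly.var])

lemma row_coord_pluecker:
  assumes xs: "length xs = 4" "set xs \<subseteq> {..<Suc n + Suc (Suc n)}" and vs: "length vs = 4"
  shows "row_coord xs (pluecker (std_basis n) vs) = rows_det (coords n vs) xs"
proof (cases "distinct xs")
  case True
  then have card: "card (set xs) = 4" using xs(1) by (simp add: distinct_card)
  have "pluecker (std_basis n) vs (set xs) = rows_det (coords n vs) (sorted_list_of_set (set xs))"
    using xs vs card unfolding pluecker_def coords_def by simp
  moreover have "\<forall>M. rows_det M xs = row_sign xs * rows_det M (sorted_list_of_set (set xs))"
    unfolding row_sign_def by (rule someI_ex[OF rows_det_sorted[OF xs(1) True]])
  ultimately show ?thesis by (simp only: row_coord_def)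
next
  case False
  then have "card (set xs) \<noteq> 4" using xs(1) by (metis card_distinct)
  then have "pluecker (std_basis n) vs (set xs) = 0" using vs by (simp add: pluecker_def)
  then show ?thesis using rows_det_not_distinct[OF xs(1) False] by (simp add: row_coord_def)
qed

section \<open>The open set\<close>

text \<open>The rows in which the coordinates of \<open>ex_basis\<close> below form the identity matrix.\<close>

definition chart :: "nat \<Rightarrow> nat list" where
  "chart n = [0, 1, n - 1, n]"

text \<open>
  On the chart of the Grassmannian where the minor \<open>chart n\<close> is nonzero, these are the coordinates of a
  basis of the subspace, namely of any basis multiplied by the adjugate of its rows in \<open>chart n\<close>.
\<close>

definition chart_coord :: "nat \<Rightarrow> (nat set \<Rightarrow> complex) \<Rightarrow> nat \<Rightarrow> nat \<Rightarrow> complex" where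
  "chart_coord n x r j = row_coord ((chart n)[j := r]) x"

text \<open>A product, so that nonvanishing means that both hypotheses of
  \<open>good_family_rel_sol\<close> on determinants hold.\<close>

definition chart_poly :: "nat \<Rightarrow> (nat set \<Rightarrow> complex) \<Rightarrow> complex" where
  "chart_poly n x = det (rel_mat n (f_poly n (chart_coord n x)) (g_poly n (chart_coord n x))) *
     det (sol_mat n (f_poly n (chart_coord n x)) (g_poly n (chart_coord n x)))"

lemma length_chart [simp]: "length (chart n) = 4"
  by (simp add: chart_def)

lemma chart_nth_less: "0 < n \<Longrightarrow> i < 4 \<Longrightarrow> chart n ! i < Suc n"
  by (auto simp: chart_def less_Suc_eq numeral_eq_Suc nth_Cons')

lemma set_chart_update:
  assumes "r < Suc n + Suc (Suc n)"
  shows "set ((chart n)[j := r]) \<subseteq> {..<Suc n + Suc (Suc n)}"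
proof -
  have "set (chart n) \<subseteq> {..<Suc n + Suc (Suc n)}" by (auto simp: chart_def)
  then show ?thesis using assms set_update_subset_insert[of "chart n" j r] by auto
qed

lemma hom_poly_coeff_f_poly: "hom_poly 1 (\<lambda>x. coeff (monom 1 s * f_poly n (chart_coord n x) j) r)"
  unfolding coeff_monom_mult coeff_f_poly chart_coord_def
  by (cases "s \<le> r"; cases "r - s < Suc n") (simp_all add: hom_poly_zero hom_poly_row_coord del: One_nat_def)

lemma hom_poly_coeff_g_poly: "hom_poly 1 (\<lambda>x. coeff (monom 1 s * g_poly n (chart_coord n x) j) r)"
  unfolding coeff_monom_mult coeff_g_poly chart_coord_def
  by (cases "s \<le> r"; cases "r - s < Suc (Suc n)") (simp_all add: hom_poly_zero hom_poly_row_coord del: One_nat_def)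

lemma hom_poly_rel_mat:
  assumes "i < 4 * n + 3" "c < 4 * Suc n"
  shows "hom_poly 1 (\<lambda>x. rel_mat n (f_poly n (chart_coord n x)) (g_poly n (chart_coord n x)) $$ (i, c))"
  using assms hom_poly_coeff_f_poly hom_poly_coeff_g_poly
  by (cases "i \<le> 2 * n") (simp_all add: rel_mat_def del: One_nat_def)

lemma rel_mat_last_row:
  assumes "c < 4 * Suc n"
  shows "rel_mat n f g $$ (4 * n + 3, c) = (if c = 3 * Suc n then 1 else 0)"
  using assms by (simp add: rel_mat_def)

lemma coeff_rel_sol:
  assumes "e < Suc n" "j < 4"
  shows "coeff (rel_sol n f g j) e = cofactor (rel_mat n f g) (4 * n + 3) (j * Suc n + e)"
proof -
  have "4 * n + 3 < 4 * Suc n" by simp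
  then show ?thesis
    using assms block_less[OF assms(2,1)]
    by (simp add: rel_sol_def coeff_rel_polys adj_mat_def carrier_matD[OF rel_mat_carrier]
        del: mult_Suc_right mult_Suc)
qed

text \<open>The first determinant has degree \<open>4 n + 3\<close>, from its linear rows. By
  \<open>coeff_rel_sol\<close> the entries of \<open>sol_mat\<close> are cofactors of the constant
  row, again of degree \<open>4 n + 3\<close>.\<close>

lemma hom_poly_chart_poly:
  assumes n: "0 < n"
  shows "\<exists>d. hom_poly d (chart_poly n)"
proof -
  define B where "B x = rel_mat n (f_poly n (chart_coord n x)) (g_poly n (chart_coord n x))" for x
  define S where "S x = sol_mat n (f_poly n (chart_coord n x)) (g_poly n (chart_coord n x))" for x
  have B: "B x \<in> carrier_mat (4 * Suc n) (4 * Suc n)" for x unfolding B_def by (rule rel_mat_carrier)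
  have N: "4 * Suc n = Suc (4 * n + 3)" by simp
  have top: "hom_poly 1 (\<lambda>x. B x $$ (i, c))" if "i < 4 * n + 3" "c < 4 * Suc n" for i c
    unfolding B_def using that by (rule hom_poly_rel_mat)
  have "hom_poly (if i < 4 * n + 3 then 1 else 0) (\<lambda>x. B x $$ (i, c))" if "i < 4 * Suc n" "c < 4 * Suc n" for i c
  proof (cases "i < 4 * n + 3")
    case True
    then show ?thesis using top that by (simp del: One_nat_def)
  next
    case False
    then have "i = 4 * n + 3" using that by simp
    then show ?thesis
      using rel_mat_last_row[OF that(2)] by (simp add: B_def hom_poly.const)
  qed
  then have "hom_poly (\<Sum>i\<in>{0..<4 * Suc n}. if i < 4 * n + 3 then 1 else 0) (\<lambda>x. det (B x))"
    by (intro hom_poly_det B)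
  then obtain dB where detB: "hom_poly dB (\<lambda>x. det (B x))" by (rule that)
  have "hom_poly ((4 * n + 3) * 1) (\<lambda>x. S x $$ (i, j))" if "i < 4" "j < 4" for i j
  proof -
    have "S x $$ (i, j) = cofactor (B x) (4 * n + 3) (j * Suc n + chart n ! i)" for x
      using that coeff_rel_sol[OF chart_nth_less[OF n that(1)] that(2)]
      by (simp add: S_def B_def sol_mat_def chart_def)
    then have eq: "(\<lambda>x. S x $$ (i, j)) = (\<lambda>x. cofactor (B x) (4 * n + 3) (j * Suc n + chart n ! i))" by simp
    show ?thesis
      unfolding eq
    proof (rule hom_poly_cofactor)
      show "B x \<in> carrier_mat (Suc (4 * n + 3)) (Suc (4 * n + 3))" for x using B[of x] unfolding N .
      show "j * Suc n + chart n ! i < Suc (4 * n + 3)"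
        using block_less[OF that(2) chart_nth_less[OF n that(1)]] unfolding N .
      show "hom_poly 1 (\<lambda>x. B x $$ (i, j))" if "i < 4 * n + 3" "j < Suc (4 * n + 3)" for i j
        using that(2) unfolding N[symmetric] by (rule top[OF that(1)])
    qed
  qed
  then have "hom_poly (\<Sum>i\<in>{0..<4 :: nat}. (4 * n + 3) * 1) (\<lambda>x. det (S x))"
    by (intro hom_poly_det) (simp add: S_def sol_mat_def)
  with detB have "hom_poly (dB + (\<Sum>i\<in>{0..<4 :: nat}. (4 * n + 3) * 1)) (\<lambda>x. det (B x) * det (S x))"
    by (rule hom_poly.mult)
  also have "(\<lambda>x. det (B x) * det (S x)) = chart_poly n"
    by (rule ext) (simp only: chart_poly_def B_def S_def)
  finally show ?thesis by (rule exI)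
qed

lemma chart_coord_pluecker:
  assumes "length vs = 4" "r < Suc n + Suc (Suc n)"
  shows "chart_coord n (pluecker (std_basis n) vs) r j = rows_det (coords n vs) ((chart n)[j := r])"
  unfolding chart_coord_def using assms set_chart_update by (intro row_coord_pluecker) auto

text \<open>Expansion along the replaced row, whose cofactors do not see the replacement. So the
  chart coordinates are the coordinate matrix times an adjugate.\<close>

lemma rows_det_update:
  assumes "j < 4" "length xs = 4"
  shows "rows_det M (xs[j := r]) = (\<Sum>k<4. M r k * cofactor (mat 4 4 (\<lambda>(i, k). M (xs ! i) k)) j k)"
proof -
  define A where "A = mat 4 4 (\<lambda>(i, k). M (xs[j := r] ! i) k)"
  have "cofactor A j k = cofactor (mat 4 4 (\<lambda>(i, k). M (xs ! i) k)) j k" for k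
  proof -
    have "mat_delete A j k = mat_delete (mat 4 4 (\<lambda>(i, k). M (xs ! i) k)) j k"
      by (rule eq_matI) (auto simp: mat_delete_def A_def)
    then show ?thesis by (simp only: cofactor_def)
  qed
  moreover have "A $$ (j, k) = M r k" if "k < 4" for k using that assms by (simp add: A_def)
  moreover have "det A = (\<Sum>k<4. A $$ (j, k) * cofactor A j k)"
    using assms by (intro laplace_expansion_row) (auto simp: A_def)
  ultimately show ?thesis unfolding A_def by simp
qed

text \<open>The columns of the chart coordinates are combinations of \<open>vs\<close>, so the good
  family lies in \<open>V\<close>; being independent with four members, it spans
  \<open>V\<close>.\<close>

lemma chart_good:
  assumes vs: "length vs = 4" "basis_of vs V" "V \<subseteq> sections n"
    and nz: "chart_poly n (pluecker (std_basis n) vs) \<noteq> 0"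
  obtains f g a where "good_family n f g a" "good_family.V f g = V"
proof -
  define L where "L = chart_coord n (pluecker (std_basis n) vs)"
  define M where "M = coords n vs"
  define C where "C j k = cofactor (mat 4 4 (\<lambda>(i, k). M (chart n ! i) k)) j k" for j k
  have V: "CV.span (set vs) = V" "distinct vs" "CV.independent (set vs)" using vs(2) by (auto simp: basis_of_def)
  have inV: "vs ! k \<in> V" if "k < 4" for k
    using that vs(1) V(1) CV.span_superset[of "set vs"] by auto
  have vsM: "vs ! k = pvec (f_poly n M k) (g_poly n M k)" if "k < 4" for k
    unfolding M_def using inV[OF that] vs(3) by (intro coords_eq) auto
  have L: "L r j = (\<Sum>k<4. M r k * C j k)" if "r < Suc n + Suc (Suc n)" "j < 4" for r j
    unfolding L_def chart_coord_pluecker[OF vs(1) that(1)] M_def[symmetric] C_def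
    by (rule rows_det_update) (use that in auto)
  have polys: "f_poly n L j = (\<Sum>k<4. Polynomial.smult (C j k) (f_poly n M k))"
    "g_poly n L j = (\<Sum>k<4. Polynomial.smult (C j k) (g_poly n M k))" if "j < 4" for j
    by (rule poly_eqI, simp add: coeff_sum coeff_f_poly coeff_g_poly L that mult.commute)+
  interpret G: good_family n "f_poly n L" "g_poly n L" "rel_sol n (f_poly n L) (g_poly n L)"
    using nz unfolding chart_poly_def L_def[symmetric]
    by (intro good_family_rel_sol degree_f_poly degree_g_poly) auto
  have "G.u j \<in> V" if "j < 4" for j
  proof -
    have "G.u j = (\<Sum>k<4. scaleC (C j k) (vs ! k))"
      unfolding G.u_def polys[OF that] using vsM by (simp add: scaleC_pvec pvec_sum)
    also have "\<dots> \<in> CV.span (set vs)"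
      using vs(1) by (intro CV.span_sum CV.span_scale CV.span_base) auto
    finally show ?thesis unfolding V(1) .
  qed
  then have sub: "G.V \<subseteq> V"
    unfolding G.V_def V(1)[symmetric] by (intro CV.span_minimal) auto
  have "G.V = V"
  proof (rule ccontr)
    assume "G.V \<noteq> V"
    with sub have psub: "G.V \<subset> V" by blast
    have card: "card (set vs) = 4" using V(2) vs(1) by (simp add: distinct_card)
    have "CV.subspace G.V" unfolding G.V_def by (rule CV.subspace_span)
    then obtain B :: "rvec set" where "card B < 4" "card B = CV.dim G.V"
      using card_basis_proper_subspace[OF _ psub V(1)[symmetric] finite_set card] by metis
    moreover have "CV.dim G.V = 4"
      unfolding G.V_def using CV.dim_span_eq_card_independent[OF G.u_indep(2)] G.u_indep(1)
      by (simp add: card_image)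
    ultimately show False by simp
  qed
  then show ?thesis by (intro that[OF G.good_family_axioms])
qed

section \<open>The explicit example and the conclusion\<close>

section \<open>A member of the open set\<close>

text \<open>Monomials at the exponents of \<open>chart\<close>, so that the chart rows of the
  coordinate matrix form the identity.\<close>

definition ex_f :: "nat \<Rightarrow> nat \<Rightarrow> complex poly" where
  "ex_f n j = monom 1 (chart n ! j)"

definition ex_g :: "nat \<Rightarrow> nat \<Rightarrow> complex poly" where
  "ex_g n j = [0, - monom 1 3, 1 - monom 1 (Suc n), monom 1 1] ! j"

text \<open>The same monomials in reverse order, with alternating signs: against \<open>ex_f\<close>
  the terms cancel in the pairs 0, 1 and 2, 3, and \<open>sol_mat\<close> becomes
  antidiagonal.\<close>

definition ex_a :: "nat \<Rightarrow> nat \<Rightarrow> complex poly" where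
  "ex_a n j = [- monom 1 n, monom 1 (n - 1), - monom 1 1, 1] ! j"

lemma sum_lessThan_4: "(\<Sum>i<4. F i) = F 0 + F 1 + F 2 + F (3::nat)" for F :: "nat \<Rightarrow> 'a :: comm_monoid_add"
  by (simp add: eval_nat_numeral)

lemma less_4: "i < (4::nat) \<longleftrightarrow> i = 0 \<or> i = 1 \<or> i = 2 \<or> i = 3" by auto

lemma ex_simps:
  "ex_f n 0 = 1" "ex_f n 1 = monom 1 1" "ex_f n 2 = monom 1 (n - 1)" "ex_f n 3 = monom 1 n"
  "ex_g n 0 = 0" "ex_g n 1 = - monom 1 3" "ex_g n 2 = 1 - monom 1 (Suc n)" "ex_g n 3 = monom 1 1"
  "ex_a n 0 = - monom 1 n" "ex_a n 1 = monom 1 (n - 1)" "ex_a n 2 = - monom 1 1" "ex_a n 3 = 1"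
  by (simp_all add: ex_f_def ex_g_def ex_a_def chart_def eval_nat_numeral)

lemma degree_ex:
  assumes "3 \<le> n" "i < 4"
  shows "degree (ex_f n i) \<le> n" "degree (ex_g n i) \<le> Suc n" "degree (ex_a n i) \<le> n"
  using assms(2) unfolding less_4
  by (elim disjE; use assms(1) in \<open>simp add: ex_simps ex_simps(2,6,10)[simplified] degree_monom_eq del: One_nat_def;
      intro degree_diff_le; simp add: degree_monom_eq\<close>)+

lemma ex_relation:
  assumes "3 \<le> n"
  shows "(\<Sum>i<4. ex_a n i * ex_f n i) = 0" "(\<Sum>i<4. ex_a n i * ex_g n i) = 0"
  using assms unfolding sum_lessThan_4 ex_simps
  by (simp_all add: mult_monom algebra_simps)

text \<open>Coefficient comparison in \<open>y 0 + t y 1 + t^(n-1) y 2 + t^n y 3 = 0\<close> and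
  \<open>y 2 (1 - t^(n+1)) + t y 3 = t^3 y 1\<close>. Low and high degrees isolate single
  coefficients, until only those named in the next steps are coupled.\<close>

lemma ex_kernel:
  assumes n: "3 \<le> n" and y: "\<And>i. i < 4 \<Longrightarrow> degree (y i) \<le> n"
    and f: "(\<Sum>i<4. y i * ex_f n i) = 0" and g: "(\<Sum>i<4. y i * ex_g n i) = 0" and 0: "coeff (y 3) 0 = 0"
    and i: "i < 4"
  shows "y i = 0"
proof -
  have high: "coeff (y i) m = 0" if "i < 4" "m > n" for i m
    using y[OF that(1)] that(2) by (simp add: coeff_eq_0)
  have F: "coeff (y 0) m + coeff (monom 1 1 * y 1) m + coeff (monom 1 (n - 1) * y 2) m + coeff (monom 1 n * y 3) m = 0" for m
    using arg_cong[OF f, of "\<lambda>p. coeff p m"] unfolding sum_lessThan_4 ex_simps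
    by (simp add: mult.commute del: One_nat_def)
  have G: "coeff (y 2) m + coeff (monom 1 1 * y 3) m = coeff (monom 1 3 * y 1) m + coeff (monom 1 (Suc n) * y 2) m" for m
    using arg_cong[OF g, of "\<lambda>p. coeff p m"] unfolding sum_lessThan_4 ex_simps
    by (simp add: algebra_simps del: One_nat_def)
  have "coeff (y 2) 0 = 0" using G[of 0] n by (simp add: coeff_monom_mult)
  moreover have "coeff (y 2) 1 = 0" using G[of 1] n 0 by (simp add: coeff_monom_mult)
  moreover have c22: "coeff (y 2) 2 = - coeff (y 3) 1"
    using G[of 2] n by (simp add: coeff_monom_mult eq_neg_iff_add_eq_0)
  moreover have y2: "coeff (y 2) k = 0" if "k \<ge> 3" for k
    using G[of "Suc n + k"] n that high[of 1] high[of 2] high[of 3] by (simp add: coeff_monom_mult)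
  \<comment> \<open>This equation, \<open>c22\<close> and the next one form a system for
    \<open>coeff (y 1) n\<close>, \<open>coeff (y 2) 2\<close> and \<open>coeff (y 3) 1\<close>
    whose only solution is zero.\<close>
  moreover have c1n: "coeff (y 1) n = - coeff (y 2) 2"
    using G[of "n + 3"] n high[of 2] high[of 3] by (simp add: coeff_monom_mult eq_neg_iff_add_eq_0)
  moreover have "coeff (y 1) n + coeff (y 2) 2 + coeff (y 3) 1 = 0"
  proof -
    have "Suc n - (n - Suc 0) = 2" "\<not> Suc n < n - Suc 0" using n by auto
    then show ?thesis using F[of "n + 1"] high[of 0] by (simp add: coeff_monom_mult)
  qed
  ultimately have c22: "coeff (y 2) 2 = 0" and c31: "coeff (y 3) 1 = 0" by auto
  have y2: "y 2 = 0"
  proof (rule poly_eqI)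
    fix k :: nat
    consider "k = 0" | "k = 1" | "k = 2" | "k \<ge> 3" by linarith
    then show "coeff (y 2) k = coeff 0 k"
      using \<open>coeff (y 2) 0 = 0\<close> \<open>coeff (y 2) 1 = 0\<close> c22 y2 by cases auto
  qed
  have y3: "y 3 = 0"
  proof (rule poly_eqI)
    fix k :: nat
    consider "k = 0" | "k = 1" | "k \<ge> 2" by linarith
    then show "coeff (y 3) k = coeff 0 k"
    proof cases
      case 3
      then show ?thesis using F[of "n + k"] n high[of 0] high[of 1] y2 by (simp add: coeff_monom_mult)
    qed (use 0 c31 in auto)
  qed
  have y1: "y 1 = 0"
  proof (rule poly_eqI)
    show "coeff (y 1) k = coeff 0 k" for k
      using G[of "k + 3"] y2 y3 by (simp add: coeff_monom_mult)
  qed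
  have y0: "y 0 = 0"
  proof (rule poly_eqI)
    show "coeff (y 0) m = coeff 0 m" for m using F[of m] y1 y2 y3 by simp
  qed
  show ?thesis using i y0 y1 y2 y3 unfolding less_4 by auto
qed

lemma det_rel_mat_ex:
  assumes n: "3 \<le> n"
  shows "det (rel_mat n (ex_f n) (ex_g n)) \<noteq> 0"
proof
  assume "det (rel_mat n (ex_f n) (ex_g n)) = 0"
  then obtain v where v: "v \<in> carrier_vec (4 * Suc n)" "v \<noteq> 0\<^sub>v (4 * Suc n)"
    "rel_mat n (ex_f n) (ex_g n) *\<^sub>v v = 0\<^sub>v (4 * Suc n)"
    using det_0_iff_vec_prod_zero[OF rel_mat_carrier] by blast
  define y where "y = rel_polys n v"
  have vy: "v = rel_vec n y" unfolding y_def by (rule rel_vec_rel_polys[OF v(1), symmetric])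
  have dy: "degree (y i) \<le> n" for i unfolding y_def by (rule degree_rel_polys)
  have row: "0 = (if r \<le> 2 * n then coeff (\<Sum>j<4. y j * ex_f n j) r
     else if r < 4 * n + 3 then coeff (\<Sum>j<4. y j * ex_g n j) (r - (2 * n + 1))
     else coeff (y 3) 0)" if "r < 4 * Suc n" for r
    using rel_mat_mult_rel_vec[of y n r "ex_f n" "ex_g n"] dy that v(3) unfolding vy by simp
  have df: "degree (y j * ex_f n j) \<le> 2 * n" "degree (y j * ex_g n j) \<le> 2 * n + 1" if "j < 4" for j
    using degree_mult_le[of "y j" "ex_f n j"] degree_mult_le[of "y j" "ex_g n j"] dy[of j]
      degree_ex(1,2)[OF n that] by linarith+
  have yf: "(\<Sum>j<4. y j * ex_f n j) = 0"
  proof (rule poly_eqI)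
    fix r
    have "degree (\<Sum>j<4. y j * ex_f n j) \<le> 2 * n" using df by (intro degree_sum_le) auto
    then show "coeff (\<Sum>j<4. y j * ex_f n j) r = coeff 0 r"
      using row[of r] by (cases "r \<le> 2 * n") (auto simp: coeff_eq_0)
  qed
  have yg: "(\<Sum>j<4. y j * ex_g n j) = 0"
  proof (rule poly_eqI)
    fix r
    have "degree (\<Sum>j<4. y j * ex_g n j) \<le> 2 * n + 1" using df by (intro degree_sum_le) auto
    then show "coeff (\<Sum>j<4. y j * ex_g n j) r = coeff 0 r"
      using row[of "r + (2 * n + 1)"] by (cases "r \<le> 2 * n + 1") (auto simp: coeff_eq_0)
  qed
  have "coeff (y 3) 0 = 0" using row[of "4 * n + 3"] by simp
  then have y0: "y i = 0" if "i < 4" for i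
    using that by (intro ex_kernel[OF n _ yf yg]) (rule dy)
  have "v = 0\<^sub>v (4 * Suc n)"
    unfolding vy
  proof (rule eq_vecI)
    fix c assume "c < dim_vec (0\<^sub>v (4 * Suc n) :: complex vec)"
    then have c: "c < 4 * Suc n" by simp
    then have "c div Suc n < 4" by (rule less_mult_imp_div_less)
    then show "rel_vec n y $ c = 0\<^sub>v (4 * Suc n) $ c" using c y0 by (simp add: rel_vec_def)
  qed (simp add: rel_vec_def)
  with v(2) show False by blast
qed

text \<open>The relation \<open>ex_a\<close> is normalised by \<open>ex_a n 3 = 1\<close>, so
  \<open>rel_mat\<close> maps it to the last unit vector and \<open>rel_sol\<close> to
  \<open>det\<close> times that vector.\<close>

lemma rel_sol_ex:
  assumes n: "3 \<le> n" and j: "j < 4"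
  shows "rel_sol n (ex_f n) (ex_g n) j = Polynomial.smult (det (rel_mat n (ex_f n) (ex_g n))) (ex_a n j)"
proof -
  let ?B = "rel_mat n (ex_f n) (ex_g n)"
  have "?B *\<^sub>v rel_vec n (ex_a n) = unit_vec (4 * Suc n) (4 * n + 3)"
  proof (rule eq_vecI)
    fix r assume "r < dim_vec (unit_vec (4 * Suc n) (4 * n + 3) :: complex vec)"
    then have r: "r < 4 * Suc n" by simp
    then show "(?B *\<^sub>v rel_vec n (ex_a n)) $ r = unit_vec (4 * Suc n) (4 * n + 3) $ r"
      using rel_mat_mult_rel_vec[of "ex_a n" n r "ex_f n" "ex_g n"] degree_ex(3)[OF n] ex_relation[OF n]
      by (auto simp: ex_simps)
  qed (simp add: rel_mat_def)
  moreover have sm: "rel_vec n (\<lambda>i. Polynomial.smult (det ?B) (ex_a n i)) = det ?B \<cdot>\<^sub>v rel_vec n (ex_a n)"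
    by (intro eq_vecI) (simp_all add: rel_vec_def)
  ultimately have "?B *\<^sub>v rel_vec n (rel_sol n (ex_f n) (ex_g n)) =
      ?B *\<^sub>v rel_vec n (\<lambda>i. Polynomial.smult (det ?B) (ex_a n i))"
    unfolding rel_mat_mult_rel_sol sm mult_mat_vec[OF rel_mat_carrier rel_vec_carrier] by simp
  then have "rel_vec n (rel_sol n (ex_f n) (ex_g n)) = rel_vec n (\<lambda>i. Polynomial.smult (det ?B) (ex_a n i))"
    by (rule invertible_inj[OF rel_mat_carrier det_rel_mat_ex[OF n] rel_vec_carrier rel_vec_carrier])
  then show ?thesis
  proof (rule rel_vec_inject)
    show "degree (rel_sol n (ex_f n) (ex_g n) i) \<le> n" for i
      unfolding rel_sol_def by (rule degree_rel_polys)
    show "degree (Polynomial.smult (det ?B) (ex_a n i)) \<le> n" if "i < 4" for i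
      using degree_ex(3)[OF n that] by (rule order.trans[OF degree_smult_le])
  qed (rule j)
qed

text \<open>Up to the nonzero factor \<open>d\<close>, each of the four exponents occurs in exactly
  one \<open>ex_a n j\<close>; they are distinct because \<open>n \<ge> 3\<close>.\<close>

lemma det_sol_mat_ex:
  assumes n: "3 \<le> n"
  shows "det (sol_mat n (ex_f n) (ex_g n)) \<noteq> 0"
proof
  let ?S = "sol_mat n (ex_f n) (ex_g n)"
  define d where "d = det (rel_mat n (ex_f n) (ex_g n))"
  have d: "d \<noteq> 0" unfolding d_def by (rule det_rel_mat_ex[OF n])
  have S: "?S \<in> carrier_mat 4 4" by (simp add: sol_mat_def)
  assume "det ?S = 0"
  then obtain v where v: "v \<in> carrier_vec 4" "v \<noteq> 0\<^sub>v 4" "?S *\<^sub>v v = 0\<^sub>v 4"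
    using det_0_iff_vec_prod_zero[OF S] by blast
  have row: "(\<Sum>j<4. d * coeff (ex_a n j) ([0, 1, n - 1, n] ! i) * v $ j) = 0" if "i < 4" for i
  proof -
    have "(?S *\<^sub>v v) $ i = (\<Sum>j<4. coeff (rel_sol n (ex_f n) (ex_g n) j) ([0, 1, n - 1, n] ! i) * v $ j)"
      using that v(1) by (simp add: sol_mat_def scalar_prod_def lessThan_atLeast0)
    also have "\<dots> = (\<Sum>j<4. d * coeff (ex_a n j) ([0, 1, n - 1, n] ! i) * v $ j)"
      by (intro sum.cong refl) (simp add: rel_sol_ex[OF n] d_def)
    finally show ?thesis using v(3) that by simp
  qed
  have "v $ 3 = 0" using row[of 0] d n unfolding sum_lessThan_4 ex_simps by simp
  moreover have n1: "n - Suc 0 \<noteq> Suc 0" "n - Suc 0 \<noteq> n" "n \<noteq> 1" "n - 1 \<noteq> 0" using n by auto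
  then have "v $ 2 = 0" using row[of 1] d n unfolding sum_lessThan_4 ex_simps by simp
  moreover have "v $ 1 = 0" using row[of 2] d n n1 unfolding sum_lessThan_4 ex_simps by simp
  moreover have "v $ 0 = 0" using row[of 3] d n1 unfolding sum_lessThan_4 ex_simps by (simp add: eval_nat_numeral)
  ultimately have "v = 0\<^sub>v 4" using v(1) by (intro eq_vecI) (auto simp: less_4)
  with v(2) show False by blast
qed

lemma rel_mat_cong:
  assumes "\<And>j. j < 4 \<Longrightarrow> f j = f' j" "\<And>j. j < 4 \<Longrightarrow> g j = g' j"
  shows "rel_mat n f g = rel_mat n f' g'"
proof (rule eq_matI)
  fix r c assume rc: "r < dim_row (rel_mat n f' g')" "c < dim_col (rel_mat n f' g')"
  then have "r < 4 * Suc n" "c < 4 * Suc n" by (simp_all add: rel_mat_def)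
  moreover from this(2) have "c div Suc n < 4" by (rule less_mult_imp_div_less)
  ultimately show "rel_mat n f g $$ (r, c) = rel_mat n f' g' $$ (r, c)"
    using assms by (simp add: rel_mat_def)
qed (simp_all add: rel_mat_def)

definition ex_basis :: "nat \<Rightarrow> rvec list" where
  "ex_basis n = map (\<lambda>j. pvec (ex_f n j) (ex_g n j)) [0..<4]"

lemma ex_basis_nth: "j < 4 \<Longrightarrow> ex_basis n ! j = pvec (ex_f n j) (ex_g n j)"
  and length_ex_basis: "length (ex_basis n) = 4"
  by (simp_all add: ex_basis_def)

text \<open>Replacing a row of the identity matrix leaves the new diagonal entry as determinant. So
  the chart coordinates of the example are its own coordinates.\<close>

lemma rows_det_unit_update:
  assumes unit: "\<And>i k. i < 4 \<Longrightarrow> k < 4 \<Longrightarrow> M (xs ! i) k = (if i = k then 1 else 0)"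
    and j: "j < 4" and xs: "length xs = 4"
  shows "rows_det M (xs[j := r]) = M r j"
proof -
  define A where "A = mat 4 4 (\<lambda>(i, k). M (xs[j := r] ! i) k)"
  define v where "v = vec 4 (M r)"
  have A: "A \<in> carrier_mat 4 4" by (simp add: A_def)
  have "transpose_mat A = replace_col (1\<^sub>m 4) (1\<^sub>m 4 *\<^sub>v v) j"
    by (rule eq_matI) (auto simp: A_def v_def replace_col_def unit xs nth_list_update)
  moreover have "det (replace_col (1\<^sub>m 4) (1\<^sub>m 4 *\<^sub>v v) j) = v $ j * det (1\<^sub>m 4)"
    by (rule cramer_lemma_mat) (use j in \<open>auto simp: v_def\<close>)
  ultimately have "det A = M r j"
    using det_transpose[OF A] j by (simp add: v_def)
  then show ?thesis by (simp add: A_def)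
qed

lemma chart_nth_inj: "3 \<le> n \<Longrightarrow> i < 4 \<Longrightarrow> k < 4 \<Longrightarrow> chart n ! i = chart n ! k \<longleftrightarrow> i = k"
  unfolding less_4 by (auto simp: chart_def eval_nat_numeral)

lemma chart_poly_ex:
  assumes n: "3 \<le> n"
  shows "chart_poly n (pluecker (std_basis n) (ex_basis n)) \<noteq> 0"
proof -
  define L where "L = chart_coord n (pluecker (std_basis n) (ex_basis n))"
  define M where "M = coords n (ex_basis n)"
  have M: "f_poly n M j = ex_f n j" "g_poly n M j = ex_g n j" if "j < 4" for j
    unfolding M_def using ex_basis_nth[OF that] degree_ex(1,2)[OF n that] by (rule coords_pvec)+
  have unit: "M (chart n ! i) k = (if i = k then 1 else 0)" if "i < 4" "k < 4" for i k
  proof -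
    have "M (chart n ! i) k = coeff (f_poly n M k) (chart n ! i)"
      using chart_nth_less[OF _ that(1)] n by (simp add: coeff_f_poly)
    then show ?thesis unfolding M[OF that(2)] ex_f_def using chart_nth_inj[OF n that] by auto
  qed
  have L: "L r j = M r j" if "r < Suc n + Suc (Suc n)" "j < 4" for r j
    unfolding L_def chart_coord_pluecker[OF length_ex_basis that(1)] M_def[symmetric]
    by (rule rows_det_unit_update[OF unit that(2) length_chart])
  have eq: "f_poly n L j = ex_f n j" "g_poly n L j = ex_g n j" if "j < 4" for j
    unfolding M[OF that, symmetric]
    by (rule poly_eqI, simp add: coeff_f_poly coeff_g_poly L that)+
  have B: "rel_mat n (f_poly n L) (g_poly n L) = rel_mat n (ex_f n) (ex_g n)"
    by (rule rel_mat_cong) (rule eq; assumption)+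
  then have "sol_mat n (f_poly n L) (g_poly n L) = sol_mat n (ex_f n) (ex_g n)"
    by (simp add: sol_mat_def rel_sol_def)
  with B show ?thesis
    unfolding chart_poly_def L_def[symmetric] using det_rel_mat_ex[OF n] det_sol_mat_ex[OF n] by simp
qed

lemma ex_basis_basis:
  assumes n: "3 \<le> n"
  shows "basis_of (ex_basis n) (CV.span (set (ex_basis n)))" "CV.span (set (ex_basis n)) \<subseteq> sections n"
proof -
  interpret G: good_family n "ex_f n" "ex_g n" "rel_sol n (ex_f n) (ex_g n)"
    by (rule good_family_rel_sol[OF degree_ex(1,2)[OF n] det_rel_mat_ex[OF n] det_sol_mat_ex[OF n]])
  have s: "set (ex_basis n) = G.u ` {..<4}"
    by (simp add: ex_basis_def G.u_def[abs_def] lessThan_atLeast0)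
  have "distinct (ex_basis n)"
    using G.u_indep(1) unfolding ex_basis_def distinct_map G.u_def[abs_def] by (simp add: lessThan_atLeast0)
  then show "basis_of (ex_basis n) (CV.span (set (ex_basis n)))"
    using G.u_indep(2) unfolding basis_of_def s by simp
  show "CV.span (set (ex_basis n)) \<subseteq> sections n"
    unfolding s using G.V_sections unfolding G.V_def .
qed

theorem theorem5p17:
  fixes e :: int and E :: sheaf
  assumes "e \<ge> 3"
    and "E = direct_sum_O [e, e + 1]"
  shows "\<exists>U. zopen_Gr 4 (global_sections E) U \<and> U \<noteq> {} \<and>
    (\<forall>V\<in>U. generated E V \<and> linearly_stable E V \<and>
      (\<forall>vs. basis_of vs V \<longrightarrow>
        vector_bundle (dual_span_bundle vs) \<and> \<not> semistable (dual_span_bundle vs)))"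
proof -
  define n where "n = nat e"
  have n: "3 \<le> n" and E: "E = direct_sum_O [int n, int (Suc n)]"
    using assms by (simp_all add: n_def add.commute)
  \<comment> \<open>With some basis demanded here, the complement demands vanishing at every basis,
    which is the form of \<open>zclosed_Gr\<close>.\<close>
  define U where "U = {V \<in> Gr 4 (sections n). \<exists>vs. basis_of vs V \<and> chart_poly n (pluecker (std_basis n) vs) \<noteq> 0}"
  have "zopen_Gr 4 (sections n) U"
    unfolding zopen_Gr_def zclosed_Gr_def
  proof (intro conjI exI)
    show "U \<subseteq> Gr 4 (sections n)" by (auto simp: U_def)
    show "basis_of (std_basis n) (sections n)" by (rule basis_std_basis)
    show "\<forall>P\<in>{chart_poly n}. \<exists>d. hom_poly d P" using hom_poly_chart_poly[of n] n by simp
    show "Gr 4 (sections n) - U = {V \<in> Gr 4 (sections n).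
        \<forall>vs. basis_of vs V \<longrightarrow> (\<forall>P\<in>{chart_poly n}. P (pluecker (std_basis n) vs) = 0)}"
      by (auto simp: U_def)
  qed
  moreover have "CV.span (set (ex_basis n)) \<in> U"
    unfolding U_def Gr_def using ex_basis_basis[OF n] chart_poly_ex[OF n] length_ex_basis[of n]
    by (auto intro: CV.subspace_span)
  moreover have "generated E V \<and> linearly_stable E V \<and>
      (\<forall>vs. basis_of vs V \<longrightarrow> vector_bundle (dual_span_bundle vs) \<and> \<not> semistable (dual_span_bundle vs))"
    if V: "V \<in> U" for V
  proof -
    obtain vs where vs: "basis_of vs V" "chart_poly n (pluecker (std_basis n) vs) \<noteq> 0"
      using V by (auto simp: U_def)
    obtain ws where ws: "length ws = 4" "basis_of ws V" and sec: "V \<subseteq> sections n"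
      using V by (auto simp: U_def Gr_def)
    have "length xs = CV.dim V" if "basis_of xs V" for xs
      using that CV.dim_span_eq_card_independent[of "set xs"] by (auto simp: basis_of_def distinct_card)
    then have "length vs = 4" using vs(1) ws by metis
    then obtain f g a where G: "good_family n f g a" and VG: "good_family.V f g = V"
      using chart_good[OF _ vs(1) sec vs(2)] by blast
    interpret G: good_family n f g a by (rule G)
    show ?thesis
      using G.V_stable G.dual_span_bundle_V unfolding E VG by blast
  qed
  ultimately show ?thesis unfolding E by blast
qed

end
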